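(* Let $M$ be an algebra with calculus $\Omega^1(M)$, $H$ a Hopf algebra with bicovariant calculus, and $P=M\otimes H$ the tensor product bundle with calculus $\Omega^1(P)$ defined by $N_P=N_M\otimes H\otimes H+M\otimes M\otimes N_H+\Omega^1M\otimes\Omega^1H$. A framing and coframing of $M$ with bundle $P$ are equivalent to data $(V,e,e^* )$ where $V$ is a (finite-dimensional) right $H$-comodule, $e:V\to\Omega^1(M)$ is a $V$-bein and $e^*:V^*\to\Omega^1(M)$ is a $V$-cobein. Under this correspondence the framing and coframing maps and the quantum metric are $$\theta(v)=e(v_{[0]})\otimes v_{[1]}\otimes 1,\qquad \theta^*(w)=e^*(w_{[0]})\otimes 1\otimes w_{[1]},\qquad g=\sum_a e^*(f^a)\otimes_M e(e_a),$$ where $\{e_a\}$ is a basis of $V$ with dual basis $\{f^a\}$.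
   Context: Everything is over a field $k$; $H$ is a Hopf algebra with invertible antipode $S$. For an algebra $M$, $\Omega^1M=\ker(M\otimes M\to M)$ with $\mathrm dm=1\otimes m-m\otimes1$, and a calculus is $\Omega^1(M)=\Omega^1M/N_M$ with $N_M$ a sub-bimodule. A bicovariant calculus on $H$ is given by an $\mathrm{Ad}$-stable right ideal $Q_H\subset\ker\epsilon$, with $\mathrm{Ad}(h)=h_{(2)}\otimes(Sh_{(1)})h_{(3)}$; $N_H$ corresponds to $H\otimes Q_H$ under $h\otimes g\mapsto hg_{(1)}\otimes g_{(2)}$. $P=M\otimes H$ has coaction $\Delta_R=\mathrm{id}\otimes\Delta$; we identify $P\otimes P=M\otimes M\otimes H\otimes H$. In $\Omega^1(P)=\Omega^1P/N_P$ one has $P\Omega^1(M)=\Omega^1(M)\otimes H\otimes 1$ and $\Omega^1(M)P=\Omega^1(M)\otimes 1\otimes H$ (these coincide in $\Omega^1(P)$). Right coactions are written $v\mapsto v_{[0]}\otimes v_{[1]}\in V\otimes H$. $V^*$ is given the right coaction with $\langle v,w_{[0]}\rangle w_{[1]}=\langle v_{[0]},w\rangle S^{-1}v_{[1]}$. $\mathcal E=(P\otimes V)^H$ (invariants under the tensor product coaction), $\mathcal E^*=\hom^H(V,P)$ ($H$-comodule maps). A framing of $M$ with bundle $P$ is a right $H$-comodule $V$ and an equivariant map $\theta:V\to P\Omega^1(M)$ such that $s_\theta:\mathcal E\to\Omega^1(M)$, $p\otimes v\mapsto p\,\theta(v)$, is an isomorphism of left $M$-modules. A coframing is an equivariant map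 $\theta^*:V^*\to\Omega^1(M)P$ such that $s_{\theta^*}:\mathcal E^*\to\Omega^1(M)$, $\phi\mapsto\sum_a\theta^*(f^a)\phi(e_a)$, is an isomorphism of right $M$-modules. The corresponding quantum metric is $g=\sum_a\theta^*(f^a)\otimes_P\theta(e_a)\in\Omega^1(M)\otimes_M\Omega^1(M)$. A $V$-bein is a linear map $e:V\to\Omega^1(M)$ such that $s_e:M\otimes V\to\Omega^1(M)$, $m\otimes v\mapsto m\,e(v)$, is an isomorphism. A $V$-cobein is a linear map $e^*:V^*\to\Omega^1(M)$ such that $s_{e^*}:V^*\otimes M\to\Omega^1(M)$, $w\otimes m\mapsto e^*(w)m$, is an isomorphism. *)

theory Defs
  imports Complex_Main "HOL-Library.Function_Algebras" "HOL-Library.Set_Algebras"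
    "HOL-Library.FuncSet"
begin

section \<open>Vector spaces, tensor products and quotients over a field\<close>

text \<open>
  A vector space is a subspace \<open>car\<close> of a type carrying a scalar multiplication \<open>scl\<close>.
  Field-valued functions form a vector space under the pointwise operations. Tensor products
  and quotients are realised as spaces of such functions, so that they can be iterated:
  \<open>v \<otimes> w\<close> is evaluation at \<open>(v, w)\<close> on the bilinear forms on \<open>V \<times> W\<close>, and the class of \<open>x\<close> in
  \<open>V/N\<close> is evaluation at \<open>x\<close> on the linear forms on \<open>V\<close> vanishing on \<open>N\<close>. Over a field this gives
  the usual tensor product and the usual quotient, as the lemmas \<open>tlift\<close>, \<open>qcls_eq_iff\<close>
  and \<open>qlift\<close> confirm.
\<close>

record ('k, 'a) kspace =
  scl :: "'k \<Rightarrow> 'a \<Rightarrow> 'a"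
  car :: "'a set"

type_synonym ('k, 'a, 'b) tens = "('a \<Rightarrow> 'b \<Rightarrow> 'k) \<Rightarrow> 'k"
type_synonym ('k, 'a) quo = "('a \<Rightarrow> 'k) \<Rightarrow> 'k"

definition vspace :: "('k::field, 'a::ab_group_add) kspace \<Rightarrow> bool" where
  "vspace V \<longleftrightarrow> vector_space (scl V) \<and> module.subspace (scl V) (car V)"

definition lin :: "('k::field, 'a::ab_group_add) kspace \<Rightarrow> ('k, 'b::ab_group_add) kspace
    \<Rightarrow> ('a \<Rightarrow> 'b) \<Rightarrow> bool" where
  "lin V W f \<longleftrightarrow> f \<in> car V \<rightarrow> car W
     \<and> (\<forall>x\<in>car V. \<forall>y\<in>car V. f (x + y) = f x + f y)
     \<and> (\<forall>c. \<forall>x\<in>car V. f (scl V c x) = scl W c (f x))"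

definition bilin :: "('k::field, 'a::ab_group_add) kspace \<Rightarrow> ('k, 'b::ab_group_add) kspace
    \<Rightarrow> ('k, 'c::ab_group_add) kspace \<Rightarrow> ('a \<Rightarrow> 'b \<Rightarrow> 'c) \<Rightarrow> bool" where
  "bilin V W U f \<longleftrightarrow> (\<forall>v\<in>car V. lin W U (f v)) \<and> (\<forall>w\<in>car W. lin V U (\<lambda>v. f v w))"

definition gnd :: "('k::field, 'k) kspace" where
  "gnd = \<lparr>scl = (*), car = UNIV\<rparr>"

definition fscale :: "'k::field \<Rightarrow> ('x \<Rightarrow> 'k) \<Rightarrow> 'x \<Rightarrow> 'k" where
  "fscale c f = (\<lambda>x. c * f x)"

definition dual :: "('k::field, 'a::ab_group_add) kspace \<Rightarrow> ('k, 'a \<Rightarrow> 'k) kspace" where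
  "dual V = \<lparr>scl = fscale, car = {w. lin V gnd w}\<rparr>"

definition tns :: "'a \<Rightarrow> ('k::field, 'a::ab_group_add) kspace \<Rightarrow> ('k, 'b::ab_group_add) kspace
    \<Rightarrow> 'b \<Rightarrow> ('k, 'a, 'b) tens" ("(_ \<otimes>\<^bsub>_,_\<^esub> _)" [71, 0, 0, 70] 70) where
  "v \<otimes>\<^bsub>V,W\<^esub> w = (\<lambda>B. if bilin V W gnd B then B v w else 0)"

text \<open>The image of \<open>A \<otimes> B\<close> in \<open>V \<otimes> W\<close>, for subspaces \<open>A \<subseteq> V\<close> and \<open>B \<subseteq> W\<close>.\<close>

definition tspan :: "('k::field, 'a::ab_group_add) kspace \<Rightarrow> ('k, 'b::ab_group_add) kspace
    \<Rightarrow> 'a set \<Rightarrow> 'b set \<Rightarrow> ('k, 'a, 'b) tens set" where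
  "tspan V W A B = module.span fscale {v \<otimes>\<^bsub>V,W\<^esub> w | v w. v \<in> A \<and> w \<in> B}"

definition tensor :: "('k::field, 'a::ab_group_add) kspace \<Rightarrow> ('k, 'b::ab_group_add) kspace
    \<Rightarrow> ('k, ('k, 'a, 'b) tens) kspace" (infixr "\<otimes>" 70) where
  "V \<otimes> W = \<lparr>scl = fscale, car = tspan V W (car V) (car W)\<rparr>"

text \<open>
  The linear map \<open>V \<otimes> W \<rightarrow> U\<close> induced by a bilinear \<open>f\<close>. With \<open>x = \<Sum>\<^sub>i v\<^sub>i \<otimes> w\<^sub>i\<close>, the term
  \<open>tlift V W U (\<lambda>v w. f v w) x\<close> is \<open>\<Sum>\<^sub>i f v\<^sub>i w\<^sub>i\<close>; applied to a coproduct or coaction it is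
  Sweedler notation.
\<close>

definition tlift :: "('k::field, 'a::ab_group_add) kspace \<Rightarrow> ('k, 'b::ab_group_add) kspace
    \<Rightarrow> ('k, 'c::ab_group_add) kspace \<Rightarrow> ('a \<Rightarrow> 'b \<Rightarrow> 'c) \<Rightarrow> ('k, 'a, 'b) tens \<Rightarrow> 'c" where
  "tlift V W U f = (SOME g. lin (V \<otimes> W) U g
     \<and> (\<forall>v\<in>car V. \<forall>w\<in>car W. g (v \<otimes>\<^bsub>V,W\<^esub> w) = f v w))"

definition qcls :: "('k::field, 'a::ab_group_add) kspace \<Rightarrow> 'a set \<Rightarrow> 'a \<Rightarrow> ('k, 'a) quo" where
  "qcls V N x = (\<lambda>\<phi>. if lin V gnd \<phi> \<and> (\<forall>n\<in>N. \<phi> n = 0) then \<phi> x else 0)"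

definition quot :: "('k::field, 'a::ab_group_add) kspace \<Rightarrow> 'a set
    \<Rightarrow> ('k, ('k, 'a) quo) kspace" where
  "quot V N = \<lparr>scl = fscale, car = qcls V N ` car V\<rparr>"

text \<open>The linear map \<open>V/N \<rightarrow> U\<close> induced by a linear \<open>f\<close> vanishing on \<open>N\<close>.\<close>

definition qlift :: "('k::field, 'a::ab_group_add) kspace \<Rightarrow> 'a set
    \<Rightarrow> ('k, 'c::ab_group_add) kspace \<Rightarrow> ('a \<Rightarrow> 'c) \<Rightarrow> ('k, 'a) quo \<Rightarrow> 'c" where
  "qlift V N U f = (SOME g. lin (quot V N) U g \<and> (\<forall>x\<in>car V. g (qcls V N x) = f x))"


subsection \<open>The universal properties\<close>

lemma vector_space_fscale: "vector_space (fscale :: 'k::field \<Rightarrow> ('x \<Rightarrow> 'k) \<Rightarrow> 'x \<Rightarrow> 'k)"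
  by unfold_locales (auto simp: fscale_def fun_eq_iff algebra_simps)

lemma vector_space_gnd: "vector_space ((*) :: 'k::field \<Rightarrow> 'k \<Rightarrow> 'k)"
  by unfold_locales (auto simp: algebra_simps)

lemma linear_form_separates:
  fixes s :: "'k::field \<Rightarrow> 'a::ab_group_add \<Rightarrow> 'a"
  assumes "vector_space s" and "module.subspace s N" and "x \<notin> N"
  obtains \<phi> :: "'a \<Rightarrow> 'k" where "Vector_Spaces.linear s (*) \<phi>" "\<And>n. n \<in> N \<Longrightarrow> \<phi> n = 0" "\<phi> x = 1"
proof -
  interpret vector_space s by fact
  interpret g: vector_space "(*) :: 'k \<Rightarrow> 'k \<Rightarrow> 'k" by (rule vector_space_gnd)
  interpret p: vector_space_pair s "(*) :: 'k \<Rightarrow> 'k \<Rightarrow> 'k" ..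
  obtain B where B: "B \<subseteq> N" "independent B" "span B = N"
    using basis_exists[of N] assms(2) span_minimal by (metis subset_antisym)
  have ind: "independent (insert x B)"
    using B assms(3) by (simp add: independent_insert)
  obtain \<phi> where \<phi>: "Vector_Spaces.linear s (*) \<phi>"
      "\<forall>b\<in>insert x B. \<phi> b = (if b = x then 1 else (0::'k))"
    using p.linear_independent_extend[OF ind, of "\<lambda>b. if b = x then 1 else 0"] by blast
  have xB: "x \<notin> B" using B assms(3) by blast
  have "\<phi> b = 0" if "b \<in> B" for b
    using \<phi>(2) xB that by auto
  then have "\<phi> n = 0" if "n \<in> N" for n
    using p.linear_eq_0_on_span[OF \<phi>(1), of B n] that B(3) by blast
  with \<phi> that show thesis by simp
qed

lemma linear_extend_relations:
  fixes s1 :: "'k::field \<Rightarrow> 'a::ab_group_add \<Rightarrow> 'a" and s2 :: "'k \<Rightarrow> 'b::ab_group_add \<Rightarrow> 'b"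
  assumes "vector_space s1" "vector_space s2"
    and rel: "\<And>F c. finite F \<Longrightarrow> F \<subseteq> X \<Longrightarrow> (\<Sum>x\<in>F. s1 (c x) (d x)) = 0 \<Longrightarrow> (\<Sum>x\<in>F. s2 (c x) (f x)) = 0"
  obtains g where "Vector_Spaces.linear s1 s2 g" "\<And>x. x \<in> X \<Longrightarrow> g (d x) = f x"
proof -
  interpret a: vector_space s1 by fact
  interpret b: vector_space s2 by fact
  interpret p: vector_space_pair s1 s2 ..
  obtain B where B: "B \<subseteq> d ` X" "a.independent B" "d ` X \<subseteq> a.span B"
    by (rule a.maximal_independent_subset[of "d ` X"])
  define r where "r = inv_into X d"
  have r: "r b \<in> X" "d (r b) = b" if "b \<in> B" for b
    using B(1) that by (auto simp: r_def inv_into_into f_inv_into_f)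
  obtain g where g: "Vector_Spaces.linear s1 s2 g" "\<And>b. b \<in> B \<Longrightarrow> g b = f (r b)"
    using p.linear_independent_extend[OF B(2), of "\<lambda>b. f (r b)"] by blast
  have "g (d x) = f x" if x: "x \<in> X" for x
  proof -
    obtain t c where t: "finite t" "t \<subseteq> B" "d x = (\<Sum>b\<in>t. s1 (c b) b)"
      using B(3) x unfolding a.span_explicit by blast
    define F where "F = r ` t"
    have inj: "inj_on r t" using t(2) r by (intro inj_on_inverseI[where g = d]) blast
    define c' where "c' y = (if y = x then -1 else 0) + (if y \<in> F then c (d y) else 0)" for y
    have fin: "finite (insert x F)" using t by (simp add: F_def)
    have sub: "insert x F \<subseteq> X" using t(2) r x by (auto simp: F_def)
    have *: "(\<Sum>y\<in>insert x F. s (c' y) (h y)) = (\<Sum>b\<in>t. s (c b) (h (r b))) - h x"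
      if "vector_space s" for s :: "'k \<Rightarrow> 'z::ab_group_add \<Rightarrow> 'z" and h
    proof -
      interpret z: vector_space s by fact
      have "(\<Sum>y\<in>insert x F. s (c' y) (h y))
          = (\<Sum>y\<in>insert x F. s (if y = x then -1 else 0) (h y))
            + (\<Sum>y\<in>insert x F. s (if y \<in> F then c (d y) else 0) (h y))"
        by (simp only: c'_def z.scale_left_distrib sum.distrib)
      also have "(\<Sum>y\<in>insert x F. s (if y = x then -1 else 0) (h y)) = (\<Sum>y\<in>{x}. s (-1) (h y))"
        using fin by (intro sum.mono_neutral_cong_right) auto
      also have "(\<Sum>y\<in>insert x F. s (if y \<in> F then c (d y) else 0) (h y)) = (\<Sum>y\<in>F. s (c (d y)) (h y))"
        using fin by (intro sum.mono_neutral_cong_right) auto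
      also have "\<dots> = (\<Sum>b\<in>t. s (c (d (r b))) (h (r b)))"
        unfolding F_def using inj by (simp add: sum.reindex)
      also have "\<dots> = (\<Sum>b\<in>t. s (c b) (h (r b)))"
        using t(2) r by (intro sum.cong) auto
      finally show ?thesis by simp
    qed
    have "(\<Sum>b\<in>t. s1 (c b) (d (r b))) = d x"
      unfolding t(3) using t(2) r by (intro sum.cong) auto
    then have "(\<Sum>y\<in>insert x F. s1 (c' y) (d y)) = 0"
      using *[OF assms(1), of d] by simp
    then have "(\<Sum>y\<in>insert x F. s2 (c' y) (f y)) = 0"
      by (rule rel[OF fin sub])
    then have "(\<Sum>b\<in>t. s2 (c b) (f (r b))) = f x"
      using *[OF assms(2), of f] by simp
    moreover have "g (d x) = (\<Sum>b\<in>t. s2 (c b) (f (r b)))"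
      unfolding t(3) p.linear_sum[OF g(1)] p.linear_scale[OF g(1)]
      using t(2) g(2) by (intro sum.cong) auto
    ultimately show ?thesis by simp
  qed
  with g(1) that show thesis by blast
qed

lemma extend_evaluations:
  fixes U :: "('k::field, 'c::ab_group_add) kspace" and f :: "'x \<Rightarrow> 'c"
    and d :: "'x \<Rightarrow> 'y \<Rightarrow> 'k"
  assumes "vspace U"
    and ev: "\<And>\<psi>. Vector_Spaces.linear (scl U) (*) \<psi> \<Longrightarrow> \<exists>B. \<forall>x\<in>X. d x B = \<psi> (f x)"
  shows "\<exists>g. Vector_Spaces.linear fscale (scl U) g \<and> (\<forall>x\<in>X. g (d x) = f x)"
proof -
  have U: "vector_space (scl U)" using assms(1) by (simp add: vspace_def)
  interpret u: vector_space "scl U" by fact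
  have sum_app: "(\<Sum>x\<in>F. fscale (c x) (d x)) B = (\<Sum>x\<in>F. c x * d x B)" for F c B
    by (induction F rule: infinite_finite_induct) (auto simp: fscale_def)
  show ?thesis
  proof (rule linear_extend_relations[where d = d and f = f and X = X, OF vector_space_fscale U])
    fix F c assume F: "finite F" "F \<subseteq> X" "(\<Sum>x\<in>F. fscale (c x) (d x)) = 0"
    show "(\<Sum>x\<in>F. scl U (c x) (f x)) = 0"
    proof (rule ccontr)
      assume "(\<Sum>x\<in>F. scl U (c x) (f x)) \<noteq> 0"
      then have "(\<Sum>x\<in>F. scl U (c x) (f x)) \<notin> {0}" by simp
      then obtain \<psi> where \<psi>: "Vector_Spaces.linear (scl U) (*) \<psi>" "\<psi> (\<Sum>x\<in>F. scl U (c x) (f x)) = 1"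
        by (rule linear_form_separates[OF U u.subspace_single_0])
      interpret l: Vector_Spaces.linear "scl U" "(*)" \<psi> by fact
      obtain B where B: "\<forall>x\<in>X. d x B = \<psi> (f x)" using ev[OF \<psi>(1)] by blast
      have "(\<Sum>x\<in>F. c x * d x B) = 0" using sum_app[of c F B] unfolding F(3) by simp
      moreover have "(\<Sum>x\<in>F. c x * d x B) = (\<Sum>x\<in>F. c x * \<psi> (f x))"
        using F(2) B by (intro sum.cong) auto
      ultimately show False using \<psi>(2) by (simp add: l.sum l.scale)
    qed
  next
    fix g assume "Vector_Spaces.linear fscale (scl U) g" "\<And>x. x \<in> X \<Longrightarrow> g (d x) = f x"
    then show ?thesis by blast
  qed
qed

lemma lin_compose_linear:
  assumes "lin V U f" and "Vector_Spaces.linear (scl U) (*) \<psi>"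
  shows "lin V gnd (\<lambda>x. \<psi> (f x))"
proof -
  interpret l: Vector_Spaces.linear "scl U" "(*)" \<psi> by fact
  show ?thesis using assms(1) by (auto simp: lin_def gnd_def l.add l.scale)
qed

lemma lin_of_linear:
  assumes "Vector_Spaces.linear (scl V) (scl W) g" and "g ` car V \<subseteq> car W"
  shows "lin V W g"
proof -
  interpret l: Vector_Spaces.linear "scl V" "scl W" g by fact
  show ?thesis using assms(2) by (auto simp: lin_def l.add l.scale)
qed

lemma tlift:
  assumes "vspace U" and "bilin V W U f"
  shows "lin (V \<otimes> W) U (tlift V W U f)"
    and "v \<in> car V \<Longrightarrow> w \<in> car W \<Longrightarrow> tlift V W U f (v \<otimes>\<^bsub>V,W\<^esub> w) = f v w"
proof -
  have "\<exists>B. \<forall>x\<in>car V \<times> car W. (fst x \<otimes>\<^bsub>V,W\<^esub> snd x) B = \<psi> (f (fst x) (snd x))"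
    if "Vector_Spaces.linear (scl U) (*) \<psi>" for \<psi>
  proof -
    have "bilin V W gnd (\<lambda>v w. \<psi> (f v w))"
      using assms(2) lin_compose_linear[OF _ that, of V "\<lambda>v. f v _"]
        lin_compose_linear[OF _ that, of W "f _"] by (simp add: bilin_def)
    then show ?thesis by (intro exI[of _ "\<lambda>v w. \<psi> (f v w)"]) (simp add: tns_def)
  qed
  then obtain g where g: "Vector_Spaces.linear fscale (scl U) g"
      "\<And>x. x \<in> car V \<times> car W \<Longrightarrow> g (fst x \<otimes>\<^bsub>V,W\<^esub> snd x) = f (fst x) (snd x)"
    using extend_evaluations[OF assms(1), of "car V \<times> car W"
        "\<lambda>x. fst x \<otimes>\<^bsub>V,W\<^esub> snd x" "\<lambda>x. f (fst x) (snd x)"] by force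
  have g2: "\<forall>v\<in>car V. \<forall>w\<in>car W. g (v \<otimes>\<^bsub>V,W\<^esub> w) = f v w"
    using g(2)[of "(_, _)"] by simp
  interpret l: Vector_Spaces.linear fscale "scl U" g by fact
  have fU: "f v w \<in> car U" if "v \<in> car V" "w \<in> car W" for v w
    using assms(2) that by (auto simp: bilin_def lin_def)
  have "g ` {v \<otimes>\<^bsub>V,W\<^esub> w | v w. v \<in> car V \<and> w \<in> car W} \<subseteq> car U"
    using g2 fU by auto
  then have "l.vs2.span (g ` {v \<otimes>\<^bsub>V,W\<^esub> w | v w. v \<in> car V \<and> w \<in> car W}) \<subseteq> car U"
    using l.vs2.span_minimal assms(1) unfolding vspace_def by blast
  then have "g ` car (V \<otimes> W) \<subseteq> car U"
    by (simp only: l.span_image tensor_def tspan_def kspace.select_convs)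
  then have "lin (V \<otimes> W) U g"
    using g(1) by (intro lin_of_linear) (simp_all add: tensor_def)
  with g2 have "lin (V \<otimes> W) U g \<and> (\<forall>v\<in>car V. \<forall>w\<in>car W. g (v \<otimes>\<^bsub>V,W\<^esub> w) = f v w)"
    by simp
  then have "lin (V \<otimes> W) U (tlift V W U f)
     \<and> (\<forall>v\<in>car V. \<forall>w\<in>car W. tlift V W U f (v \<otimes>\<^bsub>V,W\<^esub> w) = f v w)"
    unfolding tlift_def
    by (rule someI[where P = "\<lambda>g. lin (V \<otimes> W) U g
      \<and> (\<forall>v\<in>car V. \<forall>w\<in>car W. g (v \<otimes>\<^bsub>V,W\<^esub> w) = f v w)"])
  then show "lin (V \<otimes> W) U (tlift V W U f)"
    and "v \<in> car V \<Longrightarrow> w \<in> car W \<Longrightarrow> tlift V W U f (v \<otimes>\<^bsub>V,W\<^esub> w) = f v w"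
    by blast+
qed

lemma qcls_eq_iff:
  assumes "vspace V" and "module.subspace (scl V) N" and "N \<subseteq> car V"
    and "x \<in> car V" and "y \<in> car V"
  shows "qcls V N x = qcls V N y \<longleftrightarrow> x - y \<in> N"
proof -
  have V: "vector_space (scl V)" using assms(1) by (simp add: vspace_def)
  interpret vector_space "scl V" by fact
  have sub: "subspace (car V)" using assms(1) by (simp add: vspace_def)
  have diff: "\<phi> x = \<phi> (x - y) + \<phi> y" if "lin V gnd \<phi>" for \<phi>
  proof -
    have "x - y \<in> car V" using sub assms(4,5) by (rule subspace_diff)
    then have "\<phi> (x - y + y) = \<phi> (x - y) + \<phi> y"
      using that assms(5) unfolding lin_def by blast
    then show ?thesis by simp
  qed
  show ?thesis
  proof
    assume "x - y \<in> N"
    then show "qcls V N x = qcls V N y" by (auto simp: qcls_def fun_eq_iff dest: diff)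
  next
    assume eq: "qcls V N x = qcls V N y"
    show "x - y \<in> N"
    proof (rule ccontr)
      assume "x - y \<notin> N"
      then obtain \<phi> where \<phi>: "Vector_Spaces.linear (scl V) (*) \<phi>" "\<And>n. n \<in> N \<Longrightarrow> \<phi> n = 0" "\<phi> (x - y) = 1"
        by (rule linear_form_separates[OF V assms(2)]) iprover
      have "lin V gnd \<phi>" using \<phi>(1) by (intro lin_of_linear) (simp_all add: gnd_def)
      then show False using fun_cong[OF eq, of \<phi>] \<phi>(2,3) diff[of \<phi>] by (simp add: qcls_def)
    qed
  qed
qed

lemma qlift:
  assumes "vspace V" and "vspace U" and "lin V U f" and "\<And>n. n \<in> N \<Longrightarrow> f n = 0"
  shows "lin (quot V N) U (qlift V N U f)"
    and "x \<in> car V \<Longrightarrow> qlift V N U f (qcls V N x) = f x"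
proof -
  have "\<exists>\<phi>. \<forall>x\<in>car V. qcls V N x \<phi> = \<psi> (f x)"
    if "Vector_Spaces.linear (scl U) (*) \<psi>" for \<psi>
  proof -
    interpret l: Vector_Spaces.linear "scl U" "(*)" \<psi> by fact
    have "lin V gnd (\<lambda>x. \<psi> (f x))" by (rule lin_compose_linear[OF assms(3) that])
    then show ?thesis
      by (intro exI[of _ "\<lambda>x. \<psi> (f x)"]) (simp add: qcls_def assms(4) l.zero)
  qed
  then obtain g where g: "Vector_Spaces.linear fscale (scl U) g"
      "\<And>x. x \<in> car V \<Longrightarrow> g (qcls V N x) = f x"
    using extend_evaluations[OF assms(2), of "car V" "qcls V N" f] by force
  have "g ` car (quot V N) \<subseteq> car U"
    using g(2) assms(3) by (auto simp: quot_def lin_def)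
  then have "lin (quot V N) U g"
    using g(1) by (intro lin_of_linear) (simp_all add: quot_def)
  with g(2) have "lin (quot V N) U g \<and> (\<forall>x\<in>car V. g (qcls V N x) = f x)"
    by simp
  then have "lin (quot V N) U (qlift V N U f)
     \<and> (\<forall>x\<in>car V. qlift V N U f (qcls V N x) = f x)"
    unfolding qlift_def
    by (rule someI[where P = "\<lambda>g. lin (quot V N) U g \<and> (\<forall>x\<in>car V. g (qcls V N x) = f x)"])
  then show "lin (quot V N) U (qlift V N U f)"
    and "x \<in> car V \<Longrightarrow> qlift V N U f (qcls V N x) = f x"
    by blast+
qed


section \<open>Algebras and their first order calculi\<close>

type_synonym ('k, 'a) form = "('k, ('k, 'a, 'a) tens) quo"

definition algebra_mult :: "('k::field, 'a::{ring, monoid_mult}) kspace \<Rightarrow> ('k, 'a, 'a) tens \<Rightarrow> 'a" where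
  "algebra_mult A = tlift A A A (\<lambda>a b. a * b)"

text \<open>The sort \<open>{ring, monoid_mult}\<close> is that of unital rings, the zero ring included.\<close>

locale k_algebra =
  fixes A :: "('k::field, 'a::{ring, monoid_mult}) kspace"
  assumes vector_space_scl: "vector_space (scl A)"
    and car_UNIV: "car A = UNIV"
    and mult_scl_left: "scl A c x * y = scl A c (x * y)"
    and mult_scl_right: "x * scl A c y = scl A c (x * y)"

text \<open>The multiplication of the tensor product algebra \<open>A \<otimes> B\<close>.\<close>

definition tmult :: "('k::field, 'a::{ring, monoid_mult}) kspace
    \<Rightarrow> ('k, 'b::{ring, monoid_mult}) kspace
    \<Rightarrow> ('k, 'a, 'b) tens \<Rightarrow> ('k, 'a, 'b) tens \<Rightarrow> ('k, 'a, 'b) tens" where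
  "tmult A B x y = tlift A B (A \<otimes> B)
     (\<lambda>a b. tlift A B (A \<otimes> B) (\<lambda>a' b'. (a * a') \<otimes>\<^bsub>A,B\<^esub> (b * b')) y) x"

text \<open>The outer bimodule structure of \<open>A \<otimes> A\<close>.\<close>

definition lmul :: "('k::field, 'a::{ring, monoid_mult}) kspace \<Rightarrow> 'a
    \<Rightarrow> ('k, 'a, 'a) tens \<Rightarrow> ('k, 'a, 'a) tens" where
  "lmul A a = tlift A A (A \<otimes> A) (\<lambda>x y. (a * x) \<otimes>\<^bsub>A,A\<^esub> y)"

definition rmul :: "('k::field, 'a::{ring, monoid_mult}) kspace
    \<Rightarrow> ('k, 'a, 'a) tens \<Rightarrow> 'a \<Rightarrow> ('k, 'a, 'a) tens" where
  "rmul A z a = tlift A A (A \<otimes> A) (\<lambda>x y. x \<otimes>\<^bsub>A,A\<^esub> (y * a)) z"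

definition univ_forms :: "('k::field, 'a::{ring, monoid_mult}) kspace \<Rightarrow> ('k, 'a, 'a) tens set" where
  "univ_forms A = {z \<in> car (A \<otimes> A). algebra_mult A z = 0}"

definition calculus :: "('k::field, 'a::{ring, monoid_mult}) kspace
    \<Rightarrow> ('k, 'a, 'a) tens set \<Rightarrow> bool" where
  "calculus A N \<longleftrightarrow> module.subspace fscale N \<and> N \<subseteq> univ_forms A
     \<and> (\<forall>a. \<forall>n\<in>N. lmul A a n \<in> N \<and> rmul A n a \<in> N)"

text \<open>\<open>\<Omega>\<^sup>1(A)\<close>, as the subspace \<open>\<Omega>\<^sup>1A/N\<close> of \<open>(A \<otimes> A)/N\<close>.\<close>

definition forms :: "('k::field, 'a::{ring, monoid_mult}) kspace \<Rightarrow> ('k, 'a, 'a) tens set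
    \<Rightarrow> ('k, ('k, 'a) form) kspace" where
  "forms A N = \<lparr>scl = fscale, car = qcls (A \<otimes> A) N ` univ_forms A\<rparr>"

definition lact :: "('k::field, 'a::{ring, monoid_mult}) kspace \<Rightarrow> ('k, 'a, 'a) tens set
    \<Rightarrow> 'a \<Rightarrow> ('k, 'a) form \<Rightarrow> ('k, 'a) form" where
  "lact A N a = qlift (A \<otimes> A) N (quot (A \<otimes> A) N) (\<lambda>z. qcls (A \<otimes> A) N (lmul A a z))"

definition ract :: "('k::field, 'a::{ring, monoid_mult}) kspace \<Rightarrow> ('k, 'a, 'a) tens set
    \<Rightarrow> ('k, 'a) form \<Rightarrow> 'a \<Rightarrow> ('k, 'a) form" where
  "ract A N \<omega> a = qlift (A \<otimes> A) N (quot (A \<otimes> A) N) (\<lambda>z. qcls (A \<otimes> A) N (rmul A z a)) \<omega>"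

text \<open>An isomorphism of (left or right) modules, the scalars acting through \<open>aX\<close> and \<open>aY\<close>.\<close>

definition module_iso :: "('k::field, 'x::ab_group_add) kspace \<Rightarrow> ('k, 'y::ab_group_add) kspace
    \<Rightarrow> ('r \<Rightarrow> 'x \<Rightarrow> 'x) \<Rightarrow> ('r \<Rightarrow> 'y \<Rightarrow> 'y) \<Rightarrow> ('x \<Rightarrow> 'y) \<Rightarrow> bool" where
  "module_iso X Y aX aY f \<longleftrightarrow> lin X Y f \<and> bij_betw f (car X) (car Y)
     \<and> (\<forall>r. \<forall>x\<in>car X. f (aX r x) = aY r (f x))"

text \<open>
  The tensor product of a right module \<open>X\<close> (action \<open>r\<close>) and a left module \<open>Y\<close> (action \<open>l\<close>) over an
  algebra with underlying set \<open>R\<close>.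
\<close>

definition balancing :: "'r set \<Rightarrow> ('k::field, 'x::ab_group_add) kspace \<Rightarrow> ('x \<Rightarrow> 'r \<Rightarrow> 'x)
    \<Rightarrow> ('k, 'y::ab_group_add) kspace \<Rightarrow> ('r \<Rightarrow> 'y \<Rightarrow> 'y) \<Rightarrow> ('k, 'x, 'y) tens set" where
  "balancing R X r Y l = module.span fscale
     {(r x a \<otimes>\<^bsub>X,Y\<^esub> y) - (x \<otimes>\<^bsub>X,Y\<^esub> l a y) | x a y. x \<in> car X \<and> a \<in> R \<and> y \<in> car Y}"

definition btensor :: "'r set \<Rightarrow> ('k::field, 'x::ab_group_add) kspace \<Rightarrow> ('x \<Rightarrow> 'r \<Rightarrow> 'x)
    \<Rightarrow> ('k, 'y::ab_group_add) kspace \<Rightarrow> ('r \<Rightarrow> 'y \<Rightarrow> 'y)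
    \<Rightarrow> ('k, ('k, ('k, 'x, 'y) tens) quo) kspace" where
  "btensor R X r Y l = quot (X \<otimes> Y) (balancing R X r Y l)"

definition btns :: "'r set \<Rightarrow> ('k::field, 'x::ab_group_add) kspace \<Rightarrow> ('x \<Rightarrow> 'r \<Rightarrow> 'x)
    \<Rightarrow> ('k, 'y::ab_group_add) kspace \<Rightarrow> ('r \<Rightarrow> 'y \<Rightarrow> 'y)
    \<Rightarrow> 'x \<Rightarrow> 'y \<Rightarrow> ('k, ('k, 'x, 'y) tens) quo" where
  "btns R X r Y l x y = qcls (X \<otimes> Y) (balancing R X r Y l) (x \<otimes>\<^bsub>X,Y\<^esub> y)"


section \<open>Hopf algebras, comodules and bicovariant calculi\<close>

locale hopf_algebra = k_algebra H for H :: "('k::field, 'h::ring_1) kspace" +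
  fixes \<Delta> :: "'h \<Rightarrow> ('k, 'h, 'h) tens" and \<epsilon> :: "'h \<Rightarrow> 'k" and S :: "'h \<Rightarrow> 'h"
  assumes lin_comult: "lin H (H \<otimes> H) \<Delta>"
    and coassoc: "tlift H H (H \<otimes> H \<otimes> H)
          (\<lambda>a c. tlift H H (H \<otimes> H \<otimes> H) (\<lambda>x y. x \<otimes>\<^bsub>H,H \<otimes> H\<^esub> (y \<otimes>\<^bsub>H,H\<^esub> c)) (\<Delta> a)) (\<Delta> h)
        = tlift H H (H \<otimes> H \<otimes> H) (\<lambda>a b. a \<otimes>\<^bsub>H,H \<otimes> H\<^esub> \<Delta> b) (\<Delta> h)"
    and lin_counit: "lin H gnd \<epsilon>"
    and counit_left: "tlift H H H (\<lambda>a b. scl H (\<epsilon> a) b) (\<Delta> h) = h"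
    and counit_right: "tlift H H H (\<lambda>a b. scl H (\<epsilon> b) a) (\<Delta> h) = h"
    and comult_one: "\<Delta> 1 = 1 \<otimes>\<^bsub>H,H\<^esub> 1"
    and comult_mult: "\<Delta> (g * h) = tmult H H (\<Delta> g) (\<Delta> h)"
    and counit_one: "\<epsilon> 1 = 1"
    and counit_mult: "\<epsilon> (g * h) = \<epsilon> g * \<epsilon> h"
    and lin_antipode: "lin H H S"
    and antipode_left: "tlift H H H (\<lambda>a b. S a * b) (\<Delta> h) = scl H (\<epsilon> h) 1"
    and antipode_right: "tlift H H H (\<lambda>a b. a * S b) (\<Delta> h) = scl H (\<epsilon> h) 1"

locale right_comodule =
  fixes H :: "('k::field, 'h::ring_1) kspace"
    and \<Delta> :: "'h \<Rightarrow> ('k, 'h, 'h) tens" and \<epsilon> :: "'h \<Rightarrow> 'k"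
    and V :: "('k, 'v::ab_group_add) kspace" and \<rho> :: "'v \<Rightarrow> ('k, 'v, 'h) tens"
  assumes vector_space_scl: "vector_space (scl V)"
    and car_UNIV: "car V = UNIV"
    and lin_coaction: "lin V (V \<otimes> H) \<rho>"
    and coaction_coassoc: "tlift V H (V \<otimes> H \<otimes> H)
          (\<lambda>u c. tlift V H (V \<otimes> H \<otimes> H) (\<lambda>x y. x \<otimes>\<^bsub>V,H \<otimes> H\<^esub> (y \<otimes>\<^bsub>H,H\<^esub> c)) (\<rho> u)) (\<rho> v)
        = tlift V H (V \<otimes> H \<otimes> H) (\<lambda>u b. u \<otimes>\<^bsub>V,H \<otimes> H\<^esub> \<Delta> b) (\<rho> v)"
    and coaction_counit: "tlift V H V (\<lambda>u b. scl V (\<epsilon> b) u) (\<rho> v) = v"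

text \<open>\<open>Ad h = h\<^sub>(\<^sub>2\<^sub>) \<otimes> S h\<^sub>(\<^sub>1\<^sub>) h\<^sub>(\<^sub>3\<^sub>)\<close>\<close>

definition Ad :: "('k::field, 'h::ring_1) kspace \<Rightarrow> ('h \<Rightarrow> ('k, 'h, 'h) tens) \<Rightarrow> ('h \<Rightarrow> 'h)
    \<Rightarrow> 'h \<Rightarrow> ('k, 'h, 'h) tens" where
  "Ad H \<Delta> S h = tlift H H (H \<otimes> H)
     (\<lambda>h1 b. tlift H H (H \<otimes> H) (\<lambda>h2 h3. h2 \<otimes>\<^bsub>H,H\<^esub> (S h1 * h3)) (\<Delta> b)) (\<Delta> h)"

definition bicovariant_ideal :: "('k::field, 'h::ring_1) kspace \<Rightarrow> ('h \<Rightarrow> ('k, 'h, 'h) tens)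
    \<Rightarrow> ('h \<Rightarrow> 'k) \<Rightarrow> ('h \<Rightarrow> 'h) \<Rightarrow> 'h set \<Rightarrow> bool" where
  "bicovariant_ideal H \<Delta> \<epsilon> S Q \<longleftrightarrow> module.subspace (scl H) Q \<and> Q \<subseteq> {q. \<epsilon> q = 0}
     \<and> (\<forall>q\<in>Q. \<forall>h. q * h \<in> Q) \<and> (\<forall>q\<in>Q. Ad H \<Delta> S q \<in> tspan H H Q UNIV)"

text \<open>
  \<open>h \<otimes> g \<mapsto> h g\<^sub>(\<^sub>1\<^sub>) \<otimes> g\<^sub>(\<^sub>2\<^sub>)\<close> maps \<open>\<Omega>\<^sup>1H\<close> isomorphically onto \<open>H \<otimes> ker \<epsilon>\<close>, and \<open>N\<^sub>H\<close> is the
  part of \<open>\<Omega>\<^sup>1H\<close> going to \<open>H \<otimes> Q\<close>.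
\<close>

definition bicovariant_relations :: "('k::field, 'h::ring_1) kspace
    \<Rightarrow> ('h \<Rightarrow> ('k, 'h, 'h) tens) \<Rightarrow> 'h set \<Rightarrow> ('k, 'h, 'h) tens set" where
  "bicovariant_relations H \<Delta> Q = {z \<in> univ_forms H.
     tlift H H (H \<otimes> H) (\<lambda>h g. tlift H H (H \<otimes> H) (\<lambda>g1 g2. (h * g1) \<otimes>\<^bsub>H,H\<^esub> g2) (\<Delta> g)) z
       \<in> tspan H H UNIV Q}"


section \<open>The tensor product bundle\<close>

type_synonym ('k, 'm, 'h) btens = "('k, ('k, 'm, 'm) tens, ('k, 'h, 'h) tens) tens"
type_synonym ('k, 'm, 'h) bform = "('k, ('k, 'm, 'h) btens) quo"

context
  fixes M :: "('k::field, 'm::{ring, monoid_mult}) kspace"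
    and N\<^sub>M :: "('k, 'm, 'm) tens set"
    and H :: "('k, 'h::ring_1) kspace"
    and \<Delta> :: "'h \<Rightarrow> ('k, 'h, 'h) tens"
    and S :: "'h \<Rightarrow> 'h"
    and Q :: "'h set"
    and V :: "('k, 'v::ab_group_add) kspace"
    and \<rho> :: "'v \<Rightarrow> ('k, 'v, 'h) tens"
    and B :: "'v set"
begin

private abbreviation (input) "P \<equiv> M \<otimes> H"

text \<open>\<open>P \<otimes> P\<close>, with \<open>(m \<otimes> h) \<otimes> (m' \<otimes> h')\<close> written as \<open>(m \<otimes> m') \<otimes> (h \<otimes> h')\<close>.\<close>

private abbreviation (input) "PP \<equiv> (M \<otimes> M) \<otimes> (H \<otimes> H)"

private abbreviation (input) pp :: "('k, 'm, 'm) tens \<Rightarrow> ('k, 'h, 'h) tens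
    \<Rightarrow> ('k, 'm, 'h) btens" where
  "pp x y \<equiv> x \<otimes>\<^bsub>M \<otimes> M,H \<otimes> H\<^esub> y"

definition bundle_univ_forms :: "('k, 'm, 'h) btens set" where
  "bundle_univ_forms = {z \<in> car PP.
     tlift (M \<otimes> M) (H \<otimes> H) P (\<lambda>x y. algebra_mult M x \<otimes>\<^bsub>M,H\<^esub> algebra_mult H y) z = 0}"

definition N\<^sub>P :: "('k, 'm, 'h) btens set" where
  "N\<^sub>P = tspan (M \<otimes> M) (H \<otimes> H) N\<^sub>M (car (H \<otimes> H))
     + tspan (M \<otimes> M) (H \<otimes> H) (car (M \<otimes> M)) (bicovariant_relations H \<Delta> Q)
     + tspan (M \<otimes> M) (H \<otimes> H) (univ_forms M) (univ_forms H)"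

private abbreviation (input) "PP_N \<equiv> quot PP N\<^sub>P"

definition bundle_forms ::
    "('k, ('k, 'm, 'h) bform) kspace" where
  "bundle_forms = \<lparr>scl = fscale, car = qcls PP N\<^sub>P ` bundle_univ_forms\<rparr>"

definition P_lact :: "('k, 'm, 'h) tens
    \<Rightarrow> ('k, 'm, 'h) bform
    \<Rightarrow> ('k, 'm, 'h) bform" where
  "P_lact p = qlift PP N\<^sub>P PP_N (\<lambda>z. qcls PP N\<^sub>P
     (tlift M H PP (\<lambda>m h.
        tlift (M \<otimes> M) (H \<otimes> H) PP (\<lambda>x y. pp (lmul M m x) (lmul H h y)) z) p))"

definition P_ract :: "('k, 'm, 'h) bform
    \<Rightarrow> ('k, 'm, 'h) tens
    \<Rightarrow> ('k, 'm, 'h) bform" where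
  "P_ract \<zeta> p = qlift PP N\<^sub>P PP_N (\<lambda>z. qcls PP N\<^sub>P
     (tlift M H PP (\<lambda>m h.
        tlift (M \<otimes> M) (H \<otimes> H) PP (\<lambda>x y. pp (rmul M x m) (rmul H y h)) z) p)) \<zeta>"

text \<open>\<open>\<omega> \<otimes> h \<otimes> h'\<close> in \<open>\<Omega>\<^sup>1(P)\<close>, for \<open>\<omega> \<in> \<Omega>\<^sup>1(M)\<close>, and the inclusion of \<open>\<Omega>\<^sup>1(M)\<close> in \<open>\<Omega>\<^sup>1(P)\<close>.\<close>

definition extend :: "('k, 'm) form \<Rightarrow> 'h \<Rightarrow> 'h
    \<Rightarrow> ('k, 'm, 'h) bform" where
  "extend \<omega> h h' = qlift (M \<otimes> M) N\<^sub>M PP_N (\<lambda>x. qcls PP N\<^sub>P (pp x (h \<otimes>\<^bsub>H,H\<^esub> h'))) \<omega>"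

private abbreviation (input) "incl \<omega> \<equiv> extend \<omega> 1 1"

definition base_forms ::
    "('k, ('k, 'm, 'h) bform) kspace" where
  "base_forms = \<lparr>scl = fscale, car = (\<lambda>\<omega>. incl \<omega>) ` car (forms M N\<^sub>M)\<rparr>"

text \<open>\<open>P \<Omega>\<^sup>1(M)\<close> and \<open>\<Omega>\<^sup>1(M) P\<close>\<close>

definition P_forms ::
    "('k, ('k, 'm, 'h) bform) kspace" where
  "P_forms = \<lparr>scl = fscale,
     car = module.span fscale {P_lact p (incl \<omega>) | p \<omega>. p \<in> car P \<and> \<omega> \<in> car (forms M N\<^sub>M)}\<rparr>"

definition forms_P ::
    "('k, ('k, 'm, 'h) bform) kspace" where
  "forms_P = \<lparr>scl = fscale,
     car = module.span fscale {P_ract (incl \<omega>) p | \<omega> p. \<omega> \<in> car (forms M N\<^sub>M) \<and> p \<in> car P}\<rparr>"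

definition P_coaction :: "('k, 'm, 'h) tens \<Rightarrow> ('k, ('k, 'm, 'h) tens, 'h) tens" where
  "P_coaction = tlift M H (P \<otimes> H)
     (\<lambda>m h. tlift H H (P \<otimes> H) (\<lambda>h1 h2. (m \<otimes>\<^bsub>M,H\<^esub> h1) \<otimes>\<^bsub>P,H\<^esub> h2) (\<Delta> h))"

text \<open>
  The tensor product coaction on \<open>P \<otimes> P\<close>, which is
  \<open>m \<otimes> m' \<otimes> h \<otimes> g \<mapsto> m \<otimes> m' \<otimes> h\<^sub>(\<^sub>1\<^sub>) \<otimes> g\<^sub>(\<^sub>1\<^sub>) \<otimes> h\<^sub>(\<^sub>2\<^sub>) g\<^sub>(\<^sub>2\<^sub>)\<close>, and its descent modulo \<open>N\<^sub>P\<close>.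
\<close>

definition PP_coaction :: "('k, 'm, 'h) btens
    \<Rightarrow> ('k, ('k, 'm, 'h) btens, 'h) tens" where
  "PP_coaction = tlift (M \<otimes> M) (H \<otimes> H) (PP \<otimes> H) (\<lambda>x. tlift H H (PP \<otimes> H) (\<lambda>h g.
     tlift H H (PP \<otimes> H) (\<lambda>h1 h2.
       tlift H H (PP \<otimes> H) (\<lambda>g1 g2. pp x (h1 \<otimes>\<^bsub>H,H\<^esub> g1) \<otimes>\<^bsub>PP,H\<^esub> (h2 * g2)) (\<Delta> g)) (\<Delta> h)))"

definition bundle_forms_coaction :: "('k, 'm, 'h) bform
    \<Rightarrow> ('k, ('k, 'm, 'h) bform, 'h) tens" where
  "bundle_forms_coaction = qlift PP N\<^sub>P (PP_N \<otimes> H)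
     (\<lambda>z. tlift PP H (PP_N \<otimes> H) (\<lambda>z' h. qcls PP N\<^sub>P z' \<otimes>\<^bsub>PP_N,H\<^esub> h) (PP_coaction z))"


subsection \<open>Framings\<close>

definition E_space :: "('k, ('k, ('k, 'm, 'h) tens, 'v) tens) kspace" where
  "E_space = \<lparr>scl = fscale, car = {x \<in> car (P \<otimes> V).
     tlift P V ((P \<otimes> V) \<otimes> H) (\<lambda>p v.
       tlift P H ((P \<otimes> V) \<otimes> H) (\<lambda>p0 p1.
         tlift V H ((P \<otimes> V) \<otimes> H) (\<lambda>v0 v1. (p0 \<otimes>\<^bsub>P,V\<^esub> v0) \<otimes>\<^bsub>P \<otimes> V,H\<^esub> (p1 * v1)) (\<rho> v))
       (P_coaction p)) x
     = x \<otimes>\<^bsub>P \<otimes> V,H\<^esub> 1}\<rparr>"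

definition framing :: "('v \<Rightarrow> ('k, 'm, 'h) bform) \<Rightarrow> bool" where
  "framing \<theta> \<longleftrightarrow> lin V P_forms \<theta>
     \<and> (\<forall>v. bundle_forms_coaction (\<theta> v)
           = tlift V H (PP_N \<otimes> H) (\<lambda>v0 v1. \<theta> v0 \<otimes>\<^bsub>PP_N,H\<^esub> v1) (\<rho> v))
     \<and> module_iso E_space base_forms
         (\<lambda>m. tlift P V (P \<otimes> V) (\<lambda>p v. tmult M H (m \<otimes>\<^bsub>M,H\<^esub> 1) p \<otimes>\<^bsub>P,V\<^esub> v))
         (\<lambda>m. P_lact (m \<otimes>\<^bsub>M,H\<^esub> 1))
         (tlift P V PP_N (\<lambda>p v. P_lact p (\<theta> v)))"

definition bein :: "('v \<Rightarrow> ('k, 'm) form) \<Rightarrow> bool" where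
  "bein e \<longleftrightarrow> lin V (forms M N\<^sub>M) e
     \<and> module_iso (M \<otimes> V) (forms M N\<^sub>M)
         (\<lambda>m. tlift M V (M \<otimes> V) (\<lambda>m' v. (m * m') \<otimes>\<^bsub>M,V\<^esub> v))
         (lact M N\<^sub>M)
         (tlift M V (forms M N\<^sub>M) (\<lambda>m v. lact M N\<^sub>M m (e v)))"

text \<open>\<open>\<theta>(v) = e(v\<^sub>[\<^sub>0\<^sub>]) \<otimes> v\<^sub>[\<^sub>1\<^sub>] \<otimes> 1\<close>\<close>

definition framing_of_bein :: "('v \<Rightarrow> ('k, 'm) form)
    \<Rightarrow> 'v \<Rightarrow> ('k, 'm, 'h) bform" where
  "framing_of_bein e v = tlift V H PP_N (\<lambda>v0 v1. extend (e v0) v1 1) (\<rho> v)"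


subsection \<open>Coframings\<close>

text \<open>
  The coaction on \<open>V\<^sup>*\<close> determined by
  \<open>\<langle>v, w\<^sub>[\<^sub>0\<^sub>]\<rangle> w\<^sub>[\<^sub>1\<^sub>] = \<langle>v\<^sub>[\<^sub>0\<^sub>], w\<rangle> S\<^sup>-\<^sup>1 v\<^sub>[\<^sub>1\<^sub>]\<close>; here \<open>V\<close> must be finite-dimensional.
\<close>

definition dual_coaction :: "('v \<Rightarrow> 'k) \<Rightarrow> ('k, 'v \<Rightarrow> 'k, 'h) tens" where
  "dual_coaction w = (THE x. x \<in> car (dual V \<otimes> H)
     \<and> (\<forall>v. tlift (dual V) H H (\<lambda>w0 w1. scl H (w0 v) w1) x
           = tlift V H H (\<lambda>v0 v1. scl H (w v0) (inv S v1)) (\<rho> v)))"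

definition dual_basis :: "'v \<Rightarrow> 'v \<Rightarrow> 'k" where
  "dual_basis b = (\<lambda>v. module.representation (scl V) B v b)"

definition E_dual_space :: "('k, 'v \<Rightarrow> ('k, 'm, 'h) tens) kspace" where
  "E_dual_space = \<lparr>scl = (\<lambda>c \<phi> v. fscale c (\<phi> v)), car = {\<phi>. lin V P \<phi>
     \<and> (\<forall>v. P_coaction (\<phi> v) = tlift V H (P \<otimes> H) (\<lambda>v0 v1. \<phi> v0 \<otimes>\<^bsub>P,H\<^esub> v1) (\<rho> v))}\<rparr>"

definition coframing ::
    "(('v \<Rightarrow> 'k) \<Rightarrow> ('k, 'm, 'h) bform) \<Rightarrow> bool" where
  "coframing \<theta>' \<longleftrightarrow> \<theta>' \<in> extensional (car (dual V)) \<and> lin (dual V) forms_P \<theta>'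
     \<and> (\<forall>w\<in>car (dual V). bundle_forms_coaction (\<theta>' w)
           = tlift (dual V) H (PP_N \<otimes> H) (\<lambda>w0 w1. \<theta>' w0 \<otimes>\<^bsub>PP_N,H\<^esub> w1) (dual_coaction w))
     \<and> module_iso E_dual_space base_forms
         (\<lambda>m \<phi> v. tmult M H (\<phi> v) (m \<otimes>\<^bsub>M,H\<^esub> 1))
         (\<lambda>m \<zeta>. P_ract \<zeta> (m \<otimes>\<^bsub>M,H\<^esub> 1))
         (\<lambda>\<phi>. \<Sum>b\<in>B. P_ract (\<theta>' (dual_basis b)) (\<phi> b))"

definition cobein :: "(('v \<Rightarrow> 'k) \<Rightarrow> ('k, 'm) form) \<Rightarrow> bool" where
  "cobein e' \<longleftrightarrow> e' \<in> extensional (car (dual V)) \<and> lin (dual V) (forms M N\<^sub>M) e'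
     \<and> module_iso (dual V \<otimes> M) (forms M N\<^sub>M)
         (\<lambda>m. tlift (dual V) M (dual V \<otimes> M) (\<lambda>w m'. w \<otimes>\<^bsub>dual V,M\<^esub> (m' * m)))
         (\<lambda>m \<omega>. ract M N\<^sub>M \<omega> m)
         (tlift (dual V) M (forms M N\<^sub>M) (\<lambda>w m. ract M N\<^sub>M (e' w) m))"

text \<open>\<open>\<theta>\<^sup>*(w) = e\<^sup>*(w\<^sub>[\<^sub>0\<^sub>]) \<otimes> 1 \<otimes> w\<^sub>[\<^sub>1\<^sub>]\<close>\<close>

definition coframing_of_cobein :: "(('v \<Rightarrow> 'k) \<Rightarrow> ('k, 'm) form)
    \<Rightarrow> ('v \<Rightarrow> 'k) \<Rightarrow> ('k, 'm, 'h) bform" where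
  "coframing_of_cobein e' = restrict
     (\<lambda>w. tlift (dual V) H PP_N (\<lambda>w0 w1. extend (e' w0) 1 w1) (dual_coaction w)) (car (dual V))"


subsection \<open>The quantum metric\<close>

definition metrics ::
    "('k, ('k, ('k, ('k, 'm) form, ('k, 'm) form) tens) quo) kspace" where
  "metrics = btensor UNIV (forms M N\<^sub>M) (ract M N\<^sub>M) (forms M N\<^sub>M) (lact M N\<^sub>M)"

definition base_tns :: "('k, 'm) form \<Rightarrow> ('k, 'm) form
    \<Rightarrow> ('k, ('k, ('k, 'm) form, ('k, 'm) form) tens) quo" where
  "base_tns = btns UNIV (forms M N\<^sub>M) (ract M N\<^sub>M) (forms M N\<^sub>M) (lact M N\<^sub>M)"

text \<open>
  \<open>\<theta>'(f\<^sup>a) \<otimes>\<^sub>P \<theta>(e\<^sub>a)\<close> lives in \<open>\<Omega>\<^sup>1(M)P \<otimes>\<^sub>P P\<Omega>\<^sup>1(M)\<close>; the metric is the element of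
  \<open>\<Omega>\<^sup>1(M) \<otimes>\<^sub>M \<Omega>\<^sup>1(M)\<close> going to it under \<open>\<omega> \<otimes>\<^sub>M \<eta> \<mapsto> \<omega> \<otimes>\<^sub>P \<eta>\<close>.
\<close>

definition quantum_metric ::
    "('v \<Rightarrow> ('k, 'm, 'h) bform)
     \<Rightarrow> (('v \<Rightarrow> 'k) \<Rightarrow> ('k, 'm, 'h) bform)
     \<Rightarrow> ('k, ('k, ('k, 'm) form, ('k, 'm) form) tens) quo \<Rightarrow> bool" where
  "quantum_metric \<theta> \<theta>' g \<longleftrightarrow> g \<in> car metrics
     \<and> qlift (forms M N\<^sub>M \<otimes> forms M N\<^sub>M)
         (balancing UNIV (forms M N\<^sub>M) (ract M N\<^sub>M) (forms M N\<^sub>M) (lact M N\<^sub>M))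
         (btensor (car P) forms_P P_ract P_forms P_lact)
         (tlift (forms M N\<^sub>M) (forms M N\<^sub>M) (btensor (car P) forms_P P_ract P_forms P_lact)
            (\<lambda>\<omega> \<eta>. btns (car P) forms_P P_ract P_forms P_lact (incl \<omega>) (incl \<eta>))) g
       = (\<Sum>b\<in>B. btns (car P) forms_P P_ract P_forms P_lact (\<theta>' (dual_basis b)) (\<theta> b))"

end

end

theory Submission
  imports Defs
begin

text \<open>
  Since \<open>\<Omega>\<^sup>1M \<otimes> \<Omega>\<^sup>1H\<close> vanishes in \<open>\<Omega>\<^sup>1(P)\<close>, both \<open>P\<Omega>\<^sup>1(M)\<close> and \<open>\<Omega>\<^sup>1(M)P\<close> are the cofree comodule
  \<open>\<Omega>\<^sup>1(M) \<otimes> H\<close>, so that an equivariant map \<open>\<theta>\<close> into them is the same as a linear map \<open>e\<close> into \<open>\<Omega>\<^sup>1(M)\<close>: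
  \<open>\<theta>(v) = e(v\<^sub>[\<^sub>0\<^sub>]) \<otimes> v\<^sub>[\<^sub>1\<^sub>]\<close>, and the counit of \<open>H\<close> recovers \<open>e\<close> from \<open>\<theta>\<close>. In terms of a basis of \<open>V\<close> the
  coaction is a matrix \<open>r\<close> over \<open>H\<close>, that of \<open>V\<^sup>*\<close> is \<open>t a b = S\<^sup>-\<^sup>1 (r a b)\<close>, and the antipode axioms become
  \<open>\<Sum>\<^sub>b t b c * r a b = \<delta>\<^sub>a\<^sub>c\<close>. The invariants \<open>\<E>\<close> and \<open>\<E>\<^sup>*\<close> are then parametrised by the families
  \<open>m\<close> of elements of \<open>M\<close> indexed by the basis, as \<open>\<Sum>\<^sub>a\<^sub>b m\<^sub>a \<otimes> t b a \<otimes> b\<close> and \<open>b \<mapsto> \<Sum>\<^sub>a m\<^sub>a \<otimes> r a b\<close>, and that one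
  identity turns \<open>s\<^sub>\<theta>\<close> into \<open>s\<^sub>e\<close>, \<open>s\<^sub>\<theta>\<^sub>*\<close> into \<open>s\<^sub>e\<^sub>*\<close> and \<open>\<Sum>\<^sub>a \<theta>\<^sup>*(f\<^sup>a) \<otimes>\<^sub>P \<theta>(e\<^sub>a)\<close> into \<open>\<Sum>\<^sub>a e\<^sup>*(f\<^sup>a) \<otimes>\<^sub>P e(e\<^sub>a)\<close>.
  The counit also gives a left inverse of \<open>\<Omega>\<^sup>1(M) \<otimes>\<^sub>M \<Omega>\<^sup>1(M) \<rightarrow> \<Omega>\<^sup>1(M)P \<otimes>\<^sub>P P\<Omega>\<^sup>1(M)\<close>, which determines the metric.
\<close>

text \<open>These rules would expand sums of tensors, which are functions, pointwise.\<close>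

declare plus_fun_apply [simp del] zero_fun_apply [simp del]

subsection \<open>Vector spaces and linear maps\<close>

text \<open>That equivariance makes sense at all is the deepest use of bicovariance: the tensor
  product coaction must descend modulo \<open>N\<^sub>P\<close>, so the diagonal coaction on
  \<open>H \<otimes> H\<close> has to preserve \<open>N\<^sub>H\<close>, which is given only as a
  preimage of \<open>H \<otimes> Q\<close> under \<open>twist\<close>. It is transported there,
  where it combines the coproduct on \<open>H\<close> with \<open>Ad\<close> on \<open>Q\<close>.
  The second obstacle is the choice behind \<open>tlift\<close> and \<open>qlift\<close>: each use
  owes a proof of bilinearity, or of vanishing on the relations, and Sweedler sums are therefore
  computed with \<open>tsum\<close> and turned back into \<open>tlift\<close> only where linearity
  is known. The index order in \<open>t\<close> reflects that S^-1 reverses products and coproducts: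
  \<open>t\<close> is the inverse of \<open>r\<close> over the opposite algebra, and its transpose
  is the matrix of the dual comodule. Hence one treatment of matrix coactions serves
  \<open>V\<close> and \<open>dual V\<close>, with \<open>ext_space\<close> as the common
  target.\<close>

lemma vspace_zero: "vspace V \<Longrightarrow> 0 \<in> car V"
  and vspace_add: "vspace V \<Longrightarrow> x \<in> car V \<Longrightarrow> y \<in> car V \<Longrightarrow> x + y \<in> car V"
  and vspace_diff: "vspace V \<Longrightarrow> x \<in> car V \<Longrightarrow> y \<in> car V \<Longrightarrow> x - y \<in> car V"
  and vspace_scl: "vspace V \<Longrightarrow> x \<in> car V \<Longrightarrow> scl V c x \<in> car V"
proof -
  assume V: "vspace V"
  interpret vector_space "scl V" using V by (simp add: vspace_def)
  have s: "subspace (car V)" using V by (simp add: vspace_def)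
  show "0 \<in> car V" "x \<in> car V \<Longrightarrow> y \<in> car V \<Longrightarrow> x + y \<in> car V"
    "x \<in> car V \<Longrightarrow> y \<in> car V \<Longrightarrow> x - y \<in> car V" "x \<in> car V \<Longrightarrow> scl V c x \<in> car V"
    using s by (auto intro: subspace_0 subspace_add subspace_diff subspace_scale)
qed

lemma vspace_sum: "vspace V \<Longrightarrow> (\<And>i. i \<in> I \<Longrightarrow> f i \<in> car V) \<Longrightarrow> sum f I \<in> car V"
  by (induction I rule: infinite_finite_induct) (auto intro: vspace_zero vspace_add)

lemmas vspace_closed = vspace_zero vspace_add vspace_diff vspace_scl vspace_sum

lemma vspace_scl_add: "vspace V \<Longrightarrow> scl V c (x + y) = scl V c x + scl V c y"
  and vspace_add_scl: "vspace V \<Longrightarrow> scl V (c + d) x = scl V c x + scl V d x"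
  and vspace_scl_scl: "vspace V \<Longrightarrow> scl V c (scl V d x) = scl V (c * d) x"
  and vspace_scl_one: "vspace V \<Longrightarrow> scl V 1 x = x"
  and vspace_scl_zero: "vspace V \<Longrightarrow> scl V c 0 = 0"
  and vspace_zero_scl: "vspace V \<Longrightarrow> scl V 0 x = 0"
proof -
  assume V: "vspace V"
  interpret vector_space "scl V" using V by (simp add: vspace_def)
  show "scl V c (x + y) = scl V c x + scl V c y" "scl V (c + d) x = scl V c x + scl V d x"
    "scl V c (scl V d x) = scl V (c * d) x" "scl V 1 x = x" "scl V c 0 = 0" "scl V 0 x = 0"
    by (simp_all add: scale_right_distrib scale_left_distrib)
qed

lemma vspace_scl_sum: "vspace V \<Longrightarrow> scl V c (sum f I) = (\<Sum>i\<in>I. scl V c (f i))"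
  by (induction I rule: infinite_finite_induct) (auto simp: vspace_scl_add vspace_scl_zero)

lemma lin_mem: "lin V W f \<Longrightarrow> x \<in> car V \<Longrightarrow> f x \<in> car W"
  and lin_add: "lin V W f \<Longrightarrow> x \<in> car V \<Longrightarrow> y \<in> car V \<Longrightarrow> f (x + y) = f x + f y"
  and lin_scl: "lin V W f \<Longrightarrow> x \<in> car V \<Longrightarrow> f (scl V c x) = scl W c (f x)"
  by (auto simp: lin_def)

lemma lin_zero: "vspace V \<Longrightarrow> lin V W f \<Longrightarrow> f 0 = 0"
  using lin_add[of V W f 0 0] by (simp add: vspace_zero)

lemma lin_diff: "vspace V \<Longrightarrow> lin V W f \<Longrightarrow> x \<in> car V \<Longrightarrow> y \<in> car V \<Longrightarrow> f (x - y) = f x - f y"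
  using lin_add[of V W f "x - y" y] by (simp add: vspace_diff)

lemma lin_sum: "vspace V \<Longrightarrow> lin V W f \<Longrightarrow> (\<And>i. i \<in> I \<Longrightarrow> g i \<in> car V) \<Longrightarrow> f (sum g I) = (\<Sum>i\<in>I. f (g i))"
proof (induction I rule: infinite_finite_induct)
  case (insert i I)
  then show ?case by (simp add: lin_add vspace_sum)
qed (simp_all add: lin_zero)

lemma linI:
  assumes "\<And>x. x \<in> car V \<Longrightarrow> f x \<in> car W"
    and "\<And>x y. x \<in> car V \<Longrightarrow> y \<in> car V \<Longrightarrow> f (x + y) = f x + f y"
    and "\<And>c x. x \<in> car V \<Longrightarrow> f (scl V c x) = scl W c (f x)"
  shows "lin V W f"
  using assms by (auto simp: lin_def)

lemma bilinI:
  assumes "\<And>v. v \<in> car V \<Longrightarrow> lin W U (f v)" and "\<And>w. w \<in> car W \<Longrightarrow> lin V U (\<lambda>v. f v w)"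
  shows "bilin V W U f"
  using assms by (simp add: bilin_def)

lemma bilin_left: "bilin V W U f \<Longrightarrow> w \<in> car W \<Longrightarrow> lin V U (\<lambda>v. f v w)"
  and bilin_right: "bilin V W U f \<Longrightarrow> v \<in> car V \<Longrightarrow> lin W U (f v)"
  and bilin_mem: "bilin V W U f \<Longrightarrow> v \<in> car V \<Longrightarrow> w \<in> car W \<Longrightarrow> f v w \<in> car U"
  by (auto simp: bilin_def lin_def)

lemma lin_weaken: "lin V W f \<Longrightarrow> car W \<subseteq> car W' \<Longrightarrow> scl W = scl W' \<Longrightarrow> lin V W' f"
  by (auto simp: lin_def)

lemma lin_restrict_dom: "lin V W f \<Longrightarrow> car V' \<subseteq> car V \<Longrightarrow> scl V' = scl V \<Longrightarrow> lin V' W f"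
  by (auto simp: lin_def subset_iff)

lemma vspace_fscaleI: "scl V = fscale \<Longrightarrow> module.subspace fscale (car V) \<Longrightarrow> vspace V"
  by (simp add: vspace_def vector_space_fscale)

lemma subspace_span_fscale: "module.subspace fscale (module.span fscale X)"
proof -
  interpret vector_space fscale by (rule vector_space_fscale)
  show ?thesis by (rule subspace_span)
qed

lemma subspace_car: "vspace V \<Longrightarrow> module.subspace (scl V) (car V)"
  by (simp add: vspace_def)

lemma vspace_gnd: "vspace gnd"
proof -
  interpret vector_space "(*) :: 'k::field \<Rightarrow> 'k \<Rightarrow> 'k" by (rule vector_space_gnd)
  show "vspace (gnd :: ('k, 'k) kspace)" by (simp add: vspace_def gnd_def vector_space_gnd)
qed

lemma lin_const_zero: "vspace U \<Longrightarrow> lin V U (\<lambda>x. 0)"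
  by (auto simp: lin_def vspace_zero vspace_scl_zero)

lemma lin_plus:
  assumes "vspace U" "lin V U f" "lin V U g"
  shows "lin V U (\<lambda>x. f x + g x)"
  using assms by (intro linI) (auto simp: lin_add lin_scl vspace_scl_add intro: vspace_add lin_mem)

lemma lin_sum_pointwise:
  assumes "vspace U" "\<And>i. i \<in> I \<Longrightarrow> lin V U (\<lambda>x. f x i)"
  shows "lin V U (\<lambda>x. \<Sum>i\<in>I. f x i)"
  using assms by (induction I rule: infinite_finite_induct) (auto intro: lin_plus lin_const_zero)

lemma lin_id: "lin V V (\<lambda>x. x)"
  by (simp add: lin_def)

lemma lin_compose: "lin V W f \<Longrightarrow> lin W U g \<Longrightarrow> lin V U (\<lambda>x. g (f x))"
  by (intro linI) (simp_all add: lin_add lin_scl lin_mem[of V W f] lin_mem[of W U g])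

lemma lin_scl_right:
  assumes "vspace U" "lin V U f"
  shows "lin V U (\<lambda>x. scl U c (f x))"
  using assms by (intro linI)
    (auto simp: lin_add lin_scl vspace_scl_add vspace_scl_scl mult.commute intro: vspace_scl lin_mem)

lemma lin_scl_left:
  assumes "vspace U" "u \<in> car U" "lin V gnd f"
  shows "lin V U (\<lambda>x. scl U (f x) u)"
proof (rule linI)
  fix c x assume x: "x \<in> car V"
  have "f (scl V c x) = c * f x" using lin_scl[OF assms(3) x] by (simp add: gnd_def)
  then show "scl U (f (scl V c x)) u = scl U c (scl U (f x) u)"
    by (simp add: vspace_scl_scl assms(1))
qed (use assms in \<open>auto simp: lin_add vspace_add_scl intro: vspace_scl\<close>)

lemma lin_cong:
  assumes "vspace V" "\<And>x. x \<in> car V \<Longrightarrow> f x = g x"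
  shows "lin V W f \<longleftrightarrow> lin V W g"
  using assms by (auto simp: lin_def Pi_iff vspace_add vspace_scl)

subsection \<open>Tensor products\<close>

lemma car_tensor: "car (V \<otimes> W) = tspan V W (car V) (car W)"
  and scl_tensor [simp]: "scl (V \<otimes> W) = fscale"
  by (simp_all add: tensor_def)

lemma vspace_tensor [simp]: "vspace (V \<otimes> W)"
  by (rule vspace_fscaleI) (simp_all add: car_tensor tspan_def subspace_span_fscale)

lemma tspan_base: "v \<in> A \<Longrightarrow> w \<in> C \<Longrightarrow> v \<otimes>\<^bsub>V,W\<^esub> w \<in> tspan V W A C"
proof -
  interpret vector_space fscale by (rule vector_space_fscale)
  show "v \<in> A \<Longrightarrow> w \<in> C \<Longrightarrow> v \<otimes>\<^bsub>V,W\<^esub> w \<in> tspan V W A C"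
    unfolding tspan_def by (rule span_base) blast
qed

lemma subspace_tspan: "module.subspace fscale (tspan V W A C)"
  by (simp add: tspan_def subspace_span_fscale)

lemma tns_mem [simp]: "v \<in> car V \<Longrightarrow> w \<in> car W \<Longrightarrow> v \<otimes>\<^bsub>V,W\<^esub> w \<in> car (V \<otimes> W)"
  by (simp add: car_tensor tspan_base)

text \<open>Membership is carried through the induction because a map with \<open>lin\<close> is
  additive only on its carrier.\<close>

lemma tspan_induct [consumes 1, case_names zero add pure]:
  assumes "z \<in> tspan V W A C" and "P 0"
    and "\<And>x y. x \<in> tspan V W A C \<Longrightarrow> y \<in> tspan V W A C \<Longrightarrow> P x \<Longrightarrow> P y \<Longrightarrow> P (x + y)"
    and "\<And>c v w. v \<in> A \<Longrightarrow> w \<in> C \<Longrightarrow> P (fscale c (v \<otimes>\<^bsub>V,W\<^esub> w))"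
  shows "P z"
proof -
  interpret vector_space fscale by (rule vector_space_fscale)
  have "P z \<and> z \<in> tspan V W A C"
    using assms(1) unfolding tspan_def
  proof (induction rule: span_induct_alt)
    case base show ?case using assms(2) span_zero by (simp add: zero_fun_def)
  next
    case (step c x y)
    then have "fscale c x \<in> span {v \<otimes>\<^bsub>V,W\<^esub> w | v w. v \<in> A \<and> w \<in> C}"
      by (intro span_scale span_base)
    then show ?case using step assms(3)[of "fscale c x" y, unfolded tspan_def] assms(4)[of _ _ c]
      by (intro conjI span_add) blast+
  qed
  then show ?thesis ..
qed

lemma bilin_tns: "bilin V W (V \<otimes> W) (\<lambda>v w. v \<otimes>\<^bsub>V,W\<^esub> w)"
  by (intro bilinI linI tns_mem)
    (auto simp: tns_def fun_eq_iff fscale_def gnd_def plus_fun_apply bilin_def lin_def)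

lemma lin_tns_left: "vspace X \<Longrightarrow> lin X V f \<Longrightarrow> w \<in> car W \<Longrightarrow> lin X (V \<otimes> W) (\<lambda>x. f x \<otimes>\<^bsub>V,W\<^esub> w)"
  by (rule lin_compose[OF _ bilin_left[OF bilin_tns]])

lemma lin_tns_right: "vspace X \<Longrightarrow> lin X W f \<Longrightarrow> v \<in> car V \<Longrightarrow> lin X (V \<otimes> W) (\<lambda>x. v \<otimes>\<^bsub>V,W\<^esub> f x)"
  by (rule lin_compose[OF _ bilin_right[OF bilin_tns]])

lemma scl_tns: "v \<in> car V \<Longrightarrow> w \<in> car W \<Longrightarrow> fscale c (v \<otimes>\<^bsub>V,W\<^esub> w) = scl V c v \<otimes>\<^bsub>V,W\<^esub> w"
  using lin_scl[OF bilin_left[OF bilin_tns]] by fastforce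

text \<open>No case for scalars or zero remains: a scalar is absorbed into the left factor, and zero
  is the pure tensor of two zeros.\<close>

lemma tensor_induct [consumes 3, case_names add pure]:
  assumes "vspace V" "vspace W" "z \<in> car (V \<otimes> W)"
    and "\<And>x y. x \<in> car (V \<otimes> W) \<Longrightarrow> y \<in> car (V \<otimes> W) \<Longrightarrow> P x \<Longrightarrow> P y \<Longrightarrow> P (x + y)"
    and pure: "\<And>v w. v \<in> car V \<Longrightarrow> w \<in> car W \<Longrightarrow> P (v \<otimes>\<^bsub>V,W\<^esub> w)"
  shows "P z"
  using assms(3) unfolding car_tensor
proof (induction rule: tspan_induct)
  case zero
  have "0 \<otimes>\<^bsub>V,W\<^esub> 0 = 0"
    by (rule lin_zero[OF assms(1) bilin_left[OF bilin_tns vspace_zero[OF assms(2)]]])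
  with pure[OF assms(1,2)[THEN vspace_zero]] show ?case by simp
next
  case (pure c v w)
  then show ?case by (simp add: scl_tns vspace_scl assms(1,5))
qed (use assms(4) in \<open>simp add: car_tensor\<close>)

lemma lin_tensor_ext:
  assumes "lin (V \<otimes> W) U f" "lin (V \<otimes> W) U' g" "scl U = scl U'"
    and "\<And>v w. v \<in> car V \<Longrightarrow> w \<in> car W \<Longrightarrow> f (v \<otimes>\<^bsub>V,W\<^esub> w) = g (v \<otimes>\<^bsub>V,W\<^esub> w)"
    and "z \<in> car (V \<otimes> W)"
  shows "f z = g z"
  using assms(5) unfolding car_tensor
proof (induction rule: tspan_induct)
  case zero
  then show ?case by (simp add: lin_zero[OF vspace_tensor assms(1)] lin_zero[OF vspace_tensor assms(2)])
next
  case (add x y)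
  then show ?case using lin_add[OF assms(1)] lin_add[OF assms(2)] by (simp add: car_tensor)
next
  case (pure c v w)
  then show ?case using lin_scl[OF assms(1) tns_mem] lin_scl[OF assms(2) tns_mem] assms(3,4)
    by fastforce
qed

text \<open>With \<open>T\<close> the zero subspace this is a vanishing criterion; with
  \<open>T\<close> another \<open>tspan\<close> it shows that a map respects the images of
  subspaces.\<close>

lemma lin_tspan_subset:
  assumes "lin (V \<otimes> W) U f" "A \<subseteq> car V" "C \<subseteq> car W" "module.subspace (scl U) T" "vspace U"
    and "\<And>v w. v \<in> A \<Longrightarrow> w \<in> C \<Longrightarrow> f (v \<otimes>\<^bsub>V,W\<^esub> w) \<in> T"
    and "z \<in> tspan V W A C"
  shows "f z \<in> T"
proof -
  interpret u: vector_space "scl U" using assms(5) by (simp add: vspace_def)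
  interpret t: vector_space fscale by (rule vector_space_fscale)
  have sub: "tspan V W A C \<subseteq> car (V \<otimes> W)"
    unfolding car_tensor unfolding tspan_def using assms(2,3) by (intro t.span_mono) blast
  show ?thesis
    using assms(7)
  proof (induction rule: tspan_induct)
    case zero
    then show ?case using lin_zero[OF vspace_tensor assms(1)] u.subspace_0[OF assms(4)] by simp
  next
    case (add x y)
    then show ?case using lin_add[OF assms(1), of x y] sub u.subspace_add[OF assms(4)]
      by (simp add: subset_iff)
  next
    case (pure c v w)
    then have "v \<otimes>\<^bsub>V,W\<^esub> w \<in> car (V \<otimes> W)" using assms(2,3) by (auto intro: tns_mem)
    then show ?case using lin_scl[OF assms(1), of "v \<otimes>\<^bsub>V,W\<^esub> w" c] pure assms(6)
      u.subspace_scale[OF assms(4)] by simp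
  qed
qed

lemma tspan_mono: "A \<subseteq> A' \<Longrightarrow> C \<subseteq> C' \<Longrightarrow> tspan V W A C \<subseteq> tspan V W A' C'"
proof -
  interpret t: vector_space fscale by (rule vector_space_fscale)
  show "A \<subseteq> A' \<Longrightarrow> C \<subseteq> C' \<Longrightarrow> tspan V W A C \<subseteq> tspan V W A' C'"
    unfolding tspan_def by (intro t.span_mono) blast
qed

lemma lin_tlift_arg:
  assumes "vspace U" "lin X (V \<otimes> W) f" "bilin V W U F"
  shows "lin X U (\<lambda>x. tlift V W U F (f x))"
  by (rule lin_compose[OF assms(2) tlift(1)[OF assms(1,3)]])

text \<open>\<open>tlift\<close> is chosen separately for each value of the parameter, so its
  dependence on \<open>x\<close> is hidden. Both sides of each linearity law are linear in
  \<open>z\<close>, hence it is enough to compare them on pure tensors, where the choice is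
  determined.\<close>

lemma lin_tlift_param:
  assumes U: "vspace U" and X: "vspace X" and z: "z \<in> car (V \<otimes> W)"
    and F: "\<And>x. x \<in> car X \<Longrightarrow> bilin V W U (F x)"
    and G: "\<And>v w. v \<in> car V \<Longrightarrow> w \<in> car W \<Longrightarrow> lin X U (\<lambda>x. F x v w)"
  shows "lin X U (\<lambda>x. tlift V W U (F x) z)"
proof (rule linI)
  fix x y assume x: "x \<in> car X" and y: "y \<in> car X"
  note L = tlift(1)[OF U F] tlift(2)[OF U F]
  show "tlift V W U (F x) z \<in> car U" by (rule lin_mem[OF L(1)[OF x] z])
  show "tlift V W U (F (x + y)) z = tlift V W U (F x) z + tlift V W U (F y) z"
    by (rule lin_tensor_ext[OF L(1) lin_plus[OF U L(1) L(1)] refl _ z])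
      (auto simp: L(2) x y vspace_add X lin_add[OF G])
next
  fix c x assume x: "x \<in> car X"
  note L = tlift(1)[OF U F] tlift(2)[OF U F]
  show "tlift V W U (F (scl X c x)) z = scl U c (tlift V W U (F x) z)"
    by (rule lin_tensor_ext[OF L(1) lin_scl_right[OF U L(1)] refl _ z])
      (auto simp: L(2) x vspace_scl X lin_scl[OF G])
qed

subsection \<open>Quotients\<close>

lemma scl_quot [simp]: "scl (quot V N) = fscale"
  and car_quot: "car (quot V N) = qcls V N ` car V"
  by (simp_all add: quot_def)

lemma lin_qcls: "lin V (quot V N) (qcls V N)"
  by (auto simp: lin_def car_quot qcls_def fscale_def fun_eq_iff gnd_def plus_fun_apply)

lemma qcls_zero: "n \<in> N \<Longrightarrow> qcls V N n = 0"
  by (auto simp: qcls_def fun_eq_iff zero_fun_apply)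

lemma lin_image_subspace:
  assumes "vspace V" "lin V W f" "vspace W"
  shows "module.subspace (scl W) (f ` car V)"
proof -
  interpret w: vector_space "scl W" using assms(3) by (simp add: vspace_def)
  show ?thesis
  proof (rule w.subspaceI)
    show "0 \<in> f ` car V"
      using lin_zero[OF assms(1,2)] vspace_zero[OF assms(1)] by (metis image_eqI)
  next
    fix x y assume "x \<in> f ` car V" "y \<in> f ` car V"
    then show "x + y \<in> f ` car V"
      using lin_add[OF assms(2)] vspace_add[OF assms(1)] by (smt (verit) image_iff)
  next
    fix c x assume "x \<in> f ` car V"
    then show "scl W c x \<in> f ` car V"
      using lin_scl[OF assms(2)] vspace_scl[OF assms(1)] by (smt (verit) image_iff)
  qed
qed

lemma vspace_quot:
  fixes V :: "('k::field, 'a::ab_group_add) kspace"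
  assumes "vspace V"
  shows "vspace (quot V N)"
proof (rule vspace_fscaleI)
  \<comment> \<open>The codomain is enlarged to all functions, because
    \<open>lin_image_subspace\<close> asks for a codomain already known to be a vector
    space.\<close>
  let ?F = "\<lparr>scl = fscale, car = UNIV\<rparr> :: ('k, ('k, 'a) quo) kspace"
  interpret t: vector_space "fscale :: 'k \<Rightarrow> ('k, 'a) quo \<Rightarrow> ('k, 'a) quo"
    by (rule vector_space_fscale)
  have "vspace ?F" by (simp add: vspace_def vector_space_fscale)
  moreover have "lin V ?F (qcls V N)"
    by (rule lin_weaken[OF lin_qcls]) auto
  ultimately show "module.subspace fscale (car (quot V N))"
    using lin_image_subspace[OF assms, of ?F "qcls V N"] by (simp add: car_quot)
qed simp

subsection \<open>Finite sum decompositions of tensors\<close>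

text \<open>Membership is required at every index, also beyond \<open>n\<close>, so the families are
  total and two of them can be concatenated by a case distinction with a shift by
  \<open>n\<close>.\<close>

lemma tensor_decomp:
  assumes "vspace V" "vspace W" "z \<in> car (V \<otimes> W)"
  shows "\<exists>n v w. (\<forall>i. v i \<in> car V \<and> w i \<in> car W) \<and> z = (\<Sum>i<(n::nat). v i \<otimes>\<^bsub>V,W\<^esub> w i)"
  using assms
proof (induction rule: tensor_induct)
  case (add x y)
  then obtain n v w n' v' w' where *: "\<forall>i. v i \<in> car V \<and> w i \<in> car W"
      "x = (\<Sum>i<(n::nat). v i \<otimes>\<^bsub>V,W\<^esub> w i)" "\<forall>i. v' i \<in> car V \<and> w' i \<in> car W"
      "y = (\<Sum>i<(n'::nat). v' i \<otimes>\<^bsub>V,W\<^esub> w' i)" by blast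
  have "x + y = (\<Sum>i<n + n'. (if i < n then v i else v' (i - n)) \<otimes>\<^bsub>V,W\<^esub> (if i < n then w i else w' (i - n)))"
    (is "_ = sum ?f _")
  proof -
    have "sum ?f {..<n + n'} = sum ?f {0..<n} + sum ?f {n..<n + n'}"
      unfolding lessThan_atLeast0 by (rule sum.atLeastLessThan_concat[symmetric]) auto
    also have "sum ?f {n..<n + n'} = sum (\<lambda>i. ?f (i + n)) {0..<n'}"
      using sum.shift_bounds_nat_ivl[of ?f 0 n n'] by (simp add: add.commute)
    finally show ?thesis unfolding *(2,4) by (simp add: lessThan_atLeast0)
  qed
  then show ?case
    using *(1,3) by (intro exI[of _ "n + n'"] exI[of _ "\<lambda>i. if i < n then v i else v' (i - n)"]
        exI[of _ "\<lambda>i. if i < n then w i else w' (i - n)"]) auto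
next
  case (pure v w)
  then show ?case by (intro exI[of _ 1] exI[of _ "\<lambda>_. v"] exI[of _ "\<lambda>_. w"]) simp
qed

text \<open>A decomposition fixed once for each tensor. It is not additive in \<open>z\<close>, so a
  sum over it has invariant meaning only for bilinear summands.\<close>

definition tdec :: "('k::field, 'a::ab_group_add) kspace \<Rightarrow> ('k, 'b::ab_group_add) kspace
    \<Rightarrow> ('k, 'a, 'b) tens \<Rightarrow> nat \<times> (nat \<Rightarrow> 'a) \<times> (nat \<Rightarrow> 'b)" where
  "tdec V W z = (SOME d. (\<forall>i. fst (snd d) i \<in> car V \<and> snd (snd d) i \<in> car W)
     \<and> z = (\<Sum>i<fst d. fst (snd d) i \<otimes>\<^bsub>V,W\<^esub> snd (snd d) i))"

text \<open>
  The sum \<open>\<Sum>\<^sub>i f v\<^sub>i w\<^sub>i\<close> for a chosen decomposition \<open>z = \<Sum>\<^sub>i v\<^sub>i \<otimes> w\<^sub>i\<close>. Unlike \<open>tlift\<close> it commutes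
  with linear maps and with other sums without any condition on \<open>f\<close>.
\<close>

definition tsum :: "('k::field, 'a::ab_group_add) kspace \<Rightarrow> ('k, 'b::ab_group_add) kspace
    \<Rightarrow> ('k, 'a, 'b) tens \<Rightarrow> ('a \<Rightarrow> 'b \<Rightarrow> 'c::comm_monoid_add) \<Rightarrow> 'c" where
  "tsum V W z f = (case tdec V W z of (n, v, w) \<Rightarrow> \<Sum>i<n. f (v i) (w i))"

lemma tdec:
  assumes "vspace V" "vspace W" "z \<in> car (V \<otimes> W)"
  obtains n v w where "tdec V W z = (n, v, w)" "\<And>i. v i \<in> car V" "\<And>i. w i \<in> car W"
    "z = (\<Sum>i<n. v i \<otimes>\<^bsub>V,W\<^esub> w i)"
proof -
  let ?P = "\<lambda>d. (\<forall>i. fst (snd d) i \<in> car V \<and> snd (snd d) i \<in> car W)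
     \<and> z = (\<Sum>i<fst d. fst (snd d) i \<otimes>\<^bsub>V,W\<^esub> snd (snd d) i)"
  obtain n :: nat and v w where "(\<forall>i. v i \<in> car V \<and> w i \<in> car W) \<and> z = (\<Sum>i<n. v i \<otimes>\<^bsub>V,W\<^esub> w i)"
    using tensor_decomp[OF assms] by blast
  then have "?P (n, v, w)" by simp
  then have "?P (tdec V W z)" unfolding tdec_def by (rule someI[where P = ?P])
  then show thesis by (intro that[of "fst (tdec V W z)"]) auto
qed

lemma tsum_add: "tsum V W z (\<lambda>v w. f v w + g v w) = tsum V W z f + tsum V W z g"
  by (simp add: tsum_def case_prod_unfold sum.distrib)

lemma tsum_sum: "tsum V W z (\<lambda>v w. \<Sum>i\<in>I. f v w i) = (\<Sum>i\<in>I. tsum V W z (\<lambda>v w. f v w i))"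
  by (simp add: tsum_def case_prod_unfold sum.swap[of _ I])

lemma tsum_swap: "tsum V W z (\<lambda>v w. tsum V' W' z' (f v w)) = tsum V' W' z' (\<lambda>v' w'. tsum V W z (\<lambda>v w. f v w v' w'))"
  by (simp add: tsum_def case_prod_unfold sum.swap[of _ "{..<fst (tdec V W z)}"])

lemma tsum_mult_left: "tsum V W z (\<lambda>v w. (c :: 'c::semiring_0) * f v w) = c * tsum V W z f"
  and tsum_mult_right: "tsum V W z (\<lambda>v w. f v w * (c :: 'c)) = tsum V W z f * c"
  by (simp_all add: tsum_def case_prod_unfold sum_distrib_left sum_distrib_right)

lemma tsum_mem:
  assumes "vspace U" "vspace V" "vspace W" "z \<in> car (V \<otimes> W)"
    and "\<And>v w. v \<in> car V \<Longrightarrow> w \<in> car W \<Longrightarrow> f v w \<in> car U"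
  shows "tsum V W z f \<in> car U"
  by (rule tdec[OF assms(2-4)]) (simp add: assms vspace_sum tsum_def)

lemma tsum_mem_subspace:
  assumes "vector_space s" "module.subspace s T" "vspace V" "vspace W" "z \<in> car (V \<otimes> W)"
    and "\<And>v w. v \<in> car V \<Longrightarrow> w \<in> car W \<Longrightarrow> f v w \<in> T"
  shows "tsum V W z f \<in> T"
proof -
  interpret vector_space s by fact
  show ?thesis by (rule tdec[OF assms(3-5)]) (simp add: assms subspace_sum tsum_def)
qed

lemma lin_tsum:
  assumes "lin U U' g" "vspace U" "vspace V" "vspace W" "z \<in> car (V \<otimes> W)"
    and "\<And>v w. v \<in> car V \<Longrightarrow> w \<in> car W \<Longrightarrow> f v w \<in> car U"
  shows "g (tsum V W z f) = tsum V W z (\<lambda>v w. g (f v w))"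
  by (rule tdec[OF assms(3-5)]) (simp add: assms(6) tsum_def lin_sum[OF assms(2,1)])

text \<open>For a bilinear summand the chosen decomposition no longer matters. This is the passage
  between the definitions, written with \<open>tlift\<close>, and calculations in Sweedler
  notation.\<close>

lemma tlift_tsum:
  assumes "vspace U" "bilin V W U F" "vspace V" "vspace W" "z \<in> car (V \<otimes> W)"
  shows "tlift V W U F z = tsum V W z F"
proof (rule tdec[OF assms(3-5)])
  fix n v w
  assume d: "tdec V W z = (n, v, w)" "\<And>i. v i \<in> car V" "\<And>i. w i \<in> car W"
    "z = (\<Sum>i<n. v i \<otimes>\<^bsub>V,W\<^esub> w i)"
  have "tlift V W U F z = (\<Sum>i<n. tlift V W U F (v i \<otimes>\<^bsub>V,W\<^esub> w i))"
    unfolding d(4) by (rule lin_sum[OF vspace_tensor tlift(1)[OF assms(1,2)]]) (simp add: tns_mem d)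
  also have "\<dots> = tsum V W z F"
    by (simp add: tsum_def d(1-3) tlift(2)[OF assms(1,2)])
  finally show ?thesis .
qed

lemma tsum_tns:
  assumes "vspace U" "bilin V W U F" "vspace V" "vspace W" "v \<in> car V" "w \<in> car W"
  shows "tsum V W (v \<otimes>\<^bsub>V,W\<^esub> w) F = F v w"
  using tlift_tsum[OF assms(1-4) tns_mem[OF assms(5,6)]] tlift(2)[OF assms(1,2,5,6)] by simp

lemma tsum_self:
  assumes "vspace V" "vspace W" "z \<in> car (V \<otimes> W)"
  shows "tsum V W z (\<lambda>v w. v \<otimes>\<^bsub>V,W\<^esub> w) = z"
  by (rule tdec[OF assms]) (simp add: tsum_def)

text \<open>Additivity in the tensor itself is not visible from \<open>tsum\<close>, whose
  decomposition changes with the tensor; it is inherited from \<open>tlift\<close>, which is why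
  bilinearity of \<open>F\<close> is demanded here.\<close>

lemma lin_tsum_arg:
  assumes "vspace U" "vspace V" "vspace W" "vspace X" "bilin V W U F" "lin X (V \<otimes> W) f"
  shows "lin X U (\<lambda>x. tsum V W (f x) F)"
proof -
  have "lin X U (\<lambda>x. tlift V W U F (f x))" by (rule lin_tlift_arg[OF assms(1,6,5)])
  then show ?thesis
    by (subst lin_cong[OF assms(4)]) (auto simp: tlift_tsum[OF assms(1,5,2,3) lin_mem[OF assms(6)]])
qed

lemma lin_tsum_param:
  assumes "vspace U" "vspace V" "vspace W" "z \<in> car (V \<otimes> W)"
    and "\<And>v w. v \<in> car V \<Longrightarrow> w \<in> car W \<Longrightarrow> lin X U (\<lambda>x. F x v w)"
  shows "lin X U (\<lambda>x. tsum V W z (F x))"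
  by (rule tdec[OF assms(2-4)]) (simp add: tsum_def lin_sum_pointwise assms)

lemma lin_bilin_left: "bilin V W U F \<Longrightarrow> w \<in> car W \<Longrightarrow> lin X V f \<Longrightarrow> lin X U (\<lambda>x. F (f x) w)"
  by (rule lin_compose[OF _ bilin_left])

lemma lin_bilin_right: "bilin V W U F \<Longrightarrow> v \<in> car V \<Longrightarrow> lin X W f \<Longrightarrow> lin X U (\<lambda>x. F v (f x))"
  by (rule lin_compose[OF _ bilin_right])

lemmas lin_intros = lin_id bilinI lin_scl_right lin_scl_left lin_plus lin_tns_left lin_tns_right
  lin_tlift_arg lin_tlift_param lin_tsum_arg lin_tsum_param lin_compose[OF _ lin_qcls]

subsection \<open>Balanced tensor products\<close>

text \<open>The zeros of a linear map form a subspace, so the generators of the balancing relations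
  decide. Together with \<open>qlift\<close> this yields maps out of a balanced tensor
  product.\<close>

lemma balancing_vanish:
  assumes f: "lin (X \<otimes> Y) U f" and U: "vspace U" and n: "n \<in> balancing R X r Y l"
    and r: "\<And>x a. x \<in> car X \<Longrightarrow> a \<in> R \<Longrightarrow> r x a \<in> car X"
    and l: "\<And>y a. y \<in> car Y \<Longrightarrow> a \<in> R \<Longrightarrow> l a y \<in> car Y"
    and eq: "\<And>x a y. x \<in> car X \<Longrightarrow> a \<in> R \<Longrightarrow> y \<in> car Y
      \<Longrightarrow> f (r x a \<otimes>\<^bsub>X,Y\<^esub> y) = f (x \<otimes>\<^bsub>X,Y\<^esub> l a y)"
  shows "f n = 0"
proof -
  interpret vector_space fscale by (rule vector_space_fscale)
  let ?T = "{z \<in> car (X \<otimes> Y). f z = 0}"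
  have "balancing R X r Y l \<subseteq> ?T"
    unfolding balancing_def
  proof (rule span_minimal)
    show "subspace ?T"
      using vspace_closed[OF vspace_tensor[of X Y]] lin_scl[OF f] vspace_scl_zero[OF U]
      by (intro subspaceI) (auto simp: lin_zero[OF vspace_tensor f] lin_add[OF f])
  qed (auto simp: lin_diff[OF vspace_tensor f] r l eq intro!: vspace_diff vspace_tensor tns_mem)
  then show ?thesis using n by blast
qed

lemma scl_btensor [simp]: "scl (btensor R X r Y l) = fscale"
  and vspace_btensor: "vspace (btensor R X r Y l)"
  by (simp_all add: btensor_def vspace_quot)

lemma bilin_btns: "bilin X Y (btensor R X r Y l) (btns R X r Y l)"
  unfolding btensor_def btns_def
  by (intro bilinI lin_compose[OF bilin_left[OF bilin_tns] lin_qcls]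
      lin_compose[OF bilin_right[OF bilin_tns] lin_qcls])

lemma btns_balanced:
  assumes "x \<in> car X" "a \<in> R" "y \<in> car Y" "r x a \<in> car X" "l a y \<in> car Y"
  shows "btns R X r Y l (r x a) y = btns R X r Y l x (l a y)"
proof -
  interpret vector_space fscale by (rule vector_space_fscale)
  have "(r x a \<otimes>\<^bsub>X,Y\<^esub> y) - (x \<otimes>\<^bsub>X,Y\<^esub> l a y) \<in> balancing R X r Y l"
    unfolding balancing_def using assms(1-3) by (intro span_base) blast
  from qcls_zero[OF this, of "X \<otimes> Y"] show ?thesis
    using assms by (simp add: btns_def lin_diff[OF vspace_tensor lin_qcls])
qed

subsection \<open>Hopf algebras\<close>

context k_algebra
begin

lemma vspace [simp]: "vspace A"
proof -
  interpret vector_space "scl A" by (rule vector_space_scl)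
  show ?thesis by (simp add: vspace_def vector_space_scl car_UNIV)
qed

lemma mem_car [simp]: "x \<in> car A"
  by (simp add: car_UNIV)

lemma lin_mult_left: "lin X A f \<Longrightarrow> lin X A (\<lambda>x. f x * c)"
  by (rule lin_compose[where g = "\<lambda>x. x * c"], assumption) (simp add: lin_def mult_scl_left distrib_right)

lemma lin_mult_right: "lin X A f \<Longrightarrow> lin X A (\<lambda>x. c * f x)"
  by (rule lin_compose[where g = "\<lambda>x. c * x"], assumption) (simp add: lin_def mult_scl_right distrib_left)

lemma lin_algebra_mult: "lin (A \<otimes> A) A (algebra_mult A)"
  and algebra_mult_tns [simp]: "algebra_mult A (x \<otimes>\<^bsub>A,A\<^esub> y) = x * y"
proof -
  have b: "bilin A A A (*)" by (intro lin_intros lin_mult_left lin_mult_right; simp)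
  show "lin (A \<otimes> A) A (algebra_mult A)" "algebra_mult A (x \<otimes>\<^bsub>A,A\<^esub> y) = x * y"
    unfolding algebra_mult_def by (simp_all add: tlift[OF vspace b])
qed

lemma lin_lmul: "lin (A \<otimes> A) (A \<otimes> A) (lmul A a)"
  and lmul_tns [simp]: "lmul A a (x \<otimes>\<^bsub>A,A\<^esub> y) = (a * x) \<otimes>\<^bsub>A,A\<^esub> y"
  and lin_lmul_param: "z \<in> car (A \<otimes> A) \<Longrightarrow> lin A (A \<otimes> A) (\<lambda>a. lmul A a z)"
proof -
  have b: "bilin A A (A \<otimes> A) (\<lambda>x y. (a * x) \<otimes>\<^bsub>A,A\<^esub> y)" for a
    by (intro lin_intros lin_mult_left lin_mult_right; simp)
  show "lin (A \<otimes> A) (A \<otimes> A) (lmul A a)" "lmul A a (x \<otimes>\<^bsub>A,A\<^esub> y) = (a * x) \<otimes>\<^bsub>A,A\<^esub> y"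
    unfolding lmul_def by (simp_all add: tlift[OF vspace_tensor b])
  show "z \<in> car (A \<otimes> A) \<Longrightarrow> lin A (A \<otimes> A) (\<lambda>a. lmul A a z)"
    unfolding lmul_def by (intro lin_intros b lin_mult_left vspace_tensor) simp_all
qed

lemma lin_rmul: "lin (A \<otimes> A) (A \<otimes> A) (\<lambda>z. rmul A z a)"
  and rmul_tns [simp]: "rmul A (x \<otimes>\<^bsub>A,A\<^esub> y) a = x \<otimes>\<^bsub>A,A\<^esub> (y * a)"
  and lin_rmul_param: "z \<in> car (A \<otimes> A) \<Longrightarrow> lin A (A \<otimes> A) (rmul A z)"
proof -
  have b: "bilin A A (A \<otimes> A) (\<lambda>x y. x \<otimes>\<^bsub>A,A\<^esub> (y * a))" for a
    by (intro lin_intros lin_mult_left lin_mult_right; simp)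
  show "lin (A \<otimes> A) (A \<otimes> A) (\<lambda>z. rmul A z a)" "rmul A (x \<otimes>\<^bsub>A,A\<^esub> y) a = x \<otimes>\<^bsub>A,A\<^esub> (y * a)"
    unfolding rmul_def by (simp_all add: tlift[OF vspace_tensor b])
  show "z \<in> car (A \<otimes> A) \<Longrightarrow> lin A (A \<otimes> A) (rmul A z)"
    unfolding rmul_def by (intro lin_intros b lin_mult_right vspace_tensor) simp_all
qed

lemma univ_forms_subset: "univ_forms A \<subseteq> car (A \<otimes> A)"
  by (auto simp: univ_forms_def)

lemma subspace_univ_forms: "module.subspace fscale (univ_forms A)"
proof -
  interpret vector_space fscale by (rule vector_space_fscale)
  show ?thesis
    using vspace_zero[OF vspace_tensor[of A A]] vspace_add[OF vspace_tensor[of A A]]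
      vspace_scl[OF vspace_tensor[of A A]] lin_scl[OF lin_algebra_mult]
    by (intro subspaceI) (auto simp: univ_forms_def lin_zero[OF vspace_tensor lin_algebra_mult]
        lin_add[OF lin_algebra_mult] vspace_scl_zero[OF vspace])
qed

lemma lmul_univ_forms: "z \<in> univ_forms A \<Longrightarrow> lmul A a z \<in> univ_forms A"
proof -
  have "algebra_mult A (lmul A a z) = a * algebra_mult A z" if "z \<in> car (A \<otimes> A)"
    by (rule lin_tensor_ext[OF lin_compose[OF lin_lmul lin_algebra_mult]
          lin_mult_right[OF lin_algebra_mult] refl _ that]) (simp add: mult.assoc)
  then show "z \<in> univ_forms A \<Longrightarrow> lmul A a z \<in> univ_forms A"
    using lin_mem[OF lin_lmul] by (simp add: univ_forms_def)
qed

lemma rmul_univ_forms: "z \<in> univ_forms A \<Longrightarrow> rmul A z a \<in> univ_forms A"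
proof -
  have "algebra_mult A (rmul A z a) = algebra_mult A z * a" if "z \<in> car (A \<otimes> A)"
    by (rule lin_tensor_ext[OF lin_compose[OF lin_rmul lin_algebra_mult]
          lin_mult_left[OF lin_algebra_mult] refl _ that]) (simp add: mult.assoc)
  then show "z \<in> univ_forms A \<Longrightarrow> rmul A z a \<in> univ_forms A"
    using lin_mem[OF lin_rmul] by (simp add: univ_forms_def)
qed

end

section \<open>Sweedler calculus and the antipode\<close>

context hopf_algebra
begin

abbreviation HH :: "('k, ('k, 'h, 'h) tens) kspace" where "HH \<equiv> H \<otimes> H"

abbreviation tnsH :: "'h \<Rightarrow> 'h \<Rightarrow> ('k, 'h, 'h) tens" (infixr "\<odot>" 70) where
  "g \<odot> h \<equiv> g \<otimes>\<^bsub>H,H\<^esub> h"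

abbreviation sw :: "'h \<Rightarrow> ('h \<Rightarrow> 'h \<Rightarrow> 'c::comm_monoid_add) \<Rightarrow> 'c" where
  "sw h F \<equiv> tsum H H (\<Delta> h) F"

lemma comult_mem [simp]: "\<Delta> h \<in> car HH"
  by (rule lin_mem[OF lin_comult]) simp

lemmas hopf_lin = lin_mult_left lin_mult_right lin_compose[OF _ lin_comult]
  lin_compose[OF _ lin_antipode] lin_compose[OF _ lin_counit]

lemma lin_tsum_H: "lin H U' g \<Longrightarrow> sw h (\<lambda>a b. g (f a b)) = g (sw h f)"
  by (rule lin_tsum[symmetric, where U = H]) simp_all

lemma tlift_sw: "vspace U \<Longrightarrow> bilin H H U F \<Longrightarrow> tlift H H U F (\<Delta> h) = sw h F"
  by (rule tlift_tsum) simp_all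

lemma sw_mem [simp]: "vspace U \<Longrightarrow> (\<And>x y. F x y \<in> car U) \<Longrightarrow> sw h F \<in> car U"
  by (rule tsum_mem) simp_all

text \<open>A trilinear \<open>F\<close> factors through a linear map \<open>G\<close> on
  \<open>H \<otimes> (H \<otimes> H)\<close>. Applying \<open>G\<close> to the axiom
  \<open>coassoc\<close> gives the rule for arbitrary summands.\<close>

lemma sw_coassoc:
  assumes U: "vspace U"
    and 1: "\<And>y c. lin H U (\<lambda>x. F x y c)" and 2: "\<And>x c. lin H U (\<lambda>y. F x y c)"
    and 3: "\<And>x y. lin H U (\<lambda>c. F x y c)"
  shows "sw h (\<lambda>a c. sw a (\<lambda>x y. F x y c)) = sw h (\<lambda>a b. sw b (\<lambda>y c. F a y c))"
proof -
  have b2: "bilin H H U (F a)" for a by (intro bilinI 2 3)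
  have b1: "bilin H HH U (\<lambda>a. tlift H H U (F a))"
    by (intro bilinI tlift(1) b2 U lin_tlift_param) (simp_all add: b2 1)
  define G where "G = tlift H HH U (\<lambda>a. tlift H H U (F a))"
  have lG: "lin (H \<otimes> HH) U G" unfolding G_def by (rule tlift(1)[OF U b1])
  have G: "G (a \<otimes>\<^bsub>H,HH\<^esub> z) = tsum H H z (F a)" if "z \<in> car HH" for a z
    unfolding G_def using that by (simp add: tlift(2)[OF U b1] tlift_tsum[OF U b2])
  have G': "G (a \<otimes>\<^bsub>H,HH\<^esub> (y \<odot> c)) = F a y c" for a y c
    by (simp add: G tns_mem tsum_tns[OF U b2])
  have vs: "vspace (H \<otimes> HH)" by (rule vspace_tensor)
  have m: "a \<otimes>\<^bsub>H,HH\<^esub> (y \<odot> c) \<in> car (H \<otimes> HH)" for a y c by (simp add: tns_mem)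
  have bb: "bilin H H (H \<otimes> HH) (\<lambda>x y. x \<otimes>\<^bsub>H,HH\<^esub> (y \<odot> c))" for c
    by (intro lin_intros) (simp_all add: tns_mem)
  have l: "tlift H H (H \<otimes> HH) (\<lambda>a c. tlift H H (H \<otimes> HH) (\<lambda>x y. x \<otimes>\<^bsub>H,HH\<^esub> (y \<odot> c)) (\<Delta> a)) (\<Delta> h)
      = sw h (\<lambda>a c. sw a (\<lambda>x y. x \<otimes>\<^bsub>H,HH\<^esub> (y \<odot> c)))"
    unfolding tlift_sw[OF vs bb]
    by (rule tlift_sw[OF vs]) (intro lin_intros hopf_lin; simp add: tns_mem vs vspace_tensor)
  have r: "tlift H H (H \<otimes> HH) (\<lambda>a b. a \<otimes>\<^bsub>H,HH\<^esub> \<Delta> b) (\<Delta> h) = sw h (\<lambda>a b. a \<otimes>\<^bsub>H,HH\<^esub> \<Delta> b)"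
    by (rule tlift_sw[OF vs]) (intro lin_intros hopf_lin; simp add: tns_mem vs vspace_tensor)
  have "G (sw h (\<lambda>a c. sw a (\<lambda>x y. x \<otimes>\<^bsub>H,HH\<^esub> (y \<odot> c)))) = G (sw h (\<lambda>a b. a \<otimes>\<^bsub>H,HH\<^esub> \<Delta> b))"
    using coassoc[of h] unfolding l r by simp
  then show ?thesis
    by (simp add: lin_tsum[OF lG] vs m tns_mem G G')
qed

lemma sw_counit_left: "sw h (\<lambda>a b. scl H (\<epsilon> a) b) = h"
  by (subst tlift_sw[symmetric, of H]) (simp, (intro lin_intros hopf_lin; simp), rule counit_left)

lemma sw_counit_right: "sw h (\<lambda>a b. scl H (\<epsilon> b) a) = h"
  by (subst tlift_sw[symmetric, of H]) (simp, (intro lin_intros hopf_lin; simp), rule counit_right)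

lemma sw_antipode_left: "sw h (\<lambda>a b. S a * b) = scl H (\<epsilon> h) 1"
  by (subst tlift_sw[symmetric, of H]) (simp, (intro lin_intros hopf_lin; simp), rule antipode_left)

lemma sw_antipode_right: "sw h (\<lambda>a b. a * S b) = scl H (\<epsilon> h) 1"
  by (subst tlift_sw[symmetric, of H]) (simp, (intro lin_intros hopf_lin; simp), rule antipode_right)

lemma sw_counit_left': "lin H U f \<Longrightarrow> sw h (\<lambda>a b. f (scl H (\<epsilon> a) b)) = f h"
  by (subst lin_tsum_H) (simp_all add: sw_counit_left)

lemma sw_one: "vspace U \<Longrightarrow> bilin H H U F \<Longrightarrow> sw 1 F = F 1 1"
  by (simp add: comult_one tsum_tns)

lemma sw_mult:
  assumes "vspace U" "bilin H H U F"
  shows "sw (g * h) F = sw g (\<lambda>a b. sw h (\<lambda>c d. F (a * c) (b * d)))"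
proof -
  note F = lin_bilin_left[OF assms(2)] lin_bilin_right[OF assms(2)]
  have b1: "bilin H H HH (\<lambda>c d. (a * c) \<odot> (b * d))" for a b
    by (intro lin_intros hopf_lin; simp)
  have "\<Delta> (g * h) = sw g (\<lambda>a b. sw h (\<lambda>c d. (a * c) \<odot> (b * d)))"
    unfolding comult_mult tmult_def tlift_sw[OF vspace_tensor b1]
    by (rule tlift_sw[OF vspace_tensor]) (intro lin_intros hopf_lin; simp add: vspace_tensor)
  then have "tlift H H U F (\<Delta> (g * h)) = sw g (\<lambda>a b. sw h (\<lambda>c d. tlift H H U F ((a * c) \<odot> (b * d))))"
    by (simp add: lin_tsum[OF tlift(1)[OF assms]] vspace_tensor tns_mem)
  then show ?thesis by (simp add: tlift_sw[OF assms] tlift(2)[OF assms])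
qed

text \<open>Coassociativity brings the first two legs together, the antipode axiom collapses them to
  a scalar, and the counit absorbs it: g_(1) S(g_(2)) \<otimes> g_(3) = 1 \<otimes> g.\<close>

lemma sw_cancel_right:
  assumes "vspace U" "bilin H H U F"
  shows "sw g (\<lambda>p c. sw c (\<lambda>x b. F (p * S x) b)) = F 1 g"
proof -
  note F = lin_bilin_left[OF assms(2)] lin_bilin_right[OF assms(2)]
  have "sw g (\<lambda>p c. sw c (\<lambda>x b. F (p * S x) b)) = sw g (\<lambda>s b. sw s (\<lambda>p x. F (p * S x) b))"
    by (rule sw_coassoc[symmetric, OF assms(1)]) (intro lin_intros hopf_lin F; simp)+
  also have "\<dots> = sw g (\<lambda>s b. F (scl H (\<epsilon> s) 1) b)"
    by (simp add: lin_tsum_H[OF bilin_left[OF assms(2)]] sw_antipode_right)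
  also have "\<dots> = sw g (\<lambda>s b. F 1 (scl H (\<epsilon> s) b))"
    by (simp add: lin_scl[OF bilin_left[OF assms(2)]] lin_scl[OF bilin_right[OF assms(2)]])
  also have "\<dots> = F 1 g"
    by (rule sw_counit_left'[OF bilin_right[OF assms(2)]]) simp
  finally show ?thesis .
qed

lemma sw_cancel_left:
  assumes "vspace U" "bilin H H U F"
  shows "sw g (\<lambda>p c. sw c (\<lambda>x b. F (S p * x) b)) = F 1 g"
proof -
  note F = lin_bilin_left[OF assms(2)] lin_bilin_right[OF assms(2)]
  have "sw g (\<lambda>p c. sw c (\<lambda>x b. F (S p * x) b)) = sw g (\<lambda>s b. sw s (\<lambda>p x. F (S p * x) b))"
    by (rule sw_coassoc[symmetric, OF assms(1)]) (intro lin_intros hopf_lin F; simp)+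
  also have "\<dots> = sw g (\<lambda>s b. F (scl H (\<epsilon> s) 1) b)"
    by (simp add: lin_tsum_H[OF bilin_left[OF assms(2)]] sw_antipode_left)
  also have "\<dots> = sw g (\<lambda>s b. F 1 (scl H (\<epsilon> s) b))"
    by (simp add: lin_scl[OF bilin_left[OF assms(2)]] lin_scl[OF bilin_right[OF assms(2)]])
  also have "\<dots> = F 1 g"
    by (rule sw_counit_left'[OF bilin_right[OF assms(2)]]) simp
  finally show ?thesis .
qed

text \<open>Uniqueness of convolution inverses, written out: S h S g is multiplied by a counit
  factor, this is expanded by the right antipode axiom for a product, and the inner factors then
  cancel by the left one.\<close>

lemma antipode_mult: "S (g * h) = S h * S g"
proof -
  have "S h * S g = sw h (\<lambda>h1 h'. sw g (\<lambda>g1 g'. S h1 * S g1 * scl H (\<epsilon> (g' * h')) 1))"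
  proof -
    have "S h * S g = S (sw h (\<lambda>a b. scl H (\<epsilon> b) a)) * S (sw g (\<lambda>a b. scl H (\<epsilon> b) a))"
      by (simp add: sw_counit_right)
    also have "\<dots> = sw h (\<lambda>a b. S (scl H (\<epsilon> b) a)) * sw g (\<lambda>a b. S (scl H (\<epsilon> b) a))"
      by (simp add: lin_tsum_H[OF lin_antipode])
    also have "\<dots> = sw h (\<lambda>h1 h'. sw g (\<lambda>g1 g'. S (scl H (\<epsilon> h') h1) * S (scl H (\<epsilon> g') g1)))"
      by (simp add: tsum_mult_left tsum_mult_right)
    also have "\<dots> = sw h (\<lambda>h1 h'. sw g (\<lambda>g1 g'. S h1 * S g1 * scl H (\<epsilon> (g' * h')) 1))"
      by (simp add: lin_scl[OF lin_antipode] mult_scl_left mult_scl_right counit_mult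
          vspace_scl_scl mult.commute)
    finally show ?thesis .
  qed
  \<comment> \<open>The scalar \<epsilon>(g' h') is expanded as (g' h')_(1) S((g' h')_(2)), with the
    coproduct of the product split into those of its factors.\<close>
  also have "\<dots> = sw h (\<lambda>h1 h'. sw g (\<lambda>g1 g'. S h1 * S g1 * sw g' (\<lambda>g2 g3. sw h' (\<lambda>h2 h3. g2 * h2 * S (g3 * h3)))))"
    unfolding sw_antipode_right[symmetric]
    by (subst sw_mult[OF vspace]) ((intro lin_intros hopf_lin; simp), simp)
  also have "\<dots> = sw h (\<lambda>h1 h'. sw h' (\<lambda>h2 h3. sw g (\<lambda>g1 g'. sw g' (\<lambda>g2 g3. S h1 * (S g1 * g2) * h2 * S (g3 * h3)))))"
  proof -
    have "sw g (\<lambda>g1 g'. S h1 * S g1 * sw g' (\<lambda>g2 g3. sw h' (\<lambda>h2 h3. g2 * h2 * S (g3 * h3))))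
        = sw h' (\<lambda>h2 h3. sw g (\<lambda>g1 g'. sw g' (\<lambda>g2 g3. S h1 * (S g1 * g2) * h2 * S (g3 * h3))))" for h1 h'
      by (simp only: tsum_mult_left[symmetric] mult.assoc tsum_swap[of H H "\<Delta> h'" H H])
    then show ?thesis by simp
  qed
  \<comment> \<open>The pair S(g_(1)) g_(2) is now adjacent and cancels; once it is gone, S(h_(1))
    h_(2) is adjacent in turn.\<close>
  also have "\<dots> = sw h (\<lambda>h1 h'. sw h' (\<lambda>h2 h3. S h1 * 1 * h2 * S (g * h3)))"
  proof -
    have "sw g (\<lambda>g1 g'. sw g' (\<lambda>g2 g3. S h1 * (S g1 * g2) * h2 * S (g3 * h3))) = S h1 * 1 * h2 * S (g * h3)"
      for h1 h2 h3
      by (rule sw_cancel_left[OF vspace, where F = "\<lambda>u g3. S h1 * u * h2 * S (g3 * h3)"])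
        (intro lin_intros hopf_lin; simp)
    then show ?thesis by simp
  qed
  also have "\<dots> = S (g * h)"
    using sw_cancel_left[OF vspace, where F = "\<lambda>u h3. u * S (g * h3)"]
    by (simp add: bilinI hopf_lin lin_id)
  finally show ?thesis ..
qed

lemma antipode_one: "S 1 = 1"
proof -
  have "sw 1 (\<lambda>a b. S a * b) = S 1 * 1"
    by (rule sw_one[OF vspace]) (intro lin_intros hopf_lin; simp)
  then show ?thesis by (simp add: sw_antipode_left counit_one vspace_scl_one)
qed

text \<open>Apply \<epsilon> to S(h_(1)) h_(2) = \<epsilon>(h) 1 and let the counit absorb the
  second leg.\<close>

lemma counit_antipode: "\<epsilon> (S h) = \<epsilon> h"
proof -
  have "\<epsilon> h = \<epsilon> (sw h (\<lambda>a b. S a * b))"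
    using lin_scl[OF lin_counit, of 1 "\<epsilon> h"] by (simp add: sw_antipode_left counit_one gnd_def)
  also have "\<dots> = sw h (\<lambda>a b. \<epsilon> (S (scl H (\<epsilon> b) a)))"
    using lin_scl[OF lin_counit] by (simp add: lin_tsum_H[OF lin_counit, symmetric] counit_mult
        lin_scl[OF lin_antipode] gnd_def mult.commute)
  also have "\<dots> = \<epsilon> (S h)"
    by (simp add: lin_tsum_H[OF lin_compose[OF lin_antipode lin_counit]] sw_counit_right)
  finally show ?thesis ..
qed

section \<open>Trivialising the forms on \<open>H\<close>\<close>

definition twist :: "('k, 'h, 'h) tens \<Rightarrow> ('k, 'h, 'h) tens" where
  "twist = tlift H H HH (\<lambda>h g. sw g (\<lambda>g1 g2. (h * g1) \<odot> g2))"

text \<open>The inverse of \<open>twist\<close>: the antipode removes the leg g_(1) that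
  \<open>twist\<close> multiplies on.\<close>

definition untwist :: "('k, 'h, 'h) tens \<Rightarrow> ('k, 'h, 'h) tens" where
  "untwist = tlift H H HH (\<lambda>h g. sw g (\<lambda>g1 g2. (h * S g1) \<odot> g2))"

lemma lin_twist: "lin HH HH twist"
  and twist: "twist (h \<odot> g) = sw g (\<lambda>g1 g2. (h * g1) \<odot> g2)"
proof -
  have b: "bilin H H HH (\<lambda>h g. sw g (\<lambda>g1 g2. (h * g1) \<odot> g2))"
    by (intro lin_intros hopf_lin; simp)
  show "lin HH HH twist" "twist (h \<odot> g) = sw g (\<lambda>g1 g2. (h * g1) \<odot> g2)"
    unfolding twist_def by (simp_all add: tlift[OF vspace_tensor b])
qed

lemma lin_untwist: "lin HH HH untwist"
  and untwist: "untwist (h \<odot> g) = sw g (\<lambda>g1 g2. (h * S g1) \<odot> g2)"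
proof -
  have b: "bilin H H HH (\<lambda>h g. sw g (\<lambda>g1 g2. (h * S g1) \<odot> g2))"
    by (intro lin_intros hopf_lin; simp)
  show "lin HH HH untwist" "untwist (h \<odot> g) = sw g (\<lambda>g1 g2. (h * S g1) \<odot> g2)"
    unfolding untwist_def by (simp_all add: tlift[OF vspace_tensor b])
qed

lemma twist_untwist: "z \<in> car HH \<Longrightarrow> twist (untwist z) = z"
proof (rule lin_tensor_ext[OF lin_compose[OF lin_untwist lin_twist] lin_id refl])
  fix h g
  have b: "bilin H H HH (\<lambda>u b. (h * u) \<odot> b)"
    by (intro lin_intros hopf_lin; simp)
  have "twist (untwist (h \<odot> g)) = sw g (\<lambda>g1 g'. sw g' (\<lambda>g2 g3. (h * (S g1 * g2)) \<odot> g3))"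
    by (simp add: untwist lin_tsum[OF lin_twist] twist mult.assoc)
  also have "\<dots> = h \<odot> g"
    using sw_cancel_left[OF vspace_tensor b, of g] by simp
  finally show "twist (untwist (h \<odot> g)) = h \<odot> g" .
qed simp

lemma bicovariant_relations_eq:
  "bicovariant_relations H \<Delta> Q = {z \<in> univ_forms H. twist z \<in> tspan H H UNIV Q}"
proof -
  have "bilin H H HH (\<lambda>g1 g2. (h * g1) \<odot> g2)" for h
    by (intro lin_intros hopf_lin; simp)
  then show ?thesis
    unfolding bicovariant_relations_def twist_def by (simp add: tlift_sw)
qed

section \<open>The diagonal coaction of \<open>H\<close> on \<open>H \<otimes> H\<close>\<close>

definition diag_coaction :: "('k, 'h, 'h) tens \<Rightarrow> ('k, ('k, 'h, 'h) tens, 'h) tens" where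
  "diag_coaction = tlift H H (HH \<otimes> H)
     (\<lambda>h g. sw h (\<lambda>h1 h2. sw g (\<lambda>g1 g2. (h1 \<odot> g1) \<otimes>\<^bsub>HH,H\<^esub> (h2 * g2))))"

lemma lin_diag_coaction: "lin HH (HH \<otimes> H) diag_coaction"
  and diag_coaction: "diag_coaction (h \<odot> g)
    = sw h (\<lambda>h1 h2. sw g (\<lambda>g1 g2. (h1 \<odot> g1) \<otimes>\<^bsub>HH,H\<^esub> (h2 * g2)))"
proof -
  have b: "bilin H H (HH \<otimes> H)
      (\<lambda>h g. sw h (\<lambda>h1 h2. sw g (\<lambda>g1 g2. (h1 \<odot> g1) \<otimes>\<^bsub>HH,H\<^esub> (h2 * g2))))"
    by (intro lin_intros hopf_lin; simp)
  show "lin HH (HH \<otimes> H) diag_coaction" "diag_coaction (h \<odot> g)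
      = sw h (\<lambda>h1 h2. sw g (\<lambda>g1 g2. (h1 \<odot> g1) \<otimes>\<^bsub>HH,H\<^esub> (h2 * g2)))"
    unfolding diag_coaction_def by (simp_all add: tlift[OF vspace_tensor b])
qed

text \<open>Universal forms are sums of c(h,g) = h \<otimes> g - h g \<otimes> 1. Since \<Delta> is
  multiplicative, the coaction sends c(h,g) to c(h_(1),g_(1)) \<otimes> h_(2) g_(2).\<close>

lemma diag_coaction_univ_forms:
  assumes "z \<in> univ_forms H"
  shows "diag_coaction z \<in> tspan HH H (univ_forms H) UNIV"
proof -
  let ?T = "tspan HH H (univ_forms H) UNIV"
  have z: "z \<in> car HH" "algebra_mult H z = 0" using assms by (auto simp: univ_forms_def)
  define c where "c h g = h \<odot> g - (h * g) \<odot> 1" for h g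
  have c: "c h g \<in> univ_forms H" for h g
    by (auto simp: univ_forms_def c_def lin_diff[OF vspace_tensor lin_algebra_mult] intro: vspace_diff[OF vspace_tensor])
  have lc: "lin H HH (\<lambda>u. u \<odot> 1)" by (intro lin_intros; simp)
  have "z - algebra_mult H z \<odot> 1 = tsum H H z c"
  \<comment> \<open>The difference between \<open>z\<close> and its sum of generators is the product
    of \<open>z\<close> tensored with 1, which is zero for a universal form.\<close>
  proof -
    have "z = tsum H H z (\<lambda>h g. h \<odot> g)" by (simp add: tsum_self z)
    moreover have "algebra_mult H z \<odot> 1 = tsum H H z (\<lambda>h g. (h * g) \<odot> 1)"
      by (subst tsum_self[OF vspace vspace z(1), symmetric])
        (simp add: lin_tsum[OF lin_algebra_mult] z lin_tsum[OF lc])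
    moreover have "tsum H H z (\<lambda>h g. h \<odot> g) = tsum H H z c + tsum H H z (\<lambda>h g. (h * g) \<odot> 1)"
      by (simp add: c_def flip: tsum_add)
    ultimately show ?thesis by (metis add_diff_cancel_right')
  qed
  then have zc: "z = tsum H H z c" using lin_zero[OF vspace lc] by (simp add: z)
  have "diag_coaction (c h g) \<in> ?T" for h g
  proof -
    have "bilin H H (HH \<otimes> H) (\<lambda>a b. (a \<odot> 1) \<otimes>\<^bsub>HH,H\<^esub> b)"
      by (intro lin_intros; simp)
    note 1 = sw_mult[OF vspace_tensor this]
    have 2: "sw 1 (\<lambda>g1 g2. (h1 \<odot> g1) \<otimes>\<^bsub>HH,H\<^esub> (h2 * g2))
        = (h1 \<odot> 1) \<otimes>\<^bsub>HH,H\<^esub> (h2 * 1)" for h1 h2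
      by (rule sw_one[OF vspace_tensor[of "HH" H]]) (intro lin_intros hopf_lin; simp)
    have "diag_coaction (h \<odot> g) = sw h (\<lambda>h1 h2. sw g (\<lambda>g1 g2.
        c h1 g1 \<otimes>\<^bsub>HH,H\<^esub> (h2 * g2) + ((h1 * g1) \<odot> 1) \<otimes>\<^bsub>HH,H\<^esub> (h2 * g2)))"
      unfolding diag_coaction
      by (simp add: c_def vspace_diff
          lin_diff[OF vspace_tensor bilin_left[OF bilin_tns[of "HH" H]]])
    also have "\<dots> = sw h (\<lambda>h1 h2. sw g (\<lambda>g1 g2. c h1 g1 \<otimes>\<^bsub>HH,H\<^esub> (h2 * g2)))
        + diag_coaction ((h * g) \<odot> 1)"
      by (simp add: tsum_add diag_coaction 2 1)
    finally have "diag_coaction (c h g) = sw h (\<lambda>h1 h2. sw g (\<lambda>g1 g2. c h1 g1 \<otimes>\<^bsub>HH,H\<^esub> (h2 * g2)))"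
      by (simp add: c_def[of h g] lin_diff[OF vspace_tensor lin_diag_coaction])
    then show ?thesis
      by (simp add: tsum_mem_subspace[OF vector_space_fscale subspace_tspan] tspan_base c)
  qed
  then show ?thesis
    by (subst zc) (simp add: lin_tsum[OF lin_diag_coaction] z c[THEN subsetD[OF univ_forms_subset]]
        tsum_mem_subspace[OF vector_space_fscale subspace_tspan])
qed

lemma Ad_eq: "Ad H \<Delta> S q = sw q (\<lambda>q1 b. sw b (\<lambda>q2 q3. q2 \<odot> (S q1 * q3)))"
proof -
  have b: "bilin H H HH (\<lambda>q2 q3. q2 \<odot> (S q1 * q3))" for q1
    by (intro lin_intros hopf_lin; simp)
  show ?thesis
    unfolding Ad_def tlift_sw[OF vspace_tensor b]
    by (rule tlift_sw[OF vspace_tensor]) (intro lin_intros hopf_lin; simp)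
qed

text \<open>The coaction on \<open>H \<otimes> Q\<close> to which \<open>twist\<close> carries the diagonal one.\<close>

definition twisted_coaction :: "('k, 'h, 'h) tens \<Rightarrow> ('k, ('k, 'h, 'h) tens, 'h) tens" where
  "twisted_coaction = tlift H H (HH \<otimes> H) (\<lambda>a q. sw a (\<lambda>a1 a2. tlift H H (HH \<otimes> H)
     (\<lambda>q' k. untwist (a1 \<odot> q') \<otimes>\<^bsub>HH,H\<^esub> (a2 * k)) (Ad H \<Delta> S q)))"

lemma lin_Ad: "lin X H f \<Longrightarrow> vspace X \<Longrightarrow> lin X HH (\<lambda>x. Ad H \<Delta> S (f x))"
  unfolding Ad_eq by (intro lin_intros hopf_lin) simp_all

lemma bilin_untwist: "bilin H H (HH \<otimes> H) (\<lambda>q' k. untwist (a1 \<odot> q') \<otimes>\<^bsub>HH,H\<^esub> (a2 * k))"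
  by (intro lin_intros hopf_lin lin_compose[OF _ lin_untwist];
      simp add: lin_mem[OF lin_untwist])

lemma lin_twisted_coaction: "lin HH (HH \<otimes> H) twisted_coaction"
  and twisted_coaction: "twisted_coaction (a \<odot> q)
    = sw a (\<lambda>a1 a2. tlift H H (HH \<otimes> H)
     (\<lambda>q' k. untwist (a1 \<odot> q') \<otimes>\<^bsub>HH,H\<^esub> (a2 * k)) (Ad H \<Delta> S q))"
proof -
  have b: "bilin H H (HH \<otimes> H) (\<lambda>a q. sw a (\<lambda>a1 a2. tlift H H (HH \<otimes> H)
     (\<lambda>q' k. untwist (a1 \<odot> q') \<otimes>\<^bsub>HH,H\<^esub> (a2 * k)) (Ad H \<Delta> S q)))"
    by (intro lin_intros bilin_untwist hopf_lin lin_Ad lin_compose[OF _ lin_untwist];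
        simp add: lin_mem[OF lin_untwist] lin_mem[OF lin_Ad[OF lin_id]])
  show "lin HH (HH \<otimes> H) twisted_coaction" "twisted_coaction (a \<odot> q)
    = sw a (\<lambda>a1 a2. tlift H H (HH \<otimes> H)
     (\<lambda>q' k. untwist (a1 \<odot> q') \<otimes>\<^bsub>HH,H\<^esub> (a2 * k)) (Ad H \<Delta> S q))"
    unfolding twisted_coaction_def by (simp_all add: tlift[OF vspace_tensor b])
qed

text \<open>Two cancellations of a leg against the antipode of the next one undo the twist: one in
  the coacting leg, against the antipode inside \<open>Ad\<close>, and one in the first leg, against
  the antipode inside \<open>untwist\<close>.\<close>

lemma twisted_coaction_twist:
  assumes "z \<in> car HH"
  shows "twisted_coaction (twist z) = diag_coaction z"
proof (rule lin_tensor_ext[OF lin_compose[OF lin_twist lin_twisted_coaction] lin_diag_coaction refl _ assms])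
  fix h g
  let ?U = "HH \<otimes> H"
  \<comment> \<open>The summand of \<open>twisted_coaction\<close> with \<open>Ad\<close> and
    \<open>untwist\<close> both expanded, once the first argument has been split into
    \<open>a1\<close> and \<open>a2\<close>.\<close>
  define K where "K a1 a2 q = sw q (\<lambda>x b. sw b (\<lambda>y z. sw y (\<lambda>y1 y2.
     ((a1 * S y1) \<odot> y2) \<otimes>\<^bsub>HH,H\<^esub> (a2 * S x * z))))" for a1 a2 q
  note mems = vspace_tensor tns_mem
  have K: "tlift H H ?U (\<lambda>q' k. untwist (a1 \<odot> q') \<otimes>\<^bsub>HH,H\<^esub> (a2 * k)) (Ad H \<Delta> S q) = K a1 a2 q"
    for a1 a2 q
  proof -
    have "tlift H H ?U (\<lambda>q' k. untwist (a1 \<odot> q') \<otimes>\<^bsub>HH,H\<^esub> (a2 * k)) (Ad H \<Delta> S q)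
        = sw q (\<lambda>x b. sw b (\<lambda>y z. untwist (a1 \<odot> y) \<otimes>\<^bsub>HH,H\<^esub> (a2 * (S x * z))))"
      by (simp add: Ad_eq lin_tsum[OF tlift(1)[OF vspace_tensor bilin_untwist]] mems
          tlift(2)[OF vspace_tensor bilin_untwist])
    then show ?thesis
      by (simp add: K_def untwist mems mult.assoc lin_tsum[OF bilin_left[OF bilin_tns[of "HH" H]]])
  qed
  have lK: "lin X ?U (\<lambda>x. K (f x) a2 q)" "lin X ?U (\<lambda>x. K a1 (f x) q)" "lin X ?U (\<lambda>x. K a1 a2 (f x))"
    if "lin X H f" "vspace X" for X :: "('k, 'x::ab_group_add) kspace" and f a1 a2 q
    unfolding K_def using that by - (intro lin_intros hopf_lin; simp add: mems)+
  have "twisted_coaction (twist (h \<odot> g))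
      = sw g (\<lambda>g1 g'. sw (h * g1) (\<lambda>a1 a2. K a1 a2 g'))"
    by (simp add: twist lin_tsum[OF lin_twisted_coaction] mems twisted_coaction K)
  also have "\<dots> = sw g (\<lambda>g1 g'. sw h (\<lambda>h1 h2. sw g1 (\<lambda>x y. K (h1 * x) (h2 * y) g')))"
    by (simp add: sw_mult[OF vspace_tensor[of "HH" H]] bilinI lK lin_id)
  also have "\<dots> = sw h (\<lambda>h1 h2. sw g (\<lambda>g1 g'. sw g1 (\<lambda>x y. K (h1 * x) (h2 * y) g')))"
    by (rule tsum_swap)
  also have "\<dots> = diag_coaction (h \<odot> g)"
  proof -
    have 1: "sw g (\<lambda>g1 g'. sw g1 (\<lambda>x y. K (h1 * x) (h2 * y) g'))
        = sw g (\<lambda>p r. sw r (\<lambda>y g'. K (h1 * p) (h2 * y) g'))" for h1 h2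
      by (rule sw_coassoc[OF vspace_tensor[of "HH" H]]) (intro lK hopf_lin lin_id; simp)+
    have 2: "sw r (\<lambda>y g'. K (h1 * p) (h2 * y) g') = sw r (\<lambda>y z. sw y (\<lambda>y1 y2.
       ((h1 * p * S y1) \<odot> y2) \<otimes>\<^bsub>HH,H\<^esub> (h2 * 1 * z)))" for h1 h2 p r
      unfolding K_def mult.assoc[of h2]
      by (rule sw_cancel_right[OF vspace_tensor[of "HH" H]])
        (intro lin_intros hopf_lin; simp add: mems)
    have 3: "sw r (\<lambda>y z. sw y (\<lambda>y1 y2.
       ((h1 * p * S y1) \<odot> y2) \<otimes>\<^bsub>HH,H\<^esub> (h2 * 1 * z)))
       = sw r (\<lambda>y1 c. sw c (\<lambda>y2 z. ((h1 * (p * S y1)) \<odot> y2) \<otimes>\<^bsub>HH,H\<^esub> (h2 * 1 * z)))" for h1 h2 p r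
      unfolding mult.assoc[of h1]
      by (rule sw_coassoc[OF vspace_tensor[of "HH" H]]) (intro lin_intros hopf_lin; simp add: mems)+
    have 4: "sw g (\<lambda>p r. sw r (\<lambda>y1 c. sw c (\<lambda>y2 z. ((h1 * (p * S y1)) \<odot> y2) \<otimes>\<^bsub>HH,H\<^esub> (h2 * 1 * z))))
       = sw g (\<lambda>y2 z. ((h1 * 1) \<odot> y2) \<otimes>\<^bsub>HH,H\<^esub> (h2 * 1 * z))" for h1 h2
      by (rule sw_cancel_right[OF vspace_tensor[of "HH" H]])
        (intro lin_intros hopf_lin; simp add: mems)
    show ?thesis unfolding 1 2 3 4 by (simp only: mult_1_right diag_coaction)
  qed
  finally show "twisted_coaction (twist (h \<odot> g)) = diag_coaction (h \<odot> g)" .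
qed

end

subsection \<open>Bicovariant calculi\<close>

locale bicovariant_calculus = hopf_algebra H \<Delta> \<epsilon> S
  for H :: "('k::field, 'h::ring_1) kspace" and \<Delta> \<epsilon> S +
  fixes Q :: "'h set"
  assumes bicovariant_ideal: "bicovariant_ideal H \<Delta> \<epsilon> S Q"
begin

lemma
  shows counit_Q: "q \<in> Q \<Longrightarrow> \<epsilon> q = 0"
    and right_ideal_Q: "q \<in> Q \<Longrightarrow> q * h \<in> Q"
    and Ad_Q: "q \<in> Q \<Longrightarrow> Ad H \<Delta> S q \<in> tspan H H Q UNIV"
  using bicovariant_ideal by (auto simp: bicovariant_ideal_def)

abbreviation N\<^sub>H :: "('k, 'h, 'h) tens set" where
  "N\<^sub>H \<equiv> bicovariant_relations H \<Delta> Q"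

lemma N\<^sub>H_subset: "N\<^sub>H \<subseteq> univ_forms H"
  by (auto simp: bicovariant_relations_def)

lemma N\<^sub>H_subset_car: "N\<^sub>H \<subseteq> car HH"
  using N\<^sub>H_subset univ_forms_subset by blast

text \<open>\<open>twist\<close> commutes with left multiplication, which preserves
  \<open>H \<otimes> Q\<close>.\<close>

lemma lmul_N\<^sub>H: "z \<in> N\<^sub>H \<Longrightarrow> lmul H h z \<in> N\<^sub>H"
proof -
  assume "z \<in> N\<^sub>H"
  then have z: "z \<in> univ_forms H" "z \<in> car HH" "twist z \<in> tspan H H UNIV Q"
    using univ_forms_subset by (auto simp: bicovariant_relations_eq)
  have "twist (lmul H h z) = lmul H h (twist z)"
    by (rule lin_tensor_ext[OF lin_compose[OF lin_lmul lin_twist] lin_compose[OF lin_twist lin_lmul] refl _ z(2)])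
      (simp add: twist lin_tsum[OF lin_lmul] mult.assoc)
  also have "\<dots> \<in> tspan H H UNIV Q"
    by (rule lin_tspan_subset[OF lin_lmul _ _ _ vspace_tensor _ z(3)])
      (auto simp: subspace_tspan car_UNIV intro: tspan_base)
  finally show ?thesis using z by (simp add: bicovariant_relations_eq lmul_univ_forms)
qed

text \<open>Through \<open>twist\<close>, right multiplication by \<open>k\<close> becomes right
  multiplication by the coproduct of \<open>k\<close> on both legs; this preserves
  \<open>H \<otimes> Q\<close> because \<open>Q\<close> is a right ideal.\<close>

lemma rmul_N\<^sub>H: "z \<in> N\<^sub>H \<Longrightarrow> rmul H z k \<in> N\<^sub>H"
proof -
  assume "z \<in> N\<^sub>H"
  then have z: "z \<in> univ_forms H" "z \<in> car HH" "twist z \<in> tspan H H UNIV Q"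
    using univ_forms_subset by (auto simp: bicovariant_relations_eq)
  define r where "r a b = tlift H H HH (\<lambda>x y. (x * a) \<odot> (y * b))" for a b
  have b: "bilin H H HH (\<lambda>x y. (x * a) \<odot> (y * b))" for a b
    by (intro lin_intros hopf_lin; simp)
  note lr = tlift(1)[OF vspace_tensor b, folded r_def] and r = tlift(2)[OF vspace_tensor b, folded r_def]
  have lr1: "lin HH HH (\<lambda>z. sw k (\<lambda>a b. r a b (twist z)))"
    by (intro lin_tsum_param lin_compose[OF lin_twist lr]) simp_all
  have "twist (rmul H z k) = sw k (\<lambda>a b. r a b (twist z))"
  proof (rule lin_tensor_ext[OF lin_compose[OF lin_rmul lin_twist] lr1 refl _ z(2)])
    fix h g
    have "bilin H H HH (\<lambda>x y. (h * x) \<odot> y)" by (intro lin_intros hopf_lin; simp)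
    note m = sw_mult[OF vspace_tensor this]
    have "twist (rmul H (h \<odot> g) k) = sw g (\<lambda>c d. sw k (\<lambda>a b. (h * (c * a)) \<odot> (d * b)))"
      by (simp add: twist m)
    also have "\<dots> = sw k (\<lambda>a b. sw g (\<lambda>c d. (h * (c * a)) \<odot> (d * b)))"
      by (rule tsum_swap)
    finally show "twist (rmul H (h \<odot> g) k) = sw k (\<lambda>a b. r a b (twist (h \<odot> g)))"
      by (simp add: twist lin_tsum[OF lr] r mult.assoc)
  qed
  also have "\<dots> \<in> tspan H H UNIV Q"
  proof (rule tsum_mem_subspace[OF vector_space_fscale subspace_tspan])
    show "r a b (twist z) \<in> tspan H H UNIV Q" for a b
      by (rule lin_tspan_subset[OF lr _ _ _ vspace_tensor _ z(3)])
        (auto simp: subspace_tspan car_UNIV r intro!: tspan_base right_ideal_Q)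
  qed simp_all
  finally show ?thesis using z by (simp add: bicovariant_relations_eq rmul_univ_forms)
qed

text \<open>Multiplying out a S(q_(1)) \<otimes> q_(2) gives \<epsilon>(q) a, which is zero because
  \<open>Q\<close> lies in the kernel of the counit; \<open>twist\<close> brings the element back to
  a \<otimes> q.\<close>

lemma untwist_N\<^sub>H: "q \<in> Q \<Longrightarrow> untwist (a \<odot> q) \<in> N\<^sub>H"
proof -
  assume q: "q \<in> Q"
  have "algebra_mult H (untwist (a \<odot> q)) = sw q (\<lambda>q1 q2. a * (S q1 * q2))"
    by (simp add: untwist lin_tsum[OF lin_algebra_mult] mult.assoc)
  also have "\<dots> = 0"
    by (simp add: tsum_mult_left sw_antipode_left counit_Q q vspace_zero_scl)
  finally show ?thesis
    using lin_mem[OF lin_untwist] q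
    by (simp add: bicovariant_relations_eq univ_forms_def twist_untwist tspan_base)
qed

text \<open>This is where the \<open>Ad\<close>-stability of \<open>Q\<close> enters.\<close>

lemma diag_coaction_N\<^sub>H:
  assumes "z \<in> N\<^sub>H"
  shows "diag_coaction z \<in> tspan HH H N\<^sub>H UNIV"
proof -
  have z: "z \<in> car HH" "twist z \<in> tspan H H UNIV Q"
    using assms univ_forms_subset by (auto simp: bicovariant_relations_eq)
  have "tlift H H (HH \<otimes> H) (\<lambda>q' k. untwist (a1 \<odot> q') \<otimes>\<^bsub>HH,H\<^esub> (a2 * k)) (Ad H \<Delta> S q)
      \<in> tspan HH H N\<^sub>H UNIV" if "q \<in> Q" for a1 a2 q
    by (rule lin_tspan_subset[OF tlift(1)[OF vspace_tensor bilin_untwist] _ _ _ vspace_tensor _ Ad_Q[OF that]])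
      (auto simp: subspace_tspan car_UNIV tlift(2)[OF vspace_tensor bilin_untwist]
        intro!: tspan_base untwist_N\<^sub>H)
  then have "twisted_coaction (a \<odot> q) \<in> tspan HH H N\<^sub>H UNIV" if "q \<in> Q" for a q
    unfolding twisted_coaction using that
    by (intro tsum_mem_subspace[OF vector_space_fscale subspace_tspan]) simp_all
  then have "twisted_coaction (twist z) \<in> tspan HH H N\<^sub>H UNIV"
    by (intro lin_tspan_subset[OF lin_twisted_coaction _ _ _ vspace_tensor _ z(2)])
      (auto simp: subspace_tspan car_UNIV)
  then show ?thesis by (simp add: twisted_coaction_twist z)
qed

end

subsection \<open>First order calculi\<close>

lemma subspace_single_zero: "vspace U \<Longrightarrow> module.subspace (scl U) {0}"
proof -
  assume "vspace U"
  then interpret vector_space "scl U" by (simp add: vspace_def)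
  show ?thesis by (rule subspace_single_0)
qed

lemma tspan_subset: "A \<subseteq> car V \<Longrightarrow> C \<subseteq> car W \<Longrightarrow> tspan V W A C \<subseteq> car (V \<otimes> W)"
  unfolding car_tensor by (rule tspan_mono)

locale first_order_calculus = k_algebra A for A :: "('k::field, 'a::{ring, monoid_mult}) kspace" +
  fixes N :: "('k, 'a, 'a) tens set"
  assumes calculus: "calculus A N"
begin

lemma
  shows subspace_N: "module.subspace fscale N"
    and N_subset: "N \<subseteq> univ_forms A"
    and lmul_N: "n \<in> N \<Longrightarrow> lmul A a n \<in> N"
    and rmul_N: "n \<in> N \<Longrightarrow> rmul A n a \<in> N"
  using calculus by (auto simp: calculus_def)

lemma N_subset_car: "N \<subseteq> car (A \<otimes> A)"
  using N_subset univ_forms_subset by blast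

abbreviation AA :: "('k, ('k, 'a, 'a) tens) kspace" where "AA \<equiv> A \<otimes> A"
abbreviation AA_N :: "('k, ('k, 'a) form) kspace" where "AA_N \<equiv> quot (A \<otimes> A) N"
abbreviation \<Omega> :: "('k, ('k, 'a) form) kspace" where "\<Omega> \<equiv> forms A N"

lemma vspace_AA_N: "vspace AA_N"
  by (intro vspace_quot vspace_tensor)

lemma scl_forms [simp]: "scl \<Omega> = fscale"
  by (simp add: forms_def)

lemma formsE:
  assumes "\<omega> \<in> car \<Omega>"
  obtains x where "x \<in> univ_forms A" "x \<in> car AA" "\<omega> = qcls AA N x"
  using assms univ_forms_subset by (auto simp: forms_def)

lemma forms_subset: "car \<Omega> \<subseteq> car AA_N"
  using univ_forms_subset by (auto simp: forms_def car_quot)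

lemma vspace_forms: "vspace \<Omega>"
proof (rule vspace_fscaleI)
  let ?U = "\<lparr>scl = fscale, car = univ_forms A\<rparr> :: ('k, ('k, 'a, 'a) tens) kspace"
  have "vspace ?U" by (rule vspace_fscaleI) (simp_all add: subspace_univ_forms)
  moreover have "lin ?U AA_N (qcls AA N)"
    by (rule lin_restrict_dom[OF lin_qcls]) (simp_all add: univ_forms_subset)
  ultimately show "module.subspace fscale (car \<Omega>)"
    using lin_image_subspace[of ?U AA_N "qcls AA N"] by (simp add: vspace_AA_N forms_def)
qed simp

text \<open>The action is defined on the whole quotient of \<open>A \<otimes> A\<close>, where it
  descends because \<open>lmul\<close> preserves \<open>N\<close>; that it restricts to the forms is
  a separate matter, settled by \<open>lmul_univ_forms\<close>.\<close>

lemma lin_lact: "lin AA_N AA_N (lact A N a)"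
  and lact_qcls: "z \<in> car AA \<Longrightarrow> lact A N a (qcls AA N z) = qcls AA N (lmul A a z)"
proof -
  have "lin AA AA_N (\<lambda>z. qcls AA N (lmul A a z))" by (rule lin_compose[OF lin_lmul lin_qcls])
  from qlift[OF vspace_tensor vspace_AA_N this, of N] show "lin AA_N AA_N (lact A N a)"
    "z \<in> car AA \<Longrightarrow> lact A N a (qcls AA N z) = qcls AA N (lmul A a z)"
    by (simp_all add: lact_def lmul_N qcls_zero)
qed

lemma lin_ract: "lin AA_N AA_N (\<lambda>\<omega>. ract A N \<omega> a)"
  and ract_qcls: "z \<in> car AA \<Longrightarrow> ract A N (qcls AA N z) a = qcls AA N (rmul A z a)"
proof -
  have "lin AA AA_N (\<lambda>z. qcls AA N (rmul A z a))" by (rule lin_compose[OF lin_rmul lin_qcls])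
  from qlift[OF vspace_tensor vspace_AA_N this, of N] show "lin AA_N AA_N (\<lambda>\<omega>. ract A N \<omega> a)"
    "z \<in> car AA \<Longrightarrow> ract A N (qcls AA N z) a = qcls AA N (rmul A z a)"
    by (simp_all add: ract_def rmul_N qcls_zero)
qed

lemma lact_forms: "\<omega> \<in> car \<Omega> \<Longrightarrow> lact A N a \<omega> \<in> car \<Omega>"
  by (erule formsE) (auto simp: lact_qcls forms_def lmul_univ_forms)

lemma ract_forms: "\<omega> \<in> car \<Omega> \<Longrightarrow> ract A N \<omega> a \<in> car \<Omega>"
  by (erule formsE) (auto simp: ract_qcls forms_def rmul_univ_forms)

lemma lin_lact_param: "\<omega> \<in> car \<Omega> \<Longrightarrow> lin A \<Omega> (\<lambda>a. lact A N a \<omega>)"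
proof (erule formsE)
  fix x assume x: "x \<in> univ_forms A" "x \<in> car AA" "\<omega> = qcls AA N x"
  have "lin A AA_N (\<lambda>a. qcls AA N (lmul A a x))"
    by (rule lin_compose[OF lin_lmul_param[OF x(2)] lin_qcls])
  then show "lin A \<Omega> (\<lambda>a. lact A N a \<omega>)"
    using x lmul_univ_forms[OF x(1)] by (auto simp: lin_def lact_qcls forms_def)
qed

lemma lin_ract_param: "\<omega> \<in> car \<Omega> \<Longrightarrow> lin A \<Omega> (ract A N \<omega>)"
proof (erule formsE)
  fix x assume x: "x \<in> univ_forms A" "x \<in> car AA" "\<omega> = qcls AA N x"
  have "lin A AA_N (\<lambda>a. qcls AA N (rmul A x a))"
    by (rule lin_compose[OF lin_rmul_param[OF x(2)] lin_qcls])
  then show "lin A \<Omega> (ract A N \<omega>)"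
    using x rmul_univ_forms[OF x(1)] by (auto simp: lin_def ract_qcls forms_def)
qed

lemma lin_lact_forms: "lin \<Omega> \<Omega> (lact A N a)"
  by (intro linI lact_forms) (simp_all add: lin_add[OF lin_lact] lin_scl[OF lin_lact, simplified]
      subsetD[OF forms_subset])

lemma lin_ract_forms: "lin \<Omega> \<Omega> (\<lambda>\<omega>. ract A N \<omega> a)"
  by (intro linI ract_forms) (simp_all add: lin_add[OF lin_ract] lin_scl[OF lin_ract, simplified]
      subsetD[OF forms_subset])

lemma lact_lact: "\<omega> \<in> car \<Omega> \<Longrightarrow> lact A N a (lact A N b \<omega>) = lact A N (a * b) \<omega>"
proof (erule formsE)
  fix x assume x: "x \<in> univ_forms A" "x \<in> car AA" "\<omega> = qcls AA N x"
  have "lmul A a (lmul A b x) = lmul A (a * b) x"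
    by (rule lin_tensor_ext[OF lin_compose[OF lin_lmul lin_lmul] lin_lmul refl _ x(2)])
      (simp add: mult.assoc)
  then show ?thesis by (simp add: x lact_qcls lin_mem[OF lin_lmul])
qed

lemma ract_ract: "\<omega> \<in> car \<Omega> \<Longrightarrow> ract A N (ract A N \<omega> a) b = ract A N \<omega> (a * b)"
proof (erule formsE)
  fix x assume x: "x \<in> univ_forms A" "x \<in> car AA" "\<omega> = qcls AA N x"
  have "rmul A (rmul A x a) b = rmul A x (a * b)"
    by (rule lin_tensor_ext[OF lin_compose[OF lin_rmul lin_rmul] lin_rmul refl _ x(2)])
      (simp add: mult.assoc)
  then show ?thesis by (simp add: x ract_qcls lin_mem[OF lin_rmul])
qed

lemma lact_one: "\<omega> \<in> car \<Omega> \<Longrightarrow> lact A N 1 \<omega> = \<omega>"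
proof (erule formsE)
  fix x assume x: "x \<in> univ_forms A" "x \<in> car AA" "\<omega> = qcls AA N x"
  have "lmul A 1 x = x"
    by (rule lin_tensor_ext[OF lin_lmul lin_id refl _ x(2)]) simp
  then show ?thesis by (simp add: x lact_qcls)
qed

lemma ract_one: "\<omega> \<in> car \<Omega> \<Longrightarrow> ract A N \<omega> 1 = \<omega>"
proof (erule formsE)
  fix x assume x: "x \<in> univ_forms A" "x \<in> car AA" "\<omega> = qcls AA N x"
  have "rmul A x 1 = x"
    by (rule lin_tensor_ext[OF lin_rmul lin_id refl _ x(2)]) simp
  then show ?thesis by (simp add: x ract_qcls)
qed

end

subsection \<open>Forms on the tensor product bundle\<close>

locale tensor_bundle = bicovariant_calculus H \<Delta> \<epsilon> S Q + M: first_order_calculus M N\<^sub>M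
  for H :: "('k::field, 'h::ring_1) kspace" and \<Delta> \<epsilon> S Q
    and M :: "('k, 'm::{ring, monoid_mult}) kspace" and N\<^sub>M :: "('k, 'm, 'm) tens set"
begin

abbreviation MM :: "('k, ('k, 'm, 'm) tens) kspace" where "MM \<equiv> M \<otimes> M"
abbreviation P :: "('k, ('k, 'm, 'h) tens) kspace" where "P \<equiv> M \<otimes> H"
abbreviation tnsP :: "'m \<Rightarrow> 'h \<Rightarrow> ('k, 'm, 'h) tens" (infixr "\<bullet>" 70) where
  "m \<bullet> h \<equiv> m \<otimes>\<^bsub>M,H\<^esub> h"
abbreviation PP :: "('k, ('k, 'm, 'h) btens) kspace" where "PP \<equiv> MM \<otimes> HH"
abbreviation NP :: "('k, 'm, 'h) btens set" where "NP \<equiv> N\<^sub>P M N\<^sub>M H \<Delta> Q"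
abbreviation PN :: "('k, ('k, 'm, 'h) bform) kspace" where "PN \<equiv> quot PP NP"
abbreviation pp :: "('k, 'm, 'm) tens \<Rightarrow> ('k, 'h, 'h) tens \<Rightarrow> ('k, 'm, 'h) btens" where
  "pp x y \<equiv> x \<otimes>\<^bsub>MM,HH\<^esub> y"
abbreviation cls :: "('k, 'm, 'h) btens \<Rightarrow> ('k, 'm, 'h) bform" where "cls \<equiv> qcls PP NP"
abbreviation lactP :: "('k, 'm, 'h) tens \<Rightarrow> ('k, 'm, 'h) bform \<Rightarrow> ('k, 'm, 'h) bform" where
  "lactP \<equiv> P_lact M N\<^sub>M H \<Delta> Q"
abbreviation ractP :: "('k, 'm, 'h) bform \<Rightarrow> ('k, 'm, 'h) tens \<Rightarrow> ('k, 'm, 'h) bform" where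
  "ractP \<equiv> P_ract M N\<^sub>M H \<Delta> Q"
abbreviation ext :: "('k, 'm) form \<Rightarrow> 'h \<Rightarrow> 'h \<Rightarrow> ('k, 'm, 'h) bform" where
  "ext \<equiv> extend M N\<^sub>M H \<Delta> Q"
abbreviation coact :: "('k, 'm, 'h) bform \<Rightarrow> ('k, ('k, 'm, 'h) bform, 'h) tens" where
  "coact \<equiv> bundle_forms_coaction M N\<^sub>M H \<Delta> Q"

lemma vspace_PN [simp]: "vspace PN"
  by (intro vspace_quot vspace_tensor)

lemma NP_E:
  assumes "n \<in> NP"
  obtains a b c where "n = a + b + c" "a \<in> tspan MM HH N\<^sub>M (car HH)"
    "b \<in> tspan MM HH (car MM) N\<^sub>H"
    "c \<in> tspan MM HH (univ_forms M) (univ_forms H)"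
    "a \<in> car PP" "b \<in> car PP" "c \<in> car PP"
proof -
  obtain a b c where n: "n = a + b + c"
    and abc: "a \<in> tspan MM HH N\<^sub>M (car HH)"
    "b \<in> tspan MM HH (car MM) N\<^sub>H"
    "c \<in> tspan MM HH (univ_forms M) (univ_forms H)"
    using assms by (auto simp: N\<^sub>P_def elim!: set_plus_elim)
  show thesis
    by (rule that[OF n abc]; rule subsetD[OF tspan_subset])
      (fact M.N_subset_car N\<^sub>H_subset_car M.univ_forms_subset univ_forms_subset order.refl abc)+
qed

lemma NP_subset: "NP \<subseteq> car PP"
proof
  show "n \<in> car PP" if "n \<in> NP" for n
    using that by (rule NP_E) (simp add: vspace_add)
qed

text \<open>The relations are a sum of three spans, so three kinds of pure tensors decide. The
  actions of \<open>P\<close>, the coaction and the counit retraction are all shown to be well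
  defined in this way.\<close>

lemma NP_vanish:
  assumes "lin PP U f" "vspace U" and n: "n \<in> NP"
    and 1: "\<And>x y. x \<in> N\<^sub>M \<Longrightarrow> x \<in> car MM \<Longrightarrow> y \<in> car HH \<Longrightarrow> f (pp x y) = 0"
    and 2: "\<And>x y. x \<in> car MM \<Longrightarrow> y \<in> N\<^sub>H \<Longrightarrow> y \<in> car HH \<Longrightarrow> f (pp x y) = 0"
    and 3: "\<And>x y. x \<in> univ_forms M \<Longrightarrow> x \<in> car MM \<Longrightarrow> y \<in> univ_forms H
      \<Longrightarrow> y \<in> car HH \<Longrightarrow> f (pp x y) = 0"
  shows "f n = 0"
proof (rule NP_E[OF n])
  fix a b c
  assume n': "n = a + b + c" and a: "a \<in> tspan MM HH N\<^sub>M (car HH)"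
    and b: "b \<in> tspan MM HH (car MM) N\<^sub>H"
    and c: "c \<in> tspan MM HH (univ_forms M) (univ_forms H)"
    and mem: "a \<in> car PP" "b \<in> car PP" "c \<in> car PP"
  note T = lin_tspan_subset[OF assms(1) _ _ subspace_single_zero[OF assms(2)] assms(2)]
  have "f a \<in> {0}" by (rule T[OF _ _ _ a]) (use M.N_subset_car 1 in auto)
  moreover have "f b \<in> {0}" by (rule T[OF _ _ _ b]) (use N\<^sub>H_subset_car 2 in auto)
  moreover have "f c \<in> {0}"
    by (rule T[OF _ _ _ c]) (use M.univ_forms_subset univ_forms_subset 3 in auto)
  ultimately show ?thesis
    unfolding n' by (simp add: lin_add[OF assms(1)] vspace_add mem)
qed

lemma
  shows NP_calculus: "x \<in> N\<^sub>M \<Longrightarrow> y \<in> car HH \<Longrightarrow> pp x y \<in> NP"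
    and NP_fibre: "x \<in> car MM \<Longrightarrow> y \<in> N\<^sub>H \<Longrightarrow> pp x y \<in> NP"
    and NP_univ: "x \<in> univ_forms M \<Longrightarrow> y \<in> univ_forms H \<Longrightarrow> pp x y \<in> NP"
proof -
  interpret vector_space "fscale :: 'k \<Rightarrow> ('k, 'm, 'h) btens \<Rightarrow> _" by (rule vector_space_fscale)
  have 0: "0 \<in> tspan MM HH X Y" for X Y by (rule subspace_0[OF subspace_tspan])
  show "x \<in> N\<^sub>M \<Longrightarrow> y \<in> car HH \<Longrightarrow> pp x y \<in> NP"
    using set_plus_intro[OF set_plus_intro[OF tspan_base 0] 0] by (simp add: N\<^sub>P_def)
  show "x \<in> car MM \<Longrightarrow> y \<in> N\<^sub>H \<Longrightarrow> pp x y \<in> NP"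
    using set_plus_intro[OF set_plus_intro[OF 0 tspan_base] 0] by (simp add: N\<^sub>P_def)
  show "x \<in> univ_forms M \<Longrightarrow> y \<in> univ_forms H \<Longrightarrow> pp x y \<in> NP"
    using set_plus_intro[OF set_plus_intro[OF 0 0] tspan_base] by (simp add: N\<^sub>P_def)
qed

lemma cls_zero: "n \<in> NP \<Longrightarrow> cls n = 0"
  by (rule qcls_zero)

text \<open>Left and right multiplication are handled at once: \<open>A\<close> acts on the base
  factors and \<open>C\<close> on the fibre factors. Each preserves its relations and its universal
  forms, which is exactly what the three summands of \<open>NP\<close> require.\<close>

lemma P_action:
  assumes A: "\<And>m. lin MM MM (A m)" "\<And>x. x \<in> car MM \<Longrightarrow> lin M MM (\<lambda>m. A m x)"
      "\<And>m x. x \<in> N\<^sub>M \<Longrightarrow> A m x \<in> N\<^sub>M" "\<And>m x. x \<in> univ_forms M \<Longrightarrow> A m x \<in> univ_forms M"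
    and C: "\<And>h. lin HH HH (C h)" "\<And>y. y \<in> car HH \<Longrightarrow> lin H HH (\<lambda>h. C h y)"
      "\<And>h y. y \<in> N\<^sub>H \<Longrightarrow> C h y \<in> N\<^sub>H" "\<And>h y. y \<in> univ_forms H \<Longrightarrow> C h y \<in> univ_forms H"
    and op: "\<And>\<zeta> p. act \<zeta> p = qlift PP NP PN (\<lambda>z. cls (tlift M H PP (\<lambda>m h.
        tlift MM HH PP (\<lambda>x y. pp (A m x) (C h y)) z) p)) \<zeta>"
  shows "p \<in> car P \<Longrightarrow> lin PN PN (\<lambda>\<zeta>. act \<zeta> p)"
    and "\<zeta> \<in> car PN \<Longrightarrow> lin P PN (act \<zeta>)"
    and "x \<in> car MM \<Longrightarrow> y \<in> car HH
      \<Longrightarrow> act (cls (pp x y)) (m \<bullet> h) = cls (pp (A m x) (C h y))"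
proof -
  define a where "a m h = tlift MM HH PP (\<lambda>x y. pp (A m x) (C h y))" for m h
  have b: "bilin MM HH PP (\<lambda>x y. pp (A m x) (C h y))" for m h
    by (intro lin_intros A C; simp add: lin_mem[OF A(1)] lin_mem[OF C(1)])
  note la = tlift(1)[OF vspace_tensor b, folded a_def] and a = tlift(2)[OF vspace_tensor b, folded a_def]
  have lap: "bilin M H PP (\<lambda>m h. a m h z)" if "z \<in> car PP" for z
    unfolding a_def using that by (intro lin_intros b A C)
      (simp_all add: lin_mem[OF A(1)] lin_mem[OF C(1)])
  define c where "c p z = tlift M H PP (\<lambda>m h. a m h z) p" for p z
  have lc: "lin PP PP (c p)" if "p \<in> car P" for p
    unfolding c_def using that by (intro lin_tlift_param lap la vspace_tensor)
  have lcp: "lin P PP (\<lambda>p. c p z)" if "z \<in> car PP" for z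
    unfolding c_def using that by (intro lin_tlift_arg lap lin_id vspace_tensor)
  have c: "c (m \<bullet> h) z = a m h z" if "z \<in> car PP" for m h z
    unfolding c_def using that by (simp add: tlift(2)[OF vspace_tensor lap])
  have a0: "cls (a m h n) = 0" if "n \<in> NP" for m h n
    by (rule NP_vanish[OF lin_compose[OF la lin_qcls] vspace_PN that])
      (simp_all add: a cls_zero NP_calculus NP_fibre NP_univ A C lin_mem[OF A(1)] lin_mem[OF C(1)])
  have c0: "cls (c p n) = 0" if "n \<in> NP" "p \<in> car P" for p n
    by (rule lin_tensor_ext[OF lin_compose[OF lcp lin_qcls] lin_const_zero[OF vspace_PN] refl _ that(2)])
      (simp_all add: that subsetD[OF NP_subset] c a0)
  have eq: "act \<zeta> p = qlift PP NP PN (\<lambda>z. cls (c p z)) \<zeta>" for p \<zeta>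
    by (simp add: op c_def a_def)
  show "lin PN PN (\<lambda>\<zeta>. act \<zeta> p)" if p: "p \<in> car P" for p
    unfolding eq by (rule qlift(1)[OF vspace_tensor vspace_PN lin_compose[OF lc[OF p] lin_qcls]]) (rule c0[OF _ p])
  have E: "act (cls z) p = cls (c p z)" if "z \<in> car PP" "p \<in> car P" for z p
    unfolding eq
    by (rule qlift(2)[OF vspace_tensor vspace_PN lin_compose[OF lc[OF that(2)] lin_qcls] c0[OF _ that(2)] that(1)])
  show "lin P PN (act \<zeta>)" if \<zeta>: "\<zeta> \<in> car PN"
  proof -
    obtain z where z: "z \<in> car PP" "\<zeta> = cls z" using \<zeta> by (auto simp: car_quot)
    show ?thesis
      by (subst lin_cong[OF vspace_tensor, where g = "\<lambda>p. cls (c p z)"])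
        (auto simp: z E intro: lin_compose[OF lcp lin_qcls])
  qed
  show "act (cls (pp x y)) (m \<bullet> h) = cls (pp (A m x) (C h y))"
    if "x \<in> car MM" "y \<in> car HH"
    using that by (simp add: E c a)
qed

lemmas lmul_action = M.lin_lmul M.lin_lmul_param M.lmul_N M.lmul_univ_forms
    lin_lmul lin_lmul_param lmul_N\<^sub>H lmul_univ_forms
  and rmul_action = M.lin_rmul M.lin_rmul_param M.rmul_N M.rmul_univ_forms
    lin_rmul lin_rmul_param rmul_N\<^sub>H rmul_univ_forms

lemma
  shows lin_lactP: "p \<in> car P \<Longrightarrow> lin PN PN (lactP p)"
    and lin_lactP_param: "\<zeta> \<in> car PN \<Longrightarrow> lin P PN (\<lambda>p. lactP p \<zeta>)"
    and lactP_tns: "x \<in> car MM \<Longrightarrow> y \<in> car HH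
      \<Longrightarrow> lactP (m \<bullet> h) (cls (pp x y)) = cls (pp (lmul M m x) (lmul H h y))"
  by (rule P_action[where A = "lmul M" and C = "lmul H" and act = "\<lambda>\<zeta> p. lactP p \<zeta>"];
      simp add: lmul_action P_lact_def)+

lemma
  shows lin_ractP: "p \<in> car P \<Longrightarrow> lin PN PN (\<lambda>\<zeta>. ractP \<zeta> p)"
    and lin_ractP_param: "\<zeta> \<in> car PN \<Longrightarrow> lin P PN (ractP \<zeta>)"
    and ractP_tns: "x \<in> car MM \<Longrightarrow> y \<in> car HH
      \<Longrightarrow> ractP (cls (pp x y)) (m \<bullet> h) = cls (pp (rmul M x m) (rmul H y h))"
  by (rule P_action[where A = "\<lambda>m x. rmul M x m" and C = "\<lambda>h y. rmul H y h" and act = ractP];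
      simp add: rmul_action P_ract_def)+

lemma ext_qcls: "x \<in> car MM \<Longrightarrow> ext (qcls MM N\<^sub>M x) h h' = cls (pp x (h \<odot> h'))"
  and lin_ext: "lin M.AA_N PN (\<lambda>\<omega>. ext \<omega> h h')"
proof -
  have l: "lin MM PN (\<lambda>x. cls (pp x (h \<odot> h')))"
    by (intro lin_intros; simp)
  have z: "cls (pp n (h \<odot> h')) = 0" if "n \<in> N\<^sub>M" for n
    using that by (intro cls_zero NP_calculus) simp_all
  note q = qlift[OF vspace_tensor vspace_PN l z]
  show "lin M.AA_N PN (\<lambda>\<omega>. ext \<omega> h h')" using q(1) by (simp add: extend_def)
  show "x \<in> car MM \<Longrightarrow> ext (qcls MM N\<^sub>M x) h h' = cls (pp x (h \<odot> h'))"
    unfolding extend_def by (rule q(2))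
qed

lemma AA_N_E:
  assumes "\<omega> \<in> car M.AA_N"
  obtains x where "x \<in> car MM" "\<omega> = qcls MM N\<^sub>M x"
  using assms by (auto simp: car_quot)

lemma ext_mem: "\<omega> \<in> car M.AA_N \<Longrightarrow> ext \<omega> h h' \<in> car PN"
  by (rule lin_mem[OF lin_ext])

lemma lin_ext_left: "\<omega> \<in> car M.AA_N \<Longrightarrow> lin H PN (\<lambda>h. ext \<omega> h h')"
  and lin_ext_right: "\<omega> \<in> car M.AA_N \<Longrightarrow> lin H PN (\<lambda>h'. ext \<omega> h h')"
  by (erule AA_N_E, simp add: ext_qcls, intro lin_intros; simp)+

lemma lactP_ext: "\<omega> \<in> car M.AA_N \<Longrightarrow> lactP (m \<bullet> g) (ext \<omega> h h') = ext (lact M N\<^sub>M m \<omega>) (g * h) h'"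
  by (erule AA_N_E) (simp add: ext_qcls lactP_tns M.lact_qcls lin_mem[OF M.lin_lmul])

lemma ractP_ext: "\<omega> \<in> car M.AA_N \<Longrightarrow> ractP (ext \<omega> h h') (m \<bullet> g) = ext (ract M N\<^sub>M \<omega> m) h (h' * g)"
  by (erule AA_N_E) (simp add: ext_qcls ractP_tns M.ract_qcls lin_mem[OF M.lin_rmul])

text \<open>Because \<open>\<Omega>\<^sup>1M \<otimes> \<Omega>\<^sup>1H\<close> vanishes in \<open>\<Omega>\<^sup>1(P)\<close>, only the product of the two fibre components matters.\<close>

lemma ext_mult_left: "\<omega> \<in> car M.\<Omega> \<Longrightarrow> ext \<omega> h h' = ext \<omega> (h * h') 1"
  and ext_mult_right: "\<omega> \<in> car M.\<Omega> \<Longrightarrow> ext \<omega> h h' = ext \<omega> 1 (h * h')"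
proof -
  have *: "ext \<omega> h h' = ext \<omega> g g'" if \<omega>: "\<omega> \<in> car M.\<Omega>" and eq: "h * h' = g * g'" for \<omega> h h' g g'
  proof (rule M.formsE[OF \<omega>])
    fix x assume x: "x \<in> univ_forms M" "x \<in> car MM" "\<omega> = qcls MM N\<^sub>M x"
    let ?y = "h \<odot> h' - g \<odot> g'"
    have "?y \<in> univ_forms H"
      by (auto simp: univ_forms_def lin_diff[OF vspace_tensor lin_algebra_mult] eq intro: vspace_diff[OF vspace_tensor])
    then have "cls (pp x ?y) = 0" by (intro cls_zero NP_univ x)
    moreover have l: "lin HH PN (\<lambda>y. cls (pp x y))" by (intro lin_intros; simp add: x)
    ultimately show ?thesis
      using lin_diff[OF vspace_tensor l, of "h \<odot> h'" "g \<odot> g'"] by (simp add: x ext_qcls)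
  qed
  show "\<omega> \<in> car M.\<Omega> \<Longrightarrow> ext \<omega> h h' = ext \<omega> (h * h') 1" "\<omega> \<in> car M.\<Omega> \<Longrightarrow> ext \<omega> h h' = ext \<omega> 1 (h * h')"
    by (rule *; simp)+
qed

section \<open>The coaction on forms of the bundle\<close>

lemma
  shows lin_coact: "lin PN (PN \<otimes> H) coact"
    and coact_ext: "\<omega> \<in> car M.AA_N \<Longrightarrow> coact (ext \<omega> h 1) = sw h (\<lambda>a b. ext \<omega> a 1 \<otimes>\<^bsub>PN,H\<^esub> b)"
proof -
  \<comment> \<open>\<open>G x\<close> puts the base component \<open>x\<close> back in front of the
    fibre part, so that \<open>PP_coaction\<close> becomes \<open>diag_coaction\<close> followed by
    \<open>G x\<close>.\<close>
  define G where "G x = tlift HH H (PP \<otimes> H) (\<lambda>y k. pp x y \<otimes>\<^bsub>PP,H\<^esub> k)" for x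
  have bG: "bilin HH H (PP \<otimes> H) (\<lambda>y k. pp x y \<otimes>\<^bsub>PP,H\<^esub> k)" if "x \<in> car MM" for x
    using that by (intro lin_intros; simp)
  note lG = tlift(1)[OF vspace_tensor bG, folded G_def] and G = tlift(2)[OF vspace_tensor bG, folded G_def]
  define T where "T x h1 h2 g1 g2 = pp x (h1 \<odot> g1) \<otimes>\<^bsub>PP,H\<^esub> (h2 * g2)" for x h1 h2 g1 g2
  define c where "c x = tlift H H (PP \<otimes> H) (\<lambda>h g. tlift H H (PP \<otimes> H)
    (\<lambda>h1 h2. tlift H H (PP \<otimes> H) (T x h1 h2) (\<Delta> g)) (\<Delta> h))" for x
  have T1: "bilin H H (PP \<otimes> H) (T x h1 h2)" if "x \<in> car MM" for x h1 h2
    unfolding T_def using that by (intro lin_intros hopf_lin; simp)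
  have lT: "lin H (PP \<otimes> H) (\<lambda>a. T x a h2 g1 g2)" "lin H (PP \<otimes> H) (\<lambda>a. T x h1 a g1 g2)"
    if "x \<in> car MM" for x h1 h2 g1 g2
    unfolding T_def using that by (intro lin_intros hopf_lin; simp)+
  have lTx: "lin MM (PP \<otimes> H) (\<lambda>x. T x h1 h2 g1 g2)" for h1 h2 g1 g2
    unfolding T_def by (intro lin_intros; simp)
  have T2: "bilin H H (PP \<otimes> H) (\<lambda>h1 h2. tlift H H (PP \<otimes> H) (T x h1 h2) z)"
    if "x \<in> car MM" "z \<in> car HH" for x z
    using that by (intro bilinI lin_tlift_param T1 lT vspace_tensor vspace)
  have T3: "bilin H H (PP \<otimes> H) (\<lambda>h g. tlift H H (PP \<otimes> H)
      (\<lambda>h1 h2. tlift H H (PP \<otimes> H) (T x h1 h2) (\<Delta> g)) (\<Delta> h))" if "x \<in> car MM" for x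
    using that by (intro bilinI lin_tlift_param lin_tlift_arg T1 T2 vspace_tensor vspace lin_comult) simp_all
  have T4: "bilin MM HH (PP \<otimes> H) c"
    unfolding c_def
  proof (rule bilinI)
    fix z :: "('k, 'h, 'h) tens" assume z: "z \<in> car HH"
    show "lin MM (PP \<otimes> H) (\<lambda>x. tlift H H (PP \<otimes> H) (\<lambda>h g. tlift H H (PP \<otimes> H)
      (\<lambda>h1 h2. tlift H H (PP \<otimes> H) (T x h1 h2) (\<Delta> g)) (\<Delta> h)) z)"
      using z by (intro lin_tlift_param T1 T2 T3 lTx vspace_tensor vspace comult_mem)
  qed (rule tlift(1)[OF vspace_tensor T3])
  have cG: "c x y = G x (diag_coaction y)" if x: "x \<in> car MM" and y: "y \<in> car HH" for x y
  proof (rule lin_tensor_ext[OF bilin_right[OF T4 x] lin_compose[OF lin_diag_coaction lG[OF x]] refl _ y])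
    show "c x (h \<odot> g) = G x (diag_coaction (h \<odot> g))" for h g
    proof -
      have "c x (h \<odot> g) = tlift H H (PP \<otimes> H) (\<lambda>h1 h2. tlift H H (PP \<otimes> H) (T x h1 h2) (\<Delta> g)) (\<Delta> h)"
        unfolding c_def by (rule tlift(2)[OF vspace_tensor T3[OF x]]) simp_all
      also have "\<dots> = sw h (\<lambda>h1 h2. tlift H H (PP \<otimes> H) (T x h1 h2) (\<Delta> g))"
        by (rule tlift_sw[OF vspace_tensor T2[OF x]]) simp
      finally show ?thesis
        by (simp add: x tlift_sw[OF vspace_tensor T1] diag_coaction lin_tsum[OF lG] G flip: T_def)
    qed
  qed
  have PPc: "PP_coaction M H \<Delta> = tlift MM HH (PP \<otimes> H) c"
    by (simp add: PP_coaction_def c_def[abs_def] T_def[abs_def])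
  note lPPc = tlift(1)[OF vspace_tensor T4, folded PPc]
  have PPG: "PP_coaction M H \<Delta> (pp x y) = G x (diag_coaction y)"
    if "x \<in> car MM" "y \<in> car HH" for x y
    unfolding PPc using that by (simp add: tlift(2)[OF vspace_tensor T4] cG)
  define F where "F = tlift PP H (PN \<otimes> H) (\<lambda>z' h. cls z' \<otimes>\<^bsub>PN,H\<^esub> h)"
  have bF: "bilin PP H (PN \<otimes> H) (\<lambda>z' h. cls z' \<otimes>\<^bsub>PN,H\<^esub> h)"
    by (intro lin_intros; simp add: lin_mem[OF lin_qcls])
  note lF = tlift(1)[OF vspace_tensor bF, folded F_def] and F = tlift(2)[OF vspace_tensor bF, folded F_def]
  \<comment> \<open>Common to the three kinds of relations: if the fibre coaction stays in
    \<open>Y \<otimes> H\<close> and every element of \<open>Y\<close> becomes zero next to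
    \<open>x\<close>, the coaction of \<open>pp x y\<close> is zero in the quotient. The choices of
    \<open>Y\<close> are all of \<open>HH\<close>, \<open>N\<^sub>H\<close> and the universal
    forms.\<close>
  have van: "F (PP_coaction M H \<Delta> (pp x y)) = 0"
    if x: "x \<in> car MM" and y: "y \<in> car HH" "diag_coaction y \<in> tspan HH H Y UNIV"
      and Y: "Y \<subseteq> car HH" "\<And>y. y \<in> Y \<Longrightarrow> cls (pp x y) = 0" for x y Y
  proof -
    have "F (G x (diag_coaction y)) \<in> {0}"
    proof (rule lin_tspan_subset[OF lin_compose[OF lG[OF x] lF] Y(1) _ subspace_single_zero _ _ y(2)])
      fix y' k assume "y' \<in> Y"
      moreover have "0 \<otimes>\<^bsub>PN,H\<^esub> k = 0" for k
        by (rule lin_zero[OF vspace_PN bilin_left[OF bilin_tns]]) simp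
      ultimately show "F (G x (y' \<otimes>\<^bsub>HH,H\<^esub> k)) \<in> {0}"
        using Y by (simp add: G x subset_iff F)
    qed (simp_all add: car_UNIV)
    then show ?thesis by (simp add: PPG x y)
  qed
  have lFP: "lin PP (PN \<otimes> H) (\<lambda>z. F (PP_coaction M H \<Delta> z))" by (rule lin_compose[OF lPPc lF])
  have z: "F (PP_coaction M H \<Delta> n) = 0" if "n \<in> NP" for n
  proof (rule NP_vanish[OF lFP vspace_tensor that])
    fix x y assume "x \<in> N\<^sub>M" "x \<in> car MM" "y \<in> car HH"
    then show "F (PP_coaction M H \<Delta> (pp x y)) = 0"
      using lin_mem[OF lin_diag_coaction, of y]
      by (intro van[of _ _ "car HH"]) (simp_all add: car_tensor[of "HH" H] car_UNIV cls_zero NP_calculus)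
  next
    fix x y assume "x \<in> car MM" "y \<in> N\<^sub>H" "y \<in> car HH"
    then show "F (PP_coaction M H \<Delta> (pp x y)) = 0"
      by (intro van[of _ _ N\<^sub>H]) (simp_all add: diag_coaction_N\<^sub>H N\<^sub>H_subset_car cls_zero NP_fibre)
  next
    fix x y assume "x \<in> univ_forms M" "x \<in> car MM" "y \<in> univ_forms H" "y \<in> car HH"
    then show "F (PP_coaction M H \<Delta> (pp x y)) = 0"
      by (intro van[of _ _ "univ_forms H"])
        (simp_all add: diag_coaction_univ_forms univ_forms_subset cls_zero NP_univ)
  qed
  have eq: "coact = qlift PP NP (PN \<otimes> H) (\<lambda>z. F (PP_coaction M H \<Delta> z))"
    by (simp add: bundle_forms_coaction_def F_def)
  show "lin PN (PN \<otimes> H) coact"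
    unfolding eq by (rule qlift(1)[OF vspace_tensor vspace_tensor lFP z])
  show "coact (ext \<omega> h 1) = sw h (\<lambda>a b. ext \<omega> a 1 \<otimes>\<^bsub>PN,H\<^esub> b)" if "\<omega> \<in> car M.AA_N"
  proof (rule AA_N_E[OF that])
    fix x assume x: "x \<in> car MM" "\<omega> = qcls MM N\<^sub>M x"
    have s: "sw 1 (\<lambda>g1 g2. (h1 \<odot> g1) \<otimes>\<^bsub>HH,H\<^esub> (h2 * g2)) = (h1 \<odot> 1) \<otimes>\<^bsub>HH,H\<^esub> (h2 * 1)" for h1 h2
      by (rule sw_one[OF vspace_tensor[of "HH" H]]) (intro lin_intros hopf_lin; simp)
    have "coact (ext \<omega> h 1) = F (PP_coaction M H \<Delta> (pp x (h \<odot> 1)))"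
      unfolding eq x(2) ext_qcls[OF x(1)]
      by (rule qlift(2)[OF vspace_tensor vspace_tensor lFP z]) (simp_all add: x)
    also have "\<dots> = F (G x (sw h (\<lambda>h1 h2. (h1 \<odot> 1) \<otimes>\<^bsub>HH,H\<^esub> h2)))"
      by (simp add: PPG x diag_coaction s)
    also have "\<dots> = sw h (\<lambda>h1 h2. F (G x ((h1 \<odot> 1) \<otimes>\<^bsub>HH,H\<^esub> h2)))"
      by (simp add: lin_tsum[OF lin_compose[OF lG lF]] x)
    also have "\<dots> = sw h (\<lambda>a b. ext \<omega> a 1 \<otimes>\<^bsub>PN,H\<^esub> b)"
      by (simp add: G F x ext_qcls)
    finally show ?thesis .
  qed
qed

section \<open>Recovering base forms by the counit\<close>

definition retract :: "('k, 'm, 'h) bform \<Rightarrow> ('k, 'm) form" where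
  "retract = qlift PP NP M.AA_N (tlift MM HH M.AA_N
     (\<lambda>x y. fscale (\<epsilon> (algebra_mult H y)) (qcls MM N\<^sub>M x)))"

text \<open>Because \<epsilon> is taken of the product of the two fibre legs, universal forms of
  \<open>H\<close>, and with them \<open>N\<^sub>H\<close>, are visibly sent to zero; on
  \<open>N\<^sub>M\<close> the class in the base calculus is already zero.\<close>

lemma
  shows lin_retract: "lin PN M.AA_N retract"
    and retract_ext: "\<omega> \<in> car M.AA_N \<Longrightarrow> retract (ext \<omega> h h') = fscale (\<epsilon> h * \<epsilon> h') \<omega>"
proof -
  let ?f = "\<lambda>x y. fscale (\<epsilon> (algebra_mult H y)) (qcls MM N\<^sub>M x)"
  note le = lin_compose[OF lin_algebra_mult lin_counit]
  have b: "bilin MM HH M.AA_N ?f"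
    using lin_scl_left[OF M.vspace_AA_N _ le] lin_scl_right[OF M.vspace_AA_N lin_qcls]
    by (intro bilinI) (simp_all add: lin_mem[OF lin_qcls])
  note l = tlift(1)[OF M.vspace_AA_N b] and t = tlift(2)[OF M.vspace_AA_N b]
  have 0: "fscale c (0 :: ('k, 'm) form) = 0" "fscale 0 (\<omega> :: ('k, 'm) form) = 0" for c \<omega>
    using vspace_scl_zero[OF M.vspace_AA_N] vspace_zero_scl[OF M.vspace_AA_N] by simp_all
  have m: "algebra_mult H y = 0" if "y \<in> univ_forms H" for y using that by (simp add: univ_forms_def)
  have z: "tlift MM HH M.AA_N ?f n = 0" if "n \<in> NP" for n
    by (rule NP_vanish[OF l M.vspace_AA_N that])
      (simp_all add: t qcls_zero 0 m subsetD[OF N\<^sub>H_subset] lin_zero[OF vspace lin_counit])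
  show "lin PN M.AA_N retract"
    unfolding retract_def by (rule qlift(1)[OF vspace_tensor M.vspace_AA_N l z])
  show "retract (ext \<omega> h h') = fscale (\<epsilon> h * \<epsilon> h') \<omega>" if "\<omega> \<in> car M.AA_N"
  proof (rule AA_N_E[OF that])
    fix x assume x: "x \<in> car MM" "\<omega> = qcls MM N\<^sub>M x"
    have "retract (ext \<omega> h h') = tlift MM HH M.AA_N ?f (pp x (h \<odot> h'))"
      unfolding x(2) ext_qcls[OF x(1)] retract_def
      by (rule qlift(2)[OF vspace_tensor M.vspace_AA_N l z]) (simp_all add: x)
    then show ?thesis by (simp add: t x counit_mult)
  qed
qed

abbreviation incl :: "('k, 'm) form \<Rightarrow> ('k, 'm, 'h) bform" where "incl \<omega> \<equiv> ext \<omega> 1 1"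

lemmas form_mem = subsetD[OF M.forms_subset]

lemma retract_incl: "\<omega> \<in> car M.AA_N \<Longrightarrow> retract (incl \<omega>) = \<omega>"
  using vspace_scl_one[OF M.vspace_AA_N, of \<omega>] by (simp add: retract_ext counit_one)

section \<open>The common space of left and right multiples of base forms\<close>

definition ext_space :: "('k, ('k, 'm, 'h) bform) kspace" where
  "ext_space = \<lparr>scl = fscale, car = module.span fscale {ext \<omega> h 1 | \<omega> h. \<omega> \<in> car M.\<Omega>}\<rparr>"

lemma scl_ext_space [simp]: "scl ext_space = fscale"
  by (simp add: ext_space_def)

lemma vspace_ext_space: "vspace ext_space"
  by (rule vspace_fscaleI) (simp_all add: ext_space_def subspace_span_fscale)

lemma ext_in_ext_space: "\<omega> \<in> car M.\<Omega> \<Longrightarrow> ext \<omega> h 1 \<in> car ext_space"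
proof -
  interpret vector_space "fscale :: 'k \<Rightarrow> ('k, 'm, 'h) bform \<Rightarrow> _" by (rule vector_space_fscale)
  show "\<omega> \<in> car M.\<Omega> \<Longrightarrow> ext \<omega> h 1 \<in> car ext_space"
    unfolding ext_space_def by (auto intro: span_base)
qed

lemma ext_space_minimal:
  assumes "module.subspace fscale T" "\<And>\<omega> h. \<omega> \<in> car M.\<Omega> \<Longrightarrow> ext \<omega> h 1 \<in> T"
  shows "car ext_space \<subseteq> T"
proof -
  interpret vector_space "fscale :: 'k \<Rightarrow> ('k, 'm, 'h) bform \<Rightarrow> _" by (rule vector_space_fscale)
  show ?thesis unfolding ext_space_def kspace.select_convs using assms by (intro span_minimal) auto
qed

lemma ext_space_subset: "car ext_space \<subseteq> car PN"
  using subspace_car[OF vspace_PN] by (intro ext_space_minimal) (simp_all add: ext_mem form_mem)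

lemma lin_ext_space_subset:
  assumes "lin PN U f" "vspace U" "module.subspace (scl U) T"
    and "\<And>\<omega> h. \<omega> \<in> car M.\<Omega> \<Longrightarrow> f (ext \<omega> h 1) \<in> T" and "\<zeta> \<in> car ext_space"
  shows "f \<zeta> \<in> T"
proof -
  interpret p: vector_space "fscale :: 'k \<Rightarrow> ('k, 'm, 'h) bform \<Rightarrow> _" by (rule vector_space_fscale)
  interpret u: vector_space "scl U" using assms(2) by (simp add: vspace_def)
  have "p.subspace {\<zeta> \<in> car PN. f \<zeta> \<in> T}"
    using vspace_closed[OF vspace_PN] u.subspace_0[OF assms(3)] u.subspace_add[OF assms(3)]
      u.subspace_scale[OF assms(3)] lin_scl[OF assms(1)]
    by (intro p.subspaceI) (auto simp: lin_zero[OF vspace_PN assms(1)] lin_add[OF assms(1)])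
  from ext_space_minimal[OF this] show ?thesis using assms(4,5) by (auto simp: ext_mem form_mem)
qed

lemma lin_ext_space_ext:
  assumes "lin PN U f" "lin PN U g" "vspace U"
    and "\<And>\<omega> h. \<omega> \<in> car M.\<Omega> \<Longrightarrow> f (ext \<omega> h 1) = g (ext \<omega> h 1)" and "\<zeta> \<in> car ext_space"
  shows "f \<zeta> = g \<zeta>"
proof -
  have "lin PN U (\<lambda>x. f x + scl U (-1) (g x))"
    by (intro lin_plus lin_scl_right assms)
  from lin_ext_space_subset[OF this assms(3) subspace_single_zero[OF assms(3)] _ assms(5)]
  have "f \<zeta> + scl U (-1) (g \<zeta>) = 0"
    using assms(4) vspace_add_scl[OF assms(3), of 1 "-1"] vspace_scl_one[OF assms(3)]
      vspace_zero_scl[OF assms(3)] by simp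
  moreover have "g \<zeta> + scl U (-1) (g \<zeta>) = 0"
    using vspace_add_scl[OF assms(3), of 1 "-1" "g \<zeta>"] vspace_scl_one[OF assms(3)]
      vspace_zero_scl[OF assms(3)] by simp
  ultimately show ?thesis by (metis add_right_cancel)
qed

lemma ractP_incl: "\<omega> \<in> car M.\<Omega> \<Longrightarrow> ractP (incl \<omega>) (m \<bullet> h) = ext (ract M N\<^sub>M \<omega> m) h 1"
  using ext_mult_left[OF M.ract_forms, of \<omega> m 1 h] by (simp add: ractP_ext form_mem)

lemma lactP_ext_space:
  assumes "\<zeta> \<in> car ext_space" "p \<in> car P"
  shows "lactP p \<zeta> \<in> car ext_space"
proof (rule lin_ext_space_subset[OF lin_lactP[OF assms(2)] vspace_PN _ _ assms(1)])
  show "module.subspace (scl PN) (car ext_space)" using subspace_car[OF vspace_ext_space] by simp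
  fix \<omega> h assume \<omega>: "\<omega> \<in> car M.\<Omega>"
  show "lactP p (ext \<omega> h 1) \<in> car ext_space"
    by (rule lin_tspan_subset[OF lin_lactP_param[OF ext_mem[OF form_mem[OF \<omega>]]] order.refl order.refl _ vspace_PN
          _ assms(2)[unfolded car_tensor]])
      (use subspace_car[OF vspace_ext_space] in
        \<open>simp_all add: lactP_ext form_mem \<omega> ext_in_ext_space M.lact_forms\<close>)
qed

lemma ractP_ext_space:
  assumes "\<zeta> \<in> car ext_space" "p \<in> car P"
  shows "ractP \<zeta> p \<in> car ext_space"
proof (rule lin_ext_space_subset[OF lin_ractP[OF assms(2)] vspace_PN _ _ assms(1)])
  show "module.subspace (scl PN) (car ext_space)" using subspace_car[OF vspace_ext_space] by simp
  fix \<omega> h assume \<omega>: "\<omega> \<in> car M.\<Omega>"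
  \<comment> \<open>Right multiplication fills the second fibre leg; \<open>ext_mult_left\<close>
    moves its content to the first, where \<open>ext_space\<close> has its generators.\<close>
  have "ext (ract M N\<^sub>M \<omega> m) h g \<in> car ext_space" for m g
    unfolding ext_mult_left[OF M.ract_forms[OF \<omega>], of m h g] by (intro ext_in_ext_space M.ract_forms \<omega>)
  then show "ractP (ext \<omega> h 1) p \<in> car ext_space"
    by (intro lin_tspan_subset[OF lin_ractP_param[OF ext_mem[OF form_mem[OF \<omega>]]] order.refl order.refl _ vspace_PN
          _ assms(2)[unfolded car_tensor]])
      (use subspace_car[OF vspace_ext_space] in \<open>simp_all add: ractP_ext form_mem \<omega>\<close>)
qed

lemma P_forms_eq: "P_forms M N\<^sub>M H \<Delta> Q = ext_space"
proof -
  interpret vector_space "fscale :: 'k \<Rightarrow> ('k, 'm, 'h) bform \<Rightarrow> _" by (rule vector_space_fscale)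
  let ?X = "{lactP p (incl \<omega>) | p \<omega>. p \<in> car P \<and> \<omega> \<in> car M.\<Omega>}"
  have "ext \<omega> h 1 \<in> span ?X" if "\<omega> \<in> car M.\<Omega>" for \<omega> h
  proof (rule span_base)
    have "ext \<omega> h 1 = lactP (1 \<bullet> h) (incl \<omega>)"
      using that by (simp add: lactP_ext form_mem M.lact_one)
    then show "ext \<omega> h 1 \<in> ?X" using that by (auto intro!: exI[of _ "1 \<bullet> h"] tns_mem)
  qed
  then have "car ext_space \<subseteq> span ?X" by (intro ext_space_minimal subspace_span)
  moreover have "span ?X \<subseteq> car ext_space"
    using subspace_car[OF vspace_ext_space] by (intro span_minimal) (auto simp: lactP_ext_space ext_in_ext_space)
  ultimately show ?thesis by (simp add: P_forms_def ext_space_def)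
qed

text \<open>A generator \<open>ext \<omega> h 1\<close> is also a right multiple of
  \<open>incl \<omega>\<close> by \<open>1 \<bullet> h\<close>, once \<open>ext_mult_right\<close>
  has moved \<open>h\<close> to the second leg.\<close>

lemma forms_P_eq: "forms_P M N\<^sub>M H \<Delta> Q = ext_space"
proof -
  interpret vector_space "fscale :: 'k \<Rightarrow> ('k, 'm, 'h) bform \<Rightarrow> _" by (rule vector_space_fscale)
  let ?X = "{ractP (incl \<omega>) p | \<omega> p. \<omega> \<in> car M.\<Omega> \<and> p \<in> car P}"
  have "ext \<omega> h 1 \<in> span ?X" if "\<omega> \<in> car M.\<Omega>" for \<omega> h
  proof (rule span_base)
    have "ext \<omega> h 1 = ractP (incl \<omega>) (1 \<bullet> h)"
      using that ext_mult_right[OF that, of h 1] by (simp add: ractP_ext form_mem M.ract_one)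
    then show "ext \<omega> h 1 \<in> ?X" using that by (auto intro!: exI[of _ "1 \<bullet> h"] tns_mem)
  qed
  then have "car ext_space \<subseteq> span ?X" by (intro ext_space_minimal subspace_span)
  moreover have "span ?X \<subseteq> car ext_space"
    using subspace_car[OF vspace_ext_space] by (intro span_minimal) (auto simp: ractP_ext_space ext_in_ext_space)
  ultimately show ?thesis by (simp add: forms_P_def ext_space_def)
qed

lemma retract_mem: "\<zeta> \<in> car ext_space \<Longrightarrow> retract \<zeta> \<in> car M.\<Omega>"
  by (rule lin_ext_space_subset[OF lin_retract M.vspace_AA_N])
    (use subspace_car[OF M.vspace_forms] vspace_scl[OF M.vspace_forms] in
      \<open>simp_all add: retract_ext form_mem\<close>)

lemma lin_retract_ext_space: "lin ext_space M.\<Omega> retract"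
  using lin_retract ext_space_subset retract_mem by (auto simp: lin_def subset_iff)

text \<open>The retraction cuts the form leg down to a base form, and the coacted element of
  \<open>H\<close> is put back as its fibre leg. On a cofree comodule this inverts the coaction from
  the left.\<close>

definition reconstruct :: "('k, ('k, 'm, 'h) bform, 'h) tens \<Rightarrow> ('k, 'm, 'h) bform" where
  "reconstruct = tlift PN H PN (\<lambda>\<zeta> h. ext (retract \<zeta>) h 1)"

lemma
  shows lin_reconstruct: "lin (PN \<otimes> H) PN reconstruct"
    and reconstruct_tns: "\<zeta> \<in> car PN \<Longrightarrow> reconstruct (\<zeta> \<otimes>\<^bsub>PN,H\<^esub> h) = ext (retract \<zeta>) h 1"
proof -
  have "bilin PN H PN (\<lambda>\<zeta> h. ext (retract \<zeta>) h 1)"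
    by (intro bilinI lin_compose[OF lin_retract lin_ext] lin_ext_left lin_mem[OF lin_retract])
  from tlift[OF vspace_PN this] show "lin (PN \<otimes> H) PN reconstruct"
    "\<zeta> \<in> car PN \<Longrightarrow> reconstruct (\<zeta> \<otimes>\<^bsub>PN,H\<^esub> h) = ext (retract \<zeta>) h 1"
    by (simp_all add: reconstruct_def)
qed

text \<open>The coaction on \<open>\<Omega>\<^sup>1(M) \<otimes> H\<close> is cofree, so a form is recovered from its coaction.\<close>

lemma reconstruct_coact: "\<zeta> \<in> car ext_space \<Longrightarrow> reconstruct (coact \<zeta>) = \<zeta>"
proof (rule lin_ext_space_ext[OF lin_compose[OF lin_coact lin_reconstruct] lin_id vspace_PN])
  fix \<omega> h assume \<omega>: "\<omega> \<in> car M.\<Omega>"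
  have "reconstruct (coact (ext \<omega> h 1)) = sw h (\<lambda>a b. ext (fscale (\<epsilon> a) \<omega>) b 1)"
    by (simp add: coact_ext form_mem \<omega> lin_tsum[OF lin_reconstruct] ext_mem
        reconstruct_tns retract_ext counit_one)
  also have "\<dots> = sw h (\<lambda>a b. ext \<omega> (scl H (\<epsilon> a) b) 1)"
    using lin_scl[OF lin_ext form_mem[OF \<omega>]] lin_scl[OF lin_ext_left[OF form_mem[OF \<omega>]]] by simp
  also have "\<dots> = ext \<omega> h 1"
    by (rule sw_counit_left'[OF lin_ext_left]) (simp add: form_mem \<omega>)
  finally show "reconstruct (coact (ext \<omega> h 1)) = ext \<omega> h 1" .
qed simp

lemma car_base_forms: "car (base_forms M N\<^sub>M H \<Delta> Q) = incl ` car M.\<Omega>"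
  and scl_base_forms: "scl (base_forms M N\<^sub>M H \<Delta> Q) = fscale"
  by (simp_all add: base_forms_def)

lemma bij_incl: "bij_betw incl (car M.\<Omega>) (incl ` car M.\<Omega>)"
  by (rule inj_on_imp_bij_betw) (metis inj_on_inverseI retract_incl form_mem)

lemma
  shows bilin_tmult: "bilin P P P (tmult M H)"
    and tmult_tns: "tmult M H (a \<bullet> b) (a' \<bullet> b') = (a * a') \<bullet> (b * b')"
proof -
  have b1: "bilin M H P (\<lambda>a' b'. (a * a') \<bullet> (b * b'))" for a b
    by (intro lin_intros hopf_lin M.lin_mult_right; simp)
  have b2: "bilin M H P (\<lambda>a b. tlift M H P (\<lambda>a' b'. (a * a') \<bullet> (b * b')) y)" if "y \<in> car P" for y
    using that by (intro bilinI lin_tlift_param b1 vspace_tensor vspace M.vspace lin_tns_left lin_tns_right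
        hopf_lin M.lin_mult_left lin_id) simp_all
  show "bilin P P P (tmult M H)"
    unfolding tmult_def
    by (intro bilinI lin_tlift_param lin_tlift_arg b1 b2 vspace_tensor lin_id) simp_all
  show "tmult M H (a \<bullet> b) (a' \<bullet> b') = (a * a') \<bullet> (b * b')"
    unfolding tmult_def
    by (subst tlift(2)[OF vspace_tensor b2]) (simp_all add: tlift(2)[OF vspace_tensor b1])
qed

lemma tmult_mem: "p \<in> car P \<Longrightarrow> q \<in> car P \<Longrightarrow> tmult M H p q \<in> car P"
  by (rule bilin_mem[OF bilin_tmult])

lemma ractP_mem: "p \<in> car P \<Longrightarrow> \<zeta> \<in> car PN \<Longrightarrow> ractP \<zeta> p \<in> car PN"
  by (rule lin_mem[OF lin_ractP])

text \<open>On \<open>ext_space\<close> the module law can be checked on the generators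
  \<open>ext \<omega> h 1\<close>, where it is the law of the base action together with
  associativity in \<open>H\<close>.\<close>

lemma lactP_tmult:
  assumes "p \<in> car P" "\<zeta> \<in> car ext_space"
  shows "lactP (tmult M H (m \<bullet> g) p) \<zeta> = lactP (m \<bullet> g) (lactP p \<zeta>)"
proof -
  have mg: "m \<bullet> g \<in> car P" by (simp)
  have \<zeta>: "\<zeta> \<in> car PN" using assms(2) ext_space_subset by blast
  show ?thesis
  proof (rule lin_tensor_ext[OF lin_compose[OF bilin_right[OF bilin_tmult mg] lin_lactP_param[OF \<zeta>]]
        lin_compose[OF lin_lactP_param[OF \<zeta>] lin_lactP[OF mg]] refl _ assms(1)])
    fix a b
    have 1: "lin PN PN (\<lambda>\<zeta>. lactP (m \<bullet> g) (lactP (a \<bullet> b) \<zeta>))"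
      by (intro lin_compose[OF lin_lactP lin_lactP] tns_mem) simp_all
    show "lactP (tmult M H (m \<bullet> g) (a \<bullet> b)) \<zeta> = lactP (m \<bullet> g) (lactP (a \<bullet> b) \<zeta>)"
      unfolding tmult_tns
      by (rule lin_ext_space_ext[OF lin_lactP 1 vspace_PN _ assms(2)])
        (simp_all add: lactP_ext form_mem M.lact_lact M.lact_forms mult.assoc)
  qed
qed

lemma ractP_tmult:
  assumes "p \<in> car P" "\<zeta> \<in> car ext_space"
  shows "ractP \<zeta> (tmult M H p (m \<bullet> g)) = ractP (ractP \<zeta> p) (m \<bullet> g)"
proof -
  have mg: "m \<bullet> g \<in> car P" by (simp)
  have \<zeta>: "\<zeta> \<in> car PN" using assms(2) ext_space_subset by blast
  show ?thesis
  proof (rule lin_tensor_ext[OF lin_compose[OF bilin_left[OF bilin_tmult mg] lin_ractP_param[OF \<zeta>]]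
        lin_compose[OF lin_ractP_param[OF \<zeta>] lin_ractP[OF mg]] refl _ assms(1)])
    fix a b
    have 1: "lin PN PN (\<lambda>\<zeta>. ractP (ractP \<zeta> (a \<bullet> b)) (m \<bullet> g))"
      by (intro lin_compose[OF lin_ractP lin_ractP] tns_mem) simp_all
    show "ractP \<zeta> (tmult M H (a \<bullet> b) (m \<bullet> g)) = ractP (ractP \<zeta> (a \<bullet> b)) (m \<bullet> g)"
      unfolding tmult_tns
      by (rule lin_ext_space_ext[OF lin_ractP 1 vspace_PN _ assms(2)])
        (simp_all add: ractP_ext form_mem M.ract_ract M.ract_forms mult.assoc)
  qed
qed

abbreviation coactP :: "('k, 'm, 'h) tens \<Rightarrow> ('k, ('k, 'm, 'h) tens, 'h) tens" where
  "coactP \<equiv> P_coaction M H \<Delta>"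

lemma
  shows lin_coactP: "lin P (P \<otimes> H) coactP"
    and coactP_tns: "coactP (m \<bullet> h) = sw h (\<lambda>a b. (m \<bullet> a) \<otimes>\<^bsub>P,H\<^esub> b)"
proof -
  have b1: "bilin H H (P \<otimes> H) (\<lambda>h1 h2. (m \<bullet> h1) \<otimes>\<^bsub>P,H\<^esub> h2)" for m
    by (intro lin_intros; simp)
  have b2: "bilin M H (P \<otimes> H) (\<lambda>m h. sw h (\<lambda>a b. (m \<bullet> a) \<otimes>\<^bsub>P,H\<^esub> b))"
    by (intro lin_intros hopf_lin; simp)
  from tlift[OF vspace_tensor b2] show "lin P (P \<otimes> H) coactP"
    "coactP (m \<bullet> h) = sw h (\<lambda>a b. (m \<bullet> a) \<otimes>\<^bsub>P,H\<^esub> b)"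
    by (simp_all add: P_coaction_def tlift_sw[OF vspace_tensor b1])
qed

text \<open>The retraction of m \<mapsto> m \<otimes> 1, by which the coefficients in
  \<open>M\<close> of invariants and of comodule maps are read off.\<close>

definition fibre_counit :: "('k, 'm, 'h) tens \<Rightarrow> 'm" where
  "fibre_counit = tlift M H M (\<lambda>m h. scl M (\<epsilon> h) m)"

lemma
  shows lin_fibre_counit: "lin P M fibre_counit"
    and fibre_counit_tns: "fibre_counit (m \<bullet> h) = scl M (\<epsilon> h) m"
proof -
  have "bilin M H M (\<lambda>m h. scl M (\<epsilon> h) m)" by (intro lin_intros hopf_lin; simp)
  from tlift[OF M.vspace this] show "lin P M fibre_counit"
    "fibre_counit (m \<bullet> h) = scl M (\<epsilon> h) m"
    by (simp_all add: fibre_counit_def)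
qed

end

subsection \<open>Coordinates\<close>

text \<open>Indices are kept apart from basis vectors so that \<open>B\<close> can index both itself
  as a basis of \<open>V\<close> and the dual basis of \<open>dual V\<close>.\<close>

locale finite_basis =
  fixes W :: "('k::field, 'w::ab_group_add) kspace" and I :: "'i set"
    and w :: "'i \<Rightarrow> 'w" and c :: "'i \<Rightarrow> 'w \<Rightarrow> 'k"
  assumes vspace_W: "vspace W" and finite_I: "finite I"
    and basis_mem: "i \<in> I \<Longrightarrow> w i \<in> car W"
    and lin_coord: "i \<in> I \<Longrightarrow> lin W gnd (c i)"
    and coord_basis: "i \<in> I \<Longrightarrow> j \<in> I \<Longrightarrow> c i (w j) = (if i = j then 1 else 0)"
    and basis_expand: "x \<in> car W \<Longrightarrow> x = (\<Sum>i\<in>I. scl W (c i x) (w i))"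
begin

text \<open>Only the scalar multiplications of the two codomains have to agree:
  \<open>retract_induced\<close> compares a map into the quotient of \<open>M \<otimes> M\<close>
  with one into the forms.\<close>

lemma lin_basis_ext:
  assumes "lin W U f" "lin W U' g" "scl U = scl U'" "\<And>i. i \<in> I \<Longrightarrow> f (w i) = g (w i)" "x \<in> car W"
  shows "f x = g x"
proof -
  have m: "scl W (c i x) (w i) \<in> car W" if "i \<in> I" for i
    using vspace_scl[OF vspace_W] basis_mem that by simp
  have "f x = (\<Sum>i\<in>I. scl U (c i x) (f (w i)))"
    by (subst basis_expand[OF assms(5)])
      (simp add: lin_sum[OF vspace_W assms(1)] m lin_scl[OF assms(1) basis_mem])
  moreover have "g x = (\<Sum>i\<in>I. scl U (c i x) (g (w i)))"
    by (subst basis_expand[OF assms(5)])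
      (simp add: lin_sum[OF vspace_W assms(2)] m lin_scl[OF assms(2) basis_mem] assms(3))
  ultimately show ?thesis using assms(4) by simp
qed

lemma lin_basis_subset:
  assumes "lin W U f" "vspace U" "module.subspace (scl U) T" "\<And>i. i \<in> I \<Longrightarrow> f (w i) \<in> T" "x \<in> car W"
  shows "f x \<in> T"
proof -
  interpret u: vector_space "scl U" using assms(2) by (simp add: vspace_def)
  have "f x = (\<Sum>i\<in>I. scl U (c i x) (f (w i)))"
    by (subst basis_expand[OF assms(5)])
      (simp add: lin_sum[OF vspace_W assms(1)] vspace_scl[OF vspace_W] basis_mem lin_scl[OF assms(1) basis_mem])
  also have "\<dots> \<in> T" using assms(3,4) by (intro u.subspace_sum u.subspace_scale)
  finally show ?thesis .
qed

definition rcoord :: "('k, 'x::ab_group_add) kspace \<Rightarrow> 'i \<Rightarrow> ('k, 'x, 'w) tens \<Rightarrow> 'x" where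
  "rcoord X i = tlift X W X (\<lambda>x v. scl X (c i v) x)"

lemma bilin_rcoord: "vspace X \<Longrightarrow> i \<in> I \<Longrightarrow> bilin X W X (\<lambda>x v. scl X (c i v) x)"
  by (intro lin_intros lin_coord)

lemma lin_rcoord: "vspace X \<Longrightarrow> i \<in> I \<Longrightarrow> lin (X \<otimes> W) X (rcoord X i)"
  unfolding rcoord_def by (rule tlift(1)[OF _ bilin_rcoord])

lemma rcoord_tns: "vspace X \<Longrightarrow> i \<in> I \<Longrightarrow> x \<in> car X \<Longrightarrow> v \<in> car W
    \<Longrightarrow> rcoord X i (x \<otimes>\<^bsub>X,W\<^esub> v) = scl X (c i v) x"
  unfolding rcoord_def by (rule tlift(2)[OF _ bilin_rcoord])

lemma tensor_expand:
  assumes "vspace X" "z \<in> car (X \<otimes> W)"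
  shows "z = (\<Sum>i\<in>I. rcoord X i z \<otimes>\<^bsub>X,W\<^esub> w i)"
proof (rule lin_tensor_ext[OF lin_id _ refl _ assms(2)])
  show "lin (X \<otimes> W) (X \<otimes> W) (\<lambda>z. \<Sum>i\<in>I. rcoord X i z \<otimes>\<^bsub>X,W\<^esub> w i)"
    by (intro lin_sum_pointwise lin_tns_left lin_rcoord vspace_tensor assms basis_mem)
  fix x v assume x: "x \<in> car X" and v: "v \<in> car W"
  note l = bilin_right[OF bilin_tns x, of W]
  have "x \<otimes>\<^bsub>X,W\<^esub> v = (\<Sum>i\<in>I. x \<otimes>\<^bsub>X,W\<^esub> scl W (c i v) (w i))"
    by (subst basis_expand[OF v], subst lin_sum[OF vspace_W l])
      (simp_all add: vspace_scl[OF vspace_W] basis_mem)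
  also have "\<dots> = (\<Sum>i\<in>I. rcoord X i (x \<otimes>\<^bsub>X,W\<^esub> v) \<otimes>\<^bsub>X,W\<^esub> w i)"
    using lin_scl[OF l basis_mem] by (simp add: rcoord_tns assms x v basis_mem scl_tns)
  finally show "x \<otimes>\<^bsub>X,W\<^esub> v = (\<Sum>i\<in>I. rcoord X i (x \<otimes>\<^bsub>X,W\<^esub> v) \<otimes>\<^bsub>X,W\<^esub> w i)" .
qed

lemma rcoord_sum:
  assumes "vspace X" "j \<in> I" "\<And>i. i \<in> I \<Longrightarrow> m i \<in> car X"
  shows "rcoord X j (\<Sum>i\<in>I. m i \<otimes>\<^bsub>X,W\<^esub> w i) = m j"
proof -
  have "rcoord X j (\<Sum>i\<in>I. m i \<otimes>\<^bsub>X,W\<^esub> w i) = (\<Sum>i\<in>I. scl X (if j = i then 1 else 0) (m i))"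
    by (subst lin_sum[OF vspace_tensor lin_rcoord])
      (simp_all add: assms basis_mem rcoord_tns coord_basis)
  also have "\<dots> = (\<Sum>i\<in>I. if j = i then m i else 0)"
    by (intro sum.cong) (simp_all add: vspace_scl_one vspace_zero_scl assms(1))
  finally show ?thesis using assms(2) finite_I by simp
qed

text \<open>Families are extensional so that the coordinates determine them; \<open>restrict\<close>
  settles the values off \<open>I\<close>.\<close>

lemma bij_tensor_coords:
  assumes "vspace X"
  shows "bij_betw (\<lambda>m. \<Sum>i\<in>I. m i \<otimes>\<^bsub>X,W\<^esub> w i) (I \<rightarrow>\<^sub>E car X) (car (X \<otimes> W))"
proof (rule bij_betw_byWitness[where f' = "\<lambda>z. restrict (\<lambda>i. rcoord X i z) I"])
  show "\<forall>m\<in>I \<rightarrow>\<^sub>E car X. restrict (\<lambda>i. rcoord X i (\<Sum>i\<in>I. m i \<otimes>\<^bsub>X,W\<^esub> w i)) I = m"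
    using rcoord_sum[OF assms] by (intro ballI extensionalityI[where A = I]) (auto simp: PiE_def)
  show "\<forall>z\<in>car (X \<otimes> W). (\<Sum>i\<in>I. restrict (\<lambda>i. rcoord X i z) I i \<otimes>\<^bsub>X,W\<^esub> w i) = z"
    using tensor_expand[OF assms] by simp
  show "(\<lambda>m. \<Sum>i\<in>I. m i \<otimes>\<^bsub>X,W\<^esub> w i) ` (I \<rightarrow>\<^sub>E car X) \<subseteq> car (X \<otimes> W)"
    by (auto intro!: vspace_sum vspace_tensor tns_mem basis_mem)
  show "(\<lambda>z. restrict (\<lambda>i. rcoord X i z) I) ` car (X \<otimes> W) \<subseteq> I \<rightarrow>\<^sub>E car X"
    using lin_mem[OF lin_rcoord[OF assms]] by auto
qed

definition lcoord :: "('k, 'x::ab_group_add) kspace \<Rightarrow> 'i \<Rightarrow> ('k, 'w, 'x) tens \<Rightarrow> 'x" where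
  "lcoord X i = tlift W X X (\<lambda>v x. scl X (c i v) x)"

lemma bilin_lcoord: "vspace X \<Longrightarrow> i \<in> I \<Longrightarrow> bilin W X X (\<lambda>v x. scl X (c i v) x)"
  by (intro lin_intros lin_coord)

lemma lin_lcoord: "vspace X \<Longrightarrow> i \<in> I \<Longrightarrow> lin (W \<otimes> X) X (lcoord X i)"
  unfolding lcoord_def by (rule tlift(1)[OF _ bilin_lcoord])

lemma lcoord_tns: "vspace X \<Longrightarrow> i \<in> I \<Longrightarrow> x \<in> car X \<Longrightarrow> v \<in> car W
    \<Longrightarrow> lcoord X i (v \<otimes>\<^bsub>W,X\<^esub> x) = scl X (c i v) x"
  unfolding lcoord_def by (rule tlift(2)[OF _ bilin_lcoord])

lemma tensor_expand_left:
  assumes "vspace X" "z \<in> car (W \<otimes> X)"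
  shows "z = (\<Sum>i\<in>I. w i \<otimes>\<^bsub>W,X\<^esub> lcoord X i z)"
proof (rule lin_tensor_ext[OF lin_id _ refl _ assms(2)])
  show "lin (W \<otimes> X) (W \<otimes> X) (\<lambda>z. \<Sum>i\<in>I. w i \<otimes>\<^bsub>W,X\<^esub> lcoord X i z)"
    by (intro lin_sum_pointwise lin_tns_right lin_lcoord vspace_tensor assms basis_mem)
  fix v x assume v: "v \<in> car W" and x: "x \<in> car X"
  note l = bilin_left[OF bilin_tns x, of W]
  have "v \<otimes>\<^bsub>W,X\<^esub> x = (\<Sum>i\<in>I. scl W (c i v) (w i) \<otimes>\<^bsub>W,X\<^esub> x)"
    by (subst basis_expand[OF v], subst lin_sum[OF vspace_W l])
      (simp_all add: vspace_scl[OF vspace_W] basis_mem)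
  also have "\<dots> = (\<Sum>i\<in>I. w i \<otimes>\<^bsub>W,X\<^esub> lcoord X i (v \<otimes>\<^bsub>W,X\<^esub> x))"
    using lin_scl[OF bilin_right[OF bilin_tns[of W X] basis_mem] x]
    by (simp add: lcoord_tns assms x v basis_mem scl_tns[symmetric])
  finally show "v \<otimes>\<^bsub>W,X\<^esub> x = (\<Sum>i\<in>I. w i \<otimes>\<^bsub>W,X\<^esub> lcoord X i (v \<otimes>\<^bsub>W,X\<^esub> x))" .
qed

lemma lcoord_sum:
  assumes "vspace X" "j \<in> I" "\<And>i. i \<in> I \<Longrightarrow> m i \<in> car X"
  shows "lcoord X j (\<Sum>i\<in>I. w i \<otimes>\<^bsub>W,X\<^esub> m i) = m j"
proof -
  have "lcoord X j (\<Sum>i\<in>I. w i \<otimes>\<^bsub>W,X\<^esub> m i) = (\<Sum>i\<in>I. scl X (if j = i then 1 else 0) (m i))"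
    by (subst lin_sum[OF vspace_tensor lin_lcoord])
      (simp_all add: assms basis_mem lcoord_tns coord_basis)
  also have "\<dots> = (\<Sum>i\<in>I. if j = i then m i else 0)"
    by (intro sum.cong) (simp_all add: vspace_scl_one vspace_zero_scl assms(1))
  finally show ?thesis using assms(2) finite_I by simp
qed

lemma bij_tensor_coords_left:
  assumes "vspace X"
  shows "bij_betw (\<lambda>m. \<Sum>i\<in>I. w i \<otimes>\<^bsub>W,X\<^esub> m i) (I \<rightarrow>\<^sub>E car X) (car (W \<otimes> X))"
proof (rule bij_betw_byWitness[where f' = "\<lambda>z. restrict (\<lambda>i. lcoord X i z) I"])
  show "\<forall>m\<in>I \<rightarrow>\<^sub>E car X. restrict (\<lambda>i. lcoord X i (\<Sum>i\<in>I. w i \<otimes>\<^bsub>W,X\<^esub> m i)) I = m"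
    using lcoord_sum[OF assms] by (intro ballI extensionalityI[where A = I]) (auto simp: PiE_def)
  show "\<forall>z\<in>car (W \<otimes> X). (\<Sum>i\<in>I. w i \<otimes>\<^bsub>W,X\<^esub> restrict (\<lambda>i. lcoord X i z) I i) = z"
    using tensor_expand_left[OF assms] by simp
  show "(\<lambda>m. \<Sum>i\<in>I. w i \<otimes>\<^bsub>W,X\<^esub> m i) ` (I \<rightarrow>\<^sub>E car X) \<subseteq> car (W \<otimes> X)"
    by (auto intro!: vspace_sum vspace_tensor tns_mem basis_mem)
  show "(\<lambda>z. restrict (\<lambda>i. lcoord X i z) I) ` car (W \<otimes> X) \<subseteq> I \<rightarrow>\<^sub>E car X"
    using lin_mem[OF lin_lcoord[OF assms]] by auto
qed

end

lemma sum_rotate3: "(\<Sum>b\<in>I. \<Sum>a\<in>J. \<Sum>c\<in>K. f b a c) = (\<Sum>a\<in>J. \<Sum>c\<in>K. \<Sum>b\<in>I. f b a c)"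
  by (subst sum.swap) (intro sum.cong refl sum.swap)

lemma sum_rotate4:
  "(\<Sum>b\<in>I. \<Sum>a\<in>J. \<Sum>c\<in>K. \<Sum>d\<in>L. f b a c d) = (\<Sum>a\<in>J. \<Sum>c\<in>K. \<Sum>d\<in>L. \<Sum>b\<in>I. f b a c d)"
  by (subst sum.swap) (intro sum.cong refl sum_rotate3)

subsection \<open>Equivariant maps into the forms on the bundle\<close>

text \<open>The comodule axioms expressed by the coefficient matrix \<open>s\<close> in a basis. The
  two instances are \<open>V\<close> with the matrix \<open>r\<close> and \<open>dual V\<close> with
  the transpose of \<open>t\<close>.\<close>

locale matrix_coaction = tensor_bundle H \<Delta> \<epsilon> S Q M N\<^sub>M + finite_basis W I w c
  for H :: "('k::field, 'h::ring_1) kspace" and \<Delta> \<epsilon> S Q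
    and M :: "('k, 'm::{ring, monoid_mult}) kspace" and N\<^sub>M
    and W :: "('k, 'w::ab_group_add) kspace" and I :: "'i set" and w c +
  fixes \<kappa> :: "'w \<Rightarrow> ('k, 'w, 'h) tens" and s :: "'i \<Rightarrow> 'i \<Rightarrow> 'h"
  assumes lin_\<kappa>: "lin W (W \<otimes> H) \<kappa>"
    and \<kappa>_basis: "j \<in> I \<Longrightarrow> \<kappa> (w j) = (\<Sum>i\<in>I. w i \<otimes>\<^bsub>W,H\<^esub> s i j)"
    and comult_s: "i \<in> I \<Longrightarrow> j \<in> I \<Longrightarrow> \<Delta> (s i j) = (\<Sum>l\<in>I. s i l \<odot> s l j)"
    and counit_s: "i \<in> I \<Longrightarrow> j \<in> I \<Longrightarrow> \<epsilon> (s i j) = (if i = j then 1 else 0)"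
begin

lemma tlift_\<kappa>_basis:
  assumes "vspace U" "bilin W H U F" "j \<in> I"
  shows "tlift W H U F (\<kappa> (w j)) = (\<Sum>i\<in>I. F (w i) (s i j))"
proof -
  have "tlift W H U F (\<kappa> (w j)) = (\<Sum>i\<in>I. tlift W H U F (w i \<otimes>\<^bsub>W,H\<^esub> s i j))"
    unfolding \<kappa>_basis[OF assms(3)]
    by (rule lin_sum[OF vspace_tensor tlift(1)[OF assms(1,2)]]) (simp add: basis_mem)
  then show ?thesis by (simp add: tlift(2)[OF assms(1,2)] basis_mem)
qed

lemma sw_s: "i \<in> I \<Longrightarrow> j \<in> I \<Longrightarrow> vspace U \<Longrightarrow> bilin H H U F \<Longrightarrow> sw (s i j) F = (\<Sum>l\<in>I. F (s i l) (s l j))"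
  by (subst tlift_sw[symmetric]) (auto simp: comult_s lin_sum[OF vspace_tensor tlift(1)] tlift(2))

definition induced :: "('w \<Rightarrow> ('k, 'm) form) \<Rightarrow> 'w \<Rightarrow> ('k, 'm, 'h) bform" where
  "induced e x = tlift W H PN (\<lambda>x0 x1. ext (e x0) x1 1) (\<kappa> x)"

lemma bilin_induced:
  assumes "lin W M.\<Omega> e"
  shows "bilin W H PN (\<lambda>v h. ext (e v) h 1)"
proof (rule bilinI)
  have "lin W M.AA_N e" by (rule lin_weaken[OF assms M.forms_subset]) simp
  then show "lin W PN (\<lambda>v. ext (e v) h 1)" for h by (rule lin_compose[OF _ lin_ext])
  show "lin H PN (\<lambda>h. ext (e v) h 1)" if "v \<in> car W" for v
    by (rule lin_ext_left) (simp add: form_mem lin_mem[OF assms that])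
qed

lemma induced_basis:
  assumes "lin W M.\<Omega> e" "j \<in> I"
  shows "induced e (w j) = (\<Sum>i\<in>I. ext (e (w i)) (s i j) 1)"
  unfolding induced_def by (rule tlift_\<kappa>_basis[OF vspace_PN bilin_induced[OF assms(1)] assms(2)])

lemma lin_induced: "lin W M.\<Omega> e \<Longrightarrow> lin W PN (induced e)"
  unfolding induced_def
  by (rule lin_compose[OF lin_\<kappa> tlift(1)[OF vspace_PN bilin_induced]])

lemma induced_mem:
  assumes "lin W M.\<Omega> e" "x \<in> car W"
  shows "induced e x \<in> car ext_space"
proof (rule lin_basis_subset[OF lin_induced[OF assms(1)] vspace_PN _ _ assms(2)])
  show "module.subspace (scl PN) (car ext_space)" using subspace_car[OF vspace_ext_space] by simp
  show "induced e (w j) \<in> car ext_space" if "j \<in> I" for j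
    unfolding induced_basis[OF assms(1) that]
    by (intro vspace_sum[OF vspace_ext_space] ext_in_ext_space lin_mem[OF assms(1)] basis_mem)
qed

lemma lin_induced_ext_space: "lin W M.\<Omega> e \<Longrightarrow> lin W ext_space (induced e)"
  using lin_induced induced_mem by (auto simp: lin_def)

text \<open>The counit turns the matrix \<open>s\<close> into the identity matrix, so only the
  diagonal term survives.\<close>

lemma retract_induced:
  assumes "lin W M.\<Omega> e" "x \<in> car W"
  shows "retract (induced e x) = e x"
proof (rule lin_basis_ext[OF lin_compose[OF lin_induced[OF assms(1)] lin_retract] assms(1) _ _ assms(2)])
  note e = lin_mem[OF assms(1) basis_mem]
  fix j assume j: "j \<in> I"
  have "retract (induced e (w j)) = (\<Sum>i\<in>I. fscale (\<epsilon> (s i j)) (e (w i)))"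
    by (simp add: induced_basis[OF assms(1) j] lin_sum[OF vspace_PN lin_retract] ext_mem form_mem e
        retract_ext counit_one)
  also have "\<dots> = (\<Sum>i\<in>I. if i = j then e (w i) else 0)"
    using vspace_scl_one[OF M.vspace_forms] vspace_zero_scl[OF M.vspace_forms]
    by (intro sum.cong) (simp_all add: counit_s j)
  finally show "retract (induced e (w j)) = e (w j)" using finite_I j by simp
qed simp

lemma bilin_equivariance:
  "lin W PN \<theta> \<Longrightarrow> bilin W H (PN \<otimes> H) (\<lambda>v0 v1. \<theta> v0 \<otimes>\<^bsub>PN,H\<^esub> v1)"
  by (intro lin_intros; simp add: lin_mem[of W PN \<theta>] vspace_W)

lemma equivariant_iff_basis:
  assumes "lin W PN \<theta>"
  shows "(\<forall>x\<in>car W. coact (\<theta> x) = tlift W H (PN \<otimes> H) (\<lambda>v0 v1. \<theta> v0 \<otimes>\<^bsub>PN,H\<^esub> v1) (\<kappa> x))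
    \<longleftrightarrow> (\<forall>j\<in>I. coact (\<theta> (w j)) = (\<Sum>i\<in>I. \<theta> (w i) \<otimes>\<^bsub>PN,H\<^esub> s i j))" (is "?l \<longleftrightarrow> ?r")
proof
  note t = tlift_\<kappa>_basis[OF vspace_tensor bilin_equivariance[OF assms]]
  show ?r if ?l using that by (simp add: t basis_mem)
  assume r: ?r
  show ?l
  proof
    fix x assume x: "x \<in> car W"
    show "coact (\<theta> x) = tlift W H (PN \<otimes> H) (\<lambda>v0 v1. \<theta> v0 \<otimes>\<^bsub>PN,H\<^esub> v1) (\<kappa> x)"
      by (rule lin_basis_ext[OF lin_compose[OF assms lin_coact]
            lin_compose[OF lin_\<kappa> tlift(1)[OF vspace_tensor bilin_equivariance[OF assms]]] refl _ x])
        (use r in \<open>simp_all add: t\<close>)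
  qed
qed

text \<open>By \<open>comult_s\<close> both sides are the same double sum, with \<open>s i l\<close>
  in the fibre leg and \<open>s l j\<close> in the coacted leg.\<close>

lemma induced_equivariant:
  assumes "lin W M.\<Omega> e"
  shows "\<forall>x\<in>car W. coact (induced e x)
    = tlift W H (PN \<otimes> H) (\<lambda>v0 v1. induced e v0 \<otimes>\<^bsub>PN,H\<^esub> v1) (\<kappa> x)"
  unfolding equivariant_iff_basis[OF lin_induced[OF assms]]
proof
  note e = form_mem[OF lin_mem[OF assms basis_mem]]
  fix j assume j: "j \<in> I"
  have b: "bilin H H (PN \<otimes> H) (\<lambda>x y. ext (e (w i)) x 1 \<otimes>\<^bsub>PN,H\<^esub> y)" if "i \<in> I" for i
    using lin_ext_left[OF e[OF that]] by (intro lin_intros; simp add: ext_mem e that)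
  have "coact (induced e (w j)) = (\<Sum>i\<in>I. \<Sum>l\<in>I. ext (e (w i)) (s i l) 1 \<otimes>\<^bsub>PN,H\<^esub> s l j)"
    by (simp add: induced_basis[OF assms] j lin_sum[OF vspace_PN lin_coact] ext_mem e coact_ext
        sw_s[OF _ _ vspace_tensor b])
  also have "\<dots> = (\<Sum>l\<in>I. induced e (w l) \<otimes>\<^bsub>PN,H\<^esub> s l j)"
    by (subst sum.swap) (simp add: induced_basis[OF assms] ext_mem e
        lin_sum[OF vspace_PN bilin_left[OF bilin_tns[of PN H]]])
  finally show "coact (induced e (w j)) = (\<Sum>l\<in>I. induced e (w l) \<otimes>\<^bsub>PN,H\<^esub> s l j)" .
qed

text \<open>Applying \<open>reconstruct\<close> to the equivariance equation expresses \<theta> on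
  the basis through the retractions of its values.\<close>

lemma
  assumes \<theta>: "lin W ext_space \<theta>"
    and eq: "\<forall>x\<in>car W. coact (\<theta> x) = tlift W H (PN \<otimes> H) (\<lambda>v0 v1. \<theta> v0 \<otimes>\<^bsub>PN,H\<^esub> v1) (\<kappa> x)"
  shows lin_retract_equivariant: "lin W M.\<Omega> (\<lambda>x. retract (\<theta> x))"
    and induced_retract: "x \<in> car W \<Longrightarrow> induced (\<lambda>x. retract (\<theta> x)) x = \<theta> x"
proof -
  show l: "lin W M.\<Omega> (\<lambda>x. retract (\<theta> x))" by (rule lin_compose[OF \<theta> lin_retract_ext_space])
  have \<theta>': "lin W PN \<theta>" by (rule lin_weaken[OF \<theta> ext_space_subset]) simp
  show "induced (\<lambda>x. retract (\<theta> x)) x = \<theta> x" if "x \<in> car W"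
  proof (rule lin_basis_ext[OF lin_induced[OF l] \<theta>' refl _ that])
    fix j assume j: "j \<in> I"
    have "\<theta> (w j) = reconstruct (coact (\<theta> (w j)))"
      by (simp add: reconstruct_coact lin_mem[OF \<theta>] basis_mem j)
    also have "\<dots> = reconstruct (\<Sum>i\<in>I. \<theta> (w i) \<otimes>\<^bsub>PN,H\<^esub> s i j)"
      using eq equivariant_iff_basis[OF \<theta>'] j by simp
    also have "\<dots> = induced (\<lambda>x. retract (\<theta> x)) (w j)"
      by (simp add: induced_basis[OF l j] lin_sum[OF vspace_tensor lin_reconstruct]
          lin_mem[OF \<theta>'] basis_mem reconstruct_tns)
    finally show "induced (\<lambda>x. retract (\<theta> x)) (w j) = \<theta> (w j)" ..
  qed
qed

end

subsection \<open>The comodule and its dual\<close>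

locale bundle_comodule = tensor_bundle H \<Delta> \<epsilon> S Q M N\<^sub>M + V: right_comodule H \<Delta> \<epsilon> V \<rho>
    + fd: finite_dimensional_vector_space "scl V" B
  for H :: "('k::field, 'h::ring_1) kspace" and \<Delta> \<epsilon> S Q
    and M :: "('k, 'm::{ring, monoid_mult}) kspace" and N\<^sub>M
    and V :: "('k, 'v::ab_group_add) kspace" and \<rho> B +
  assumes bij_S: "bij S"
begin

abbreviation fb :: "'v \<Rightarrow> 'v \<Rightarrow> 'k" where "fb \<equiv> dual_basis V B"

lemma vspace_V [simp]: "vspace V"
  by (simp add: vspace_def V.vector_space_scl V.car_UNIV)

lemma mem_V [simp]: "v \<in> car V"
  by (simp add: V.car_UNIV)

lemma lin_fb: "lin V gnd (fb b)"
  using fd.representation_add[OF fd.independent_Basis] fd.representation_scale[OF fd.independent_Basis]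
  by (auto simp: lin_def dual_basis_def gnd_def fd.span_Basis)

lemma fb_basis: "b \<in> B \<Longrightarrow> a \<in> B \<Longrightarrow> fb a b = (if a = b then 1 else 0)"
  using fd.representation_basis[OF fd.independent_Basis] by (auto simp: dual_basis_def)

lemma fb_expand: "(\<Sum>b\<in>B. scl V (fb b v) b) = v"
  unfolding dual_basis_def
  by (rule fd.sum_representation_eq) (simp_all add: fd.independent_Basis fd.span_Basis fd.finite_Basis)

sublocale Vb: finite_basis V B "\<lambda>b. b" fb
  by unfold_locales (simp_all add: fd.finite_Basis lin_fb fb_basis fb_expand)

lemma scl_dual [simp]: "scl (dual V) = fscale" and car_dual: "car (dual V) = {w. lin V gnd w}"
  by (simp_all add: dual_def)

lemma fb_mem [simp]: "fb b \<in> car (dual V)"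
  by (simp add: car_dual lin_fb)

lemma vspace_dual: "vspace (dual V)"
proof (rule vspace_fscaleI)
  interpret vector_space "fscale :: 'k \<Rightarrow> ('v \<Rightarrow> 'k) \<Rightarrow> _" by (rule vector_space_fscale)
  have "lin V gnd (x + y)" if "lin V gnd x" "lin V gnd y" for x y :: "'v \<Rightarrow> 'k"
    using lin_plus[OF vspace_gnd that] by (simp add: plus_fun_def)
  moreover have "lin V gnd (0 :: 'v \<Rightarrow> 'k)"
    using lin_const_zero[OF vspace_gnd] by (simp add: zero_fun_def)
  moreover have "lin V gnd (fscale c x)" if "lin V gnd x" for c and x :: "'v \<Rightarrow> 'k"
    using lin_scl_right[OF vspace_gnd that, of c] by (simp add: fscale_def gnd_def)
  ultimately show "module.subspace fscale (car (dual V))"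
    by (intro subspaceI) (simp_all add: car_dual)
qed simp

lemma sum_fun_apply: "(\<Sum>i\<in>I. f i) x = (\<Sum>i\<in>I. f i x)"
  by (induction I rule: infinite_finite_induct) (simp_all add: zero_fun_apply plus_fun_apply)

lemma dual_expand: "w \<in> car (dual V) \<Longrightarrow> w = (\<Sum>b\<in>B. fscale (w b) (fb b))"
proof (rule ext)
  fix v assume w: "w \<in> car (dual V)"
  then have "w v = (\<Sum>b\<in>B. w (scl V (fb b v) b))"
    by (subst fb_expand[symmetric], subst lin_sum[where V = V]) (auto simp: car_dual)
  also have "\<dots> = (\<Sum>b\<in>B. w b * fb b v)"
    using w lin_scl[of V gnd w] by (simp add: car_dual gnd_def mult.commute)
  finally show "w v = (\<Sum>b\<in>B. fscale (w b) (fb b)) v" by (simp add: sum_fun_apply fscale_def)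
qed

sublocale Db: finite_basis "dual V" B fb "\<lambda>b w. w b"
proof unfold_locales
  show "lin (dual V) gnd (\<lambda>w. w i)" for i
    by (auto simp: lin_def gnd_def fscale_def plus_fun_apply)
  show "x = (\<Sum>i\<in>B. scl (dual V) (x i) (fb i))" if "x \<in> car (dual V)" for x
    using dual_expand[OF that] by simp
qed (auto simp: vspace_dual fd.finite_Basis fb_basis)

subsection \<open>Matrix coefficients\<close>

definition r :: "'v \<Rightarrow> 'v \<Rightarrow> 'h" where
  "r a b = Vb.lcoord H a (\<rho> b)"

definition t :: "'v \<Rightarrow> 'v \<Rightarrow> 'h" where
  "t a b = inv S (r a b)"

lemma coaction_basis: "\<rho> b = (\<Sum>a\<in>B. a \<otimes>\<^bsub>V,H\<^esub> r a b)"
  unfolding r_def by (rule Vb.tensor_expand_left[OF vspace lin_mem[OF V.lin_coaction]]) simp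

lemma tlift_coaction:
  assumes "vspace U" "bilin V H U F"
  shows "tlift V H U F (\<rho> b) = (\<Sum>a\<in>B. F a (r a b))"
proof -
  have "tlift V H U F (\<rho> b) = (\<Sum>a\<in>B. tlift V H U F (a \<otimes>\<^bsub>V,H\<^esub> r a b))"
    unfolding coaction_basis[of b]
    by (rule lin_sum[OF vspace_tensor tlift(1)[OF assms]]) (simp)
  then show ?thesis by (simp add: tlift(2)[OF assms])
qed

text \<open>Coassociativity of the coaction, read off at the coordinate \<open>a\<close> of its left
  leg.\<close>

lemma comult_r:
  assumes "a \<in> B"
  shows "\<Delta> (r a b) = (\<Sum>c\<in>B. r a c \<odot> r c b)"
proof -
  let ?U = "V \<otimes> HH"
  have b1: "bilin V H ?U (\<lambda>x y. x \<otimes>\<^bsub>V,HH\<^esub> (y \<odot> c))" for c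
    by (intro lin_intros; simp)
  have b2: "bilin V H ?U (\<lambda>u c. tlift V H ?U (\<lambda>x y. x \<otimes>\<^bsub>V,HH\<^esub> (y \<odot> c)) (\<rho> u))"
    by (intro bilinI lin_tlift_param lin_tlift_arg b1 V.lin_coaction vspace_tensor vspace
        lin_mem[OF V.lin_coaction] lin_tns_right lin_id) simp_all
  have b3: "bilin V H ?U (\<lambda>u b. u \<otimes>\<^bsub>V,HH\<^esub> \<Delta> b)"
    by (intro lin_intros hopf_lin; simp)
  have mem: "r c b \<odot> r d e \<in> car HH" for b c d e by (simp)
  have "(\<Sum>c\<in>B. \<Sum>a\<in>B. a \<otimes>\<^bsub>V,HH\<^esub> (r a c \<odot> r c b)) = (\<Sum>a\<in>B. a \<otimes>\<^bsub>V,HH\<^esub> \<Delta> (r a b))"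
    using trans[OF trans[OF tlift_coaction[OF vspace_tensor b2, symmetric] V.coaction_coassoc]
        tlift_coaction[OF vspace_tensor b3]]
    unfolding tlift_coaction[OF vspace_tensor b1] .
  also have "(\<Sum>c\<in>B. \<Sum>a\<in>B. a \<otimes>\<^bsub>V,HH\<^esub> (r a c \<odot> r c b))
      = (\<Sum>a\<in>B. a \<otimes>\<^bsub>V,HH\<^esub> (\<Sum>c\<in>B. r a c \<odot> r c b))"
    by (subst sum.swap) (simp add: lin_sum[OF vspace_tensor bilin_right[OF bilin_tns[of V "HH"]]] mem)
  finally have "Vb.lcoord HH a (\<Sum>a\<in>B. a \<otimes>\<^bsub>V,HH\<^esub> (\<Sum>c\<in>B. r a c \<odot> r c b))
      = Vb.lcoord HH a (\<Sum>a\<in>B. a \<otimes>\<^bsub>V,HH\<^esub> \<Delta> (r a b))" by simp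
  then show ?thesis
    by (simp add: Vb.lcoord_sum[OF vspace_tensor assms] vspace_sum mem)
qed

lemma sw_r: "a \<in> B \<Longrightarrow> vspace U \<Longrightarrow> bilin H H U F \<Longrightarrow> sw (r a b) F = (\<Sum>c\<in>B. F (r a c) (r c b))"
  by (subst tlift_sw[symmetric]) (auto simp: comult_r lin_sum[OF vspace_tensor tlift(1)] tlift(2))

lemma counit_r:
  assumes "a \<in> B" "b \<in> B"
  shows "\<epsilon> (r a b) = (if a = b then 1 else 0)"
proof -
  have "bilin V H V (\<lambda>u b. scl V (\<epsilon> b) u)" by (intro lin_intros hopf_lin; simp)
  from tlift_coaction[OF vspace_V this, of b] have "b = (\<Sum>a\<in>B. scl V (\<epsilon> (r a b)) a)"
    by (simp add: V.coaction_counit)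
  then have "fb a b = fb a (\<Sum>a\<in>B. scl V (\<epsilon> (r a b)) a)" by simp
  also have "\<dots> = (\<Sum>c\<in>B. \<epsilon> (r c b) * (if a = c then 1 else 0))"
    by (subst lin_sum[OF vspace_V lin_fb]) (simp_all add: lin_scl[OF lin_fb] gnd_def fb_basis assms)
  also have "\<dots> = \<epsilon> (r a b)" using assms(1) fd.finite_Basis by (simp add: if_distrib cong: if_cong)
  finally show ?thesis using assms by (simp add: fb_basis)
qed

lemma inv_S [simp]: "S (inv S h) = h" "inv S (S h) = h"
  using bij_S by (simp_all add: bij_is_surj surj_f_inv_f bij_is_inj)

lemma S_zero: "S 0 = 0"
  by (rule lin_zero[OF vspace lin_antipode])

lemma S_sum: "S (sum f I) = (\<Sum>i\<in>I. S (f i))"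
  by (rule lin_sum[OF vspace lin_antipode]) simp

lemma S_eq: "S x = S y \<Longrightarrow> x = y"
  using bij_S by (simp add: bij_is_inj inj_eq)

lemma lin_inv_S: "lin H H (inv S)"
  by (rule linI, simp) (rule S_eq, simp add: lin_add[OF lin_antipode] lin_scl[OF lin_antipode])+

text \<open>\<open>S\<close> is injective and reverses products: applied to the sum it gives \<Sum>
  S(r a b) r b c, to which the left antipode axiom for r a c applies. This is why the factors stand
  in the order opposite to a matrix product.\<close>

lemma sum_t_r:
  assumes "a \<in> B" "c \<in> B"
  shows "(\<Sum>b\<in>B. t b c * r a b) = (if a = c then 1 else 0)"
proof (rule S_eq)
  have "bilin H H H (\<lambda>x y. S x * y)" by (intro lin_intros hopf_lin; simp)
  from sw_r[OF assms(1) vspace this, of c]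
  have "(\<Sum>b\<in>B. S (r a b) * r b c) = scl H (\<epsilon> (r a c)) 1" by (simp add: sw_antipode_left)
  then show "S (\<Sum>b\<in>B. t b c * r a b) = S (if a = c then 1 else 0)"
    by (simp add: S_sum antipode_mult t_def counit_r assms antipode_one S_zero vspace_scl_one vspace_zero_scl)
qed

lemma sum_r_t:
  assumes "a \<in> B" "b \<in> B"
  shows "(\<Sum>c\<in>B. r c b * t a c) = (if a = b then 1 else 0)"
proof (rule S_eq)
  have "bilin H H H (\<lambda>x y. x * S y)" by (intro lin_intros hopf_lin; simp)
  from sw_r[OF assms(1) vspace this, of b]
  have "(\<Sum>c\<in>B. r a c * S (r c b)) = scl H (\<epsilon> (r a b)) 1" by (simp add: sw_antipode_right)
  then show "S (\<Sum>c\<in>B. r c b * t a c) = S (if a = b then 1 else 0)"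
    by (simp add: S_sum antipode_mult t_def counit_r assms antipode_one S_zero vspace_scl_one vspace_zero_scl)
qed

lemma counit_t: "a \<in> B \<Longrightarrow> b \<in> B \<Longrightarrow> \<epsilon> (t a b) = (if a = b then 1 else 0)"
  using counit_antipode[of "inv S (r a b)"] by (simp add: t_def counit_r)

text \<open>Both sides are inverse to the matrix \<open>\<Delta> (r c b)\<close>; the sum \<open>Z\<close> below is evaluated in two ways.\<close>

lemma sw_t:
  assumes a: "a \<in> B" and e: "e \<in> B" and U: "vspace U" and F: "bilin H H U F"
  shows "sw (t a e) F = (\<Sum>d\<in>B. F (t d e) (t a d))"
proof -
  note lF = lin_bilin_left[OF F] lin_bilin_right[OF F]
  note F1 = lin_sum[OF vspace bilin_left[OF F], symmetric] lin_sum[OF vspace bilin_right[OF F], symmetric]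
  have delta: "(\<Sum>i\<in>B. if j = i then g i else 0) = g j" "(\<Sum>i\<in>B. if i = j then g i else 0) = g j"
    if "j \<in> B" for j and g :: "'v \<Rightarrow> 'x::comm_monoid_add"
    using that fd.finite_Basis by simp_all
  \<comment> \<open>In the first evaluation \<open>sum_t_r\<close> collapses the sum over
    \<open>b\<close> to g = d and then the sum over \<open>d\<close> to c = e. In the second the sum
    over \<open>g\<close> is recognised as the coproduct of \<open>r c b\<close>, multiplied by that
    of \<open>t a c\<close>, and \<open>sum_r_t\<close> collapses the sum over
    \<open>c\<close>.\<close>
  define G where "G c d g x y = (\<Sum>b\<in>B. F (t d e * (r c g * x)) (t b d * (r g b * y)))" for c d g x y
  define Z where "Z = (\<Sum>c\<in>B. \<Sum>d\<in>B. \<Sum>g\<in>B. sw (t a c) (\<lambda>x y. G c d g x y))"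
  have "G c d g x y = (if g = d then F (t d e * r c d * x) y else 0)" if "d \<in> B" "g \<in> B" for c d g x y
  proof -
    have "G c d g x y = F (t d e * (r c g * x)) ((\<Sum>b\<in>B. t b d * r g b) * y)"
      unfolding G_def by (simp add: F1 sum_distrib_right mult.assoc)
    then show ?thesis
      by (simp add: sum_t_r that mult.assoc lin_zero[OF vspace bilin_right[OF F]])
  qed
  then have "Z = (\<Sum>c\<in>B. \<Sum>d\<in>B. sw (t a c) (\<lambda>x y. F (t d e * r c d * x) y))"
    unfolding Z_def by (intro sum.cong refl) (simp add: delta flip: tsum_sum)
  also have "\<dots> = (\<Sum>c\<in>B. sw (t a c) (\<lambda>x y. F ((\<Sum>d\<in>B. t d e * r c d) * x) y))"
    by (simp add: sum_distrib_right F1 flip: tsum_sum)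
  also have "\<dots> = (\<Sum>c\<in>B. if c = e then sw (t a c) F else 0)"
  proof (intro sum.cong refl)
    fix c assume "c \<in> B"
    then show "sw (t a c) (\<lambda>x y. F ((\<Sum>d\<in>B. t d e * r c d) * x) y) = (if c = e then sw (t a c) F else 0)"
      by (simp add: sum_t_r e lin_zero[OF vspace bilin_left[OF F]] tsum_def case_prod_unfold)
  qed
  also have "\<dots> = sw (t a e) F" using e fd.finite_Basis by simp
  finally have 1: "Z = sw (t a e) F" .
  define K where "K b d x y = F (t d e * x) (t b d * y)" for b d x y
  have K: "bilin H H U (K b d)" for b d unfolding K_def by (intro bilinI hopf_lin lF lin_id) simp_all
  have "Z = (\<Sum>c\<in>B. \<Sum>d\<in>B. \<Sum>b\<in>B. \<Sum>g\<in>B. sw (t a c) (\<lambda>x y. K b d (r c g * x) (r g b * y)))"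
    unfolding Z_def G_def tsum_sum K_def by (subst sum.swap) simp
  also have "\<dots> = (\<Sum>c\<in>B. \<Sum>d\<in>B. \<Sum>b\<in>B. sw (r c b * t a c) (K b d))"
  proof (intro sum.cong refl)
    fix c d b assume c: "c \<in> B"
    have "bilin H H U (\<lambda>p q. sw (t a c) (\<lambda>x y. K b d (p * x) (q * y)))"
      by (intro bilinI lin_tsum_param hopf_lin lin_bilin_left[OF K] lin_bilin_right[OF K] lin_id U) simp_all
    from sw_r[OF c U this, of b]
    show "(\<Sum>g\<in>B. sw (t a c) (\<lambda>x y. K b d (r c g * x) (r g b * y))) = sw (r c b * t a c) (K b d)"
      by (simp add: sw_mult[OF U K])
  qed
  also have "\<dots> = (\<Sum>d\<in>B. \<Sum>b\<in>B. \<Sum>c\<in>B. sw (r c b * t a c) (K b d))"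
    by (subst sum.swap) (intro sum.cong refl sum.swap)
  also have "\<dots> = (\<Sum>d\<in>B. \<Sum>b\<in>B. sw (\<Sum>c\<in>B. r c b * t a c) (K b d))"
  proof (intro sum.cong refl)
    fix d b
    have "lin H U (\<lambda>h. sw h (K b d))" by (intro lin_tsum_arg lin_comult K U) simp_all
    from lin_sum[OF vspace this, of B "\<lambda>c. r c b * t a c"]
    show "(\<Sum>c\<in>B. sw (r c b * t a c) (K b d)) = sw (\<Sum>c\<in>B. r c b * t a c) (K b d)" by simp
  qed
  also have "\<dots> = (\<Sum>d\<in>B. \<Sum>b\<in>B. if a = b then F (t d e) (t b d) else 0)"
  proof (intro sum.cong refl)
    fix d b assume "b \<in> B"
    moreover have "sw 1 (K b d) = F (t d e) (t b d)" by (simp add: sw_one[OF U K]) (simp add: K_def)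
    moreover have "sw 0 (K b d) = 0"
      by (rule lin_zero[OF vspace, of U]) (intro lin_tsum_arg lin_comult K U; simp)
    ultimately show "sw (\<Sum>c\<in>B. r c b * t a c) (K b d) = (if a = b then F (t d e) (t b d) else 0)"
      by (simp add: sum_r_t a)
  qed
  also have "\<dots> = (\<Sum>d\<in>B. F (t d e) (t a d))" using a fd.finite_Basis by simp
  finally show ?thesis using 1 by simp
qed

subsection \<open>Framings\<close>

abbreviation "is_bein \<equiv> bein M N\<^sub>M V"
abbreviation "is_framing \<equiv> framing M N\<^sub>M H \<Delta> Q V \<rho>"
abbreviation "to_framing \<equiv> framing_of_bein M N\<^sub>M H \<Delta> Q V \<rho>"
abbreviation "E \<equiv> E_space M H \<Delta> V \<rho>"
abbreviation "base \<equiv> base_forms M N\<^sub>M H \<Delta> Q"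

lemma delta:
  assumes "j \<in> B"
  shows "(\<Sum>i\<in>B. if j = i then g i else 0) = (g j :: 'x::comm_monoid_add)"
    and "(\<Sum>i\<in>B. if i = j then g i else 0) = g j"
  using assms fd.finite_Basis by simp_all

lemma vspace_base: "vspace base"
proof (rule vspace_fscaleI)
  have "lin M.\<Omega> PN incl" by (rule lin_restrict_dom[OF lin_ext M.forms_subset]) simp
  from lin_image_subspace[OF M.vspace_forms this vspace_PN]
  show "module.subspace fscale (car base)" by (simp add: car_base_forms)
qed (rule scl_base_forms)

sublocale Vc: matrix_coaction H \<Delta> \<epsilon> S Q M N\<^sub>M V B "\<lambda>b. b" fb \<rho> r
  by unfold_locales (simp_all add: V.lin_coaction coaction_basis comult_r counit_r)

lemma to_framing_eq: "to_framing = Vc.induced"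
  by (simp add: fun_eq_iff framing_of_bein_def Vc.induced_def)

lemmas to_framing_basis = Vc.induced_basis[folded to_framing_eq]
  and lin_to_framing = Vc.lin_induced[folded to_framing_eq]
  and to_framing_mem = Vc.induced_mem[folded to_framing_eq, OF _ mem_V]
  and lin_to_framing_ext_space = Vc.lin_induced_ext_space[folded to_framing_eq]
  and retract_to_framing = Vc.retract_induced[folded to_framing_eq, OF _ mem_V]
  and to_framing_equivariant = Vc.induced_equivariant[folded to_framing_eq, rule_format, OF _ mem_V]

lemma equivariant_is_to_framing:
  assumes "lin V ext_space \<theta>"
    and "\<forall>v. coact (\<theta> v) = tlift V H (PN \<otimes> H) (\<lambda>v0 v1. \<theta> v0 \<otimes>\<^bsub>PN,H\<^esub> v1) (\<rho> v)"
  shows "lin V M.\<Omega> (\<lambda>v. retract (\<theta> v))" and "to_framing (\<lambda>v. retract (\<theta> v)) = \<theta>"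
  using assms Vc.lin_retract_equivariant[of \<theta>] Vc.induced_retract[of \<theta>]
  by (simp_all add: to_framing_eq fun_eq_iff)

section \<open>Beins in coordinates\<close>

definition comb :: "('v \<Rightarrow> ('k, 'm) form) \<Rightarrow> ('v \<Rightarrow> 'm) \<Rightarrow> ('k, 'm) form" where
  "comb e m = (\<Sum>a\<in>B. lact M N\<^sub>M (m a) (e a))"

text \<open>Linearity and module linearity of s_e hold for every linear \<open>e\<close>, so
  bijectivity alone is left, and coordinates turn \<open>M \<otimes> V\<close> into families in
  \<open>M\<close>. The same criterion reappears in \<open>framing_iff\<close>.\<close>

lemma bein_iff:
  assumes "lin V M.\<Omega> e"
  shows "is_bein e \<longleftrightarrow> bij_betw (comb e) (B \<rightarrow>\<^sub>E UNIV) (car M.\<Omega>)"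
proof -
  let ?s = "tlift M V M.\<Omega> (\<lambda>m v. lact M N\<^sub>M m (e v))"
  note e = lin_mem[OF assms]
  have b: "bilin M V M.\<Omega> (\<lambda>m v. lact M N\<^sub>M m (e v))"
    by (intro bilinI M.lin_lact_param lin_compose[OF assms M.lin_lact_forms]) (simp add: e)
  note ls = tlift(1)[OF M.vspace_forms b] and s = tlift(2)[OF M.vspace_forms b]
  have b2: "bilin M V (M \<otimes> V) (\<lambda>m' v. (m * m') \<otimes>\<^bsub>M,V\<^esub> v)" for m
    by (intro lin_intros M.lin_mult_right; simp)
  have lm: "?s (tlift M V (M \<otimes> V) (\<lambda>m' v. (m * m') \<otimes>\<^bsub>M,V\<^esub> v) x) = lact M N\<^sub>M m (?s x)"
    if "x \<in> car (M \<otimes> V)" for m x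
    by (rule lin_tensor_ext[OF lin_compose[OF tlift(1)[OF vspace_tensor b2] ls]
          lin_compose[OF ls M.lin_lact_forms] refl _ that])
      (simp add: tlift(2)[OF vspace_tensor b2] s M.lact_lact e)
  have c: "?s (\<Sum>a\<in>B. m a \<otimes>\<^bsub>M,V\<^esub> a) = comb e m" for m
    by (simp add: comb_def lin_sum[OF vspace_tensor ls] s)
  have "is_bein e \<longleftrightarrow> bij_betw ?s (car (M \<otimes> V)) (car M.\<Omega>)"
    unfolding bein_def module_iso_def using assms ls lm by blast
  also have "\<dots> \<longleftrightarrow> bij_betw (comb e) (B \<rightarrow>\<^sub>E UNIV) (car M.\<Omega>)"
    using bij_betw_comp_iff[OF Vb.bij_tensor_coords[OF M.vspace], of ?s "car M.\<Omega>"]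
    by (simp add: comp_def c M.car_UNIV)
  finally show ?thesis .
qed

section \<open>The invariants in \<open>P \<otimes> V\<close>\<close>

definition diag_E :: "('k, ('k, 'm, 'h) tens, 'v) tens \<Rightarrow> ('k, ('k, ('k, 'm, 'h) tens, 'v) tens, 'h) tens" where
  "diag_E = tlift P V ((P \<otimes> V) \<otimes> H) (\<lambda>p v.
     tlift P H ((P \<otimes> V) \<otimes> H) (\<lambda>p0 p1.
       tlift V H ((P \<otimes> V) \<otimes> H) (\<lambda>v0 v1. (p0 \<otimes>\<^bsub>P,V\<^esub> v0) \<otimes>\<^bsub>P \<otimes> V,H\<^esub> (p1 * v1)) (\<rho> v))
     (coactP p))"

lemma
  shows lin_diag_E: "lin (P \<otimes> V) ((P \<otimes> V) \<otimes> H) diag_E"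
    and diag_E_basis: "diag_E ((m \<bullet> g) \<otimes>\<^bsub>P,V\<^esub> b)
      = (\<Sum>a\<in>B. sw g (\<lambda>x y. ((m \<bullet> x) \<otimes>\<^bsub>P,V\<^esub> a) \<otimes>\<^bsub>P \<otimes> V,H\<^esub> (y * r a b)))"
proof -
  let ?U = "(P \<otimes> V) \<otimes> H"
  note U = vspace_tensor[of "P \<otimes> V" H]
  define T where "T p0 p1 v0 v1 = (p0 \<otimes>\<^bsub>P,V\<^esub> v0) \<otimes>\<^bsub>P \<otimes> V,H\<^esub> (p1 * v1)" for p0 p1 v0 v1
  have T1: "bilin V H ?U (T p0 p1)" if "p0 \<in> car P" for p0 p1
    unfolding T_def using that by (intro lin_intros hopf_lin; simp)
  have lT: "lin P ?U (\<lambda>p0. T p0 p1 v0 v1)" for p1 v0 v1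
    unfolding T_def by (intro lin_intros; simp)
  have lT': "lin H ?U (\<lambda>p1. T p0 p1 v0 v1)" if "p0 \<in> car P" for p0 v0 v1
    unfolding T_def using that by (intro lin_intros hopf_lin; simp)
  have T2: "bilin P H ?U (\<lambda>p0 p1. tlift V H ?U (T p0 p1) (\<rho> v))" for v
    by (intro bilinI lin_tlift_param U T1 lT lT' vspace vspace_tensor lin_mem[OF V.lin_coaction]) simp_all
  have T3: "bilin P V ?U (\<lambda>p v. tlift P H ?U (\<lambda>p0 p1. tlift V H ?U (T p0 p1) (\<rho> v)) (coactP p))"
    by (rule bilinI, rule lin_tlift_param[OF U vspace_V lin_mem[OF lin_coactP] T2
          lin_tlift_arg[OF U V.lin_coaction T1]], assumption+)
      (rule lin_tlift_arg[OF U lin_coactP T2])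
  have eq: "diag_E = tlift P V ?U (\<lambda>p v. tlift P H ?U (\<lambda>p0 p1. tlift V H ?U (T p0 p1) (\<rho> v)) (coactP p))"
    by (simp add: diag_E_def T_def[abs_def])
  show "lin (P \<otimes> V) ?U diag_E" unfolding eq by (rule tlift(1)[OF U T3])
  have "diag_E ((m \<bullet> g) \<otimes>\<^bsub>P,V\<^esub> b)
      = tlift P H ?U (\<lambda>p0 p1. tlift V H ?U (T p0 p1) (\<rho> b)) (coactP (m \<bullet> g))"
    unfolding eq by (rule tlift(2)[OF U T3]) simp_all
  also have "\<dots> = sw g (\<lambda>x y. tlift V H ?U (T (m \<bullet> x) y) (\<rho> b))"
    unfolding coactP_tns
    by (simp add: lin_tsum[OF tlift(1)[OF U T2]] tlift(2)[OF U T2])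
  also have "\<dots> = sw g (\<lambda>x y. \<Sum>a\<in>B. T (m \<bullet> x) y a (r a b))"
    by (simp add: tlift_coaction[OF U T1])
  finally show "diag_E ((m \<bullet> g) \<otimes>\<^bsub>P,V\<^esub> b)
      = (\<Sum>a\<in>B. sw g (\<lambda>x y. ((m \<bullet> x) \<otimes>\<^bsub>P,V\<^esub> a) \<otimes>\<^bsub>P \<otimes> V,H\<^esub> (y * r a b)))"
    by (simp add: tsum_sum T_def)
qed

lemma car_E: "car E = {x \<in> car (P \<otimes> V). diag_E x = x \<otimes>\<^bsub>P \<otimes> V,H\<^esub> 1}"
  by (simp add: E_space_def diag_E_def)

lemma E_subset: "car E \<subseteq> car (P \<otimes> V)"
  by (auto simp: car_E)

text \<open>The isomorphism \<open>M \<otimes> V \<rightarrow> (P \<otimes> V)\<^sup>H\<close> is \<open>m \<otimes> v \<mapsto> m \<otimes> S\<^sup>-\<^sup>1 v\<^sub>[\<^sub>1\<^sub>] \<otimes> v\<^sub>[\<^sub>0\<^sub>]\<close>.\<close>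

definition E_param :: "('v \<Rightarrow> 'm) \<Rightarrow> ('k, ('k, 'm, 'h) tens, 'v) tens" where
  "E_param m = (\<Sum>b\<in>B. (\<Sum>a\<in>B. m a \<bullet> t b a) \<otimes>\<^bsub>P,V\<^esub> b)"

lemma E_param_coeff_mem: "(\<Sum>a\<in>B. m a \<bullet> t b a) \<in> car P"
  by (intro vspace_sum vspace_tensor tns_mem) simp_all

lemma E_param_expand: "E_param m = (\<Sum>b\<in>B. \<Sum>a\<in>B. (m a \<bullet> t b a) \<otimes>\<^bsub>P,V\<^esub> b)"
  by (simp add: E_param_def lin_sum[OF vspace_tensor bilin_left[OF bilin_tns[of P V]]])

lemma E_param_mem: "E_param m \<in> car (P \<otimes> V)"
  unfolding E_param_def by (intro vspace_sum vspace_tensor tns_mem E_param_coeff_mem) simp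

text \<open>The coproduct of t b a leaves t b d beside r a' b in the coacted leg; by
  \<open>sum_t_r\<close> the sum over \<open>b\<close> is 1 for d = a' and 0 otherwise.\<close>

lemma E_param_in_E: "E_param m \<in> car E"
proof -
  let ?U = "(P \<otimes> V) \<otimes> H"
  have b: "bilin H H ?U (\<lambda>x y. ((m a \<bullet> x) \<otimes>\<^bsub>P,V\<^esub> a') \<otimes>\<^bsub>P \<otimes> V,H\<^esub> (y * r a' b))" for a a' b
    by (intro lin_intros hopf_lin; simp)
  have mem: "(m a \<bullet> h) \<otimes>\<^bsub>P,V\<^esub> a' \<in> car (P \<otimes> V)" for a a' h by (simp)
  have "diag_E (E_param m) = (\<Sum>b\<in>B. \<Sum>a\<in>B. \<Sum>a'\<in>B. \<Sum>d\<in>B.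
      ((m a \<bullet> t d a) \<otimes>\<^bsub>P,V\<^esub> a') \<otimes>\<^bsub>P \<otimes> V,H\<^esub> (t b d * r a' b))"
    unfolding E_param_expand
    by (simp add: lin_sum[OF vspace_tensor lin_diag_E] vspace_sum mem diag_E_basis sw_t[OF _ _ vspace_tensor b])
  also have "\<dots> = (\<Sum>a\<in>B. \<Sum>a'\<in>B. \<Sum>d\<in>B. \<Sum>b\<in>B.
      ((m a \<bullet> t d a) \<otimes>\<^bsub>P,V\<^esub> a') \<otimes>\<^bsub>P \<otimes> V,H\<^esub> (t b d * r a' b))"
    by (rule sum_rotate4)
  also have "\<dots> = (\<Sum>a\<in>B. \<Sum>a'\<in>B. \<Sum>d\<in>B.
      ((m a \<bullet> t d a) \<otimes>\<^bsub>P,V\<^esub> a') \<otimes>\<^bsub>P \<otimes> V,H\<^esub> (\<Sum>b\<in>B. t b d * r a' b))"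
    by (simp add: lin_sum[OF vspace bilin_right[OF bilin_tns[of "P \<otimes> V" H]]] mem)
  also have "\<dots> = (\<Sum>a\<in>B. \<Sum>a'\<in>B. ((m a \<bullet> t a' a) \<otimes>\<^bsub>P,V\<^esub> a') \<otimes>\<^bsub>P \<otimes> V,H\<^esub> 1)"
  proof (intro sum.cong refl)
    fix a a' assume a': "a' \<in> B"
    have "(\<Sum>d\<in>B. ((m a \<bullet> t d a) \<otimes>\<^bsub>P,V\<^esub> a') \<otimes>\<^bsub>P \<otimes> V,H\<^esub> (\<Sum>b\<in>B. t b d * r a' b))
        = (\<Sum>d\<in>B. if a' = d then ((m a \<bullet> t d a) \<otimes>\<^bsub>P,V\<^esub> a') \<otimes>\<^bsub>P \<otimes> V,H\<^esub> 1 else 0)"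
      by (intro sum.cong refl)
        (simp add: sum_t_r a' lin_zero[OF vspace bilin_right[OF bilin_tns[of "P \<otimes> V" H] mem]])
    then show "(\<Sum>d\<in>B. ((m a \<bullet> t d a) \<otimes>\<^bsub>P,V\<^esub> a') \<otimes>\<^bsub>P \<otimes> V,H\<^esub> (\<Sum>b\<in>B. t b d * r a' b))
        = ((m a \<bullet> t a' a) \<otimes>\<^bsub>P,V\<^esub> a') \<otimes>\<^bsub>P \<otimes> V,H\<^esub> 1" by (simp add: delta a')
  qed
  also have "\<dots> = E_param m \<otimes>\<^bsub>P \<otimes> V,H\<^esub> 1"
    unfolding E_param_expand
    by (subst sum.swap)
      (simp add: lin_sum[OF vspace_tensor bilin_left[OF bilin_tns[of "P \<otimes> V" H]]] mem vspace_sum)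
  finally show ?thesis by (simp add: car_E E_param_mem)
qed

lemma fibre_counit_coeff:
  assumes "b \<in> B"
  shows "fibre_counit (\<Sum>a\<in>B. m a \<bullet> t b a) = m b"
proof -
  have "fibre_counit (\<Sum>a\<in>B. m a \<bullet> t b a) = (\<Sum>a\<in>B. if b = a then m a else 0)"
    by (simp add: lin_sum[OF vspace_tensor lin_fibre_counit] fibre_counit_tns counit_t assms
        vspace_scl_one vspace_zero_scl if_distrib[of "\<lambda>c. scl M c _"] cong: if_cong)
  then show ?thesis by (simp add: delta assms)
qed

lemma E_param_rcoord: "b \<in> B \<Longrightarrow> fibre_counit (Vb.rcoord P b (E_param m)) = m b"
  unfolding E_param_def
  by (simp add: Vb.rcoord_sum[OF vspace_tensor] E_param_coeff_mem fibre_counit_coeff)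

text \<open>The map \<open>L\<close> multiplies the coacted leg by entries of \<open>t\<close>,
  which cancel the entries of \<open>r\<close> created by the coaction. So \<open>L\<close> after
  \<open>diag_E\<close> is the coordinate at \<open>c\<close>, while on z \<otimes> 1 it yields the
  right-hand side; invariance equates the two.\<close>

lemma E_coords:
  assumes z: "z \<in> car E" and c: "c \<in> B"
  shows "Vb.rcoord P c z = (\<Sum>a\<in>B. fibre_counit (Vb.rcoord P a z) \<bullet> t c a)"
proof -
  have zP: "z \<in> car (P \<otimes> V)" and inv: "diag_E z = z \<otimes>\<^bsub>P \<otimes> V,H\<^esub> 1"
    using z by (auto simp: car_E)
  define L where "L = tlift (P \<otimes> V) H P
    (\<lambda>z h. \<Sum>a\<in>B. fibre_counit (Vb.rcoord P a z) \<bullet> (h * t c a))"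
  have b: "bilin (P \<otimes> V) H P (\<lambda>z h. \<Sum>a\<in>B. fibre_counit (Vb.rcoord P a z) \<bullet> (h * t c a))"
    by (intro bilinI lin_sum_pointwise lin_tns_left lin_tns_right vspace_tensor vspace
        lin_compose[OF Vb.lin_rcoord lin_fibre_counit] hopf_lin lin_id) simp_all
  note lL = tlift(1)[OF vspace_tensor b, folded L_def] and L = tlift(2)[OF vspace_tensor b, folded L_def]
  have Lb: "L ((p \<otimes>\<^bsub>P,V\<^esub> b) \<otimes>\<^bsub>P \<otimes> V,H\<^esub> h) = fibre_counit p \<bullet> (h * t c b)"
    if "p \<in> car P" "b \<in> B" for p b h
  proof -
    have "L ((p \<otimes>\<^bsub>P,V\<^esub> b) \<otimes>\<^bsub>P \<otimes> V,H\<^esub> h)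
        = (\<Sum>a\<in>B. if a = b then fibre_counit p \<bullet> (h * t c a) else 0)"
      unfolding L[OF tns_mem[OF that(1) mem_V] mem_car]
    proof (intro sum.cong refl)
      fix a assume a: "a \<in> B"
      have "0 \<bullet> (h * t c a) = 0"
        by (rule lin_zero[OF M.vspace bilin_left[OF bilin_tns]]) simp
      then show "fibre_counit (Vb.rcoord P a (p \<otimes>\<^bsub>P,V\<^esub> b)) \<bullet> (h * t c a)
          = (if a = b then fibre_counit p \<bullet> (h * t c a) else 0)"
        using a that vspace_scl_one[OF vspace_tensor, of M H p] vspace_zero_scl[OF vspace_tensor, of M H p]
        by (simp add: Vb.rcoord_tns[OF vspace_tensor] fb_basis lin_zero[OF vspace_tensor lin_fibre_counit])
    qed
    then show ?thesis by (simp add: delta that)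
  qed
  \<comment> \<open>By \<open>sum_r_t\<close> the cancellation leaves a Kronecker delta, and the
    counit axiom restores the fibre component of \<open>p\<close>.\<close>
  have D: "L (diag_E (p \<otimes>\<^bsub>P,V\<^esub> b)) = (if c = b then p else 0)" if p: "p \<in> car P" and bB: "b \<in> B" for p b
  proof (rule lin_tensor_ext[OF lin_compose[OF lin_compose[OF bilin_left[OF bilin_tns mem_V] lin_diag_E] lL] _ refl _ p])
    show "lin P P (\<lambda>p. if c = b then p else 0)"
      by (cases "c = b") (simp_all add: lin_id lin_const_zero)
    fix m g
    note lm = bilin_right[OF bilin_tns M.mem_car, of H m]
    have "L (diag_E ((m \<bullet> g) \<otimes>\<^bsub>P,V\<^esub> b))
        = (\<Sum>a\<in>B. sw g (\<lambda>x y. scl M (\<epsilon> x) m \<bullet> (y * (r a b * t c a))))"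
      by (simp add: diag_E_basis lin_sum[OF vspace_tensor lL] lin_tsum[OF lL] Lb
          fibre_counit_tns mult.assoc)
    also have "\<dots> = sw g (\<lambda>x y. scl M (\<epsilon> x) m \<bullet> (y * (\<Sum>a\<in>B. r a b * t c a)))"
      by (simp add: sum_distrib_left lin_sum[OF vspace bilin_right[OF bilin_tns[of M H]]] flip: tsum_sum)
    also have "\<dots> = sw g (\<lambda>x y. m \<bullet> scl H (\<epsilon> x) (y * (if c = b then 1 else 0)))"
      using lin_scl[OF lm] by (simp add: sum_r_t c bB scl_tns[symmetric])
    also have "\<dots> = (if c = b then m \<bullet> g else 0)"
    proof (cases "c = b")
      case False
      then show ?thesis by (simp add: vspace_scl_zero lin_zero[OF vspace lm] tsum_def case_prod_unfold)
    qed (simp add: lin_tsum_H[OF lm] sw_counit_left)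
    finally show "L (diag_E ((m \<bullet> g) \<otimes>\<^bsub>P,V\<^esub> b)) = (if c = b then m \<bullet> g else 0)" .
  qed
  have mem: "Vb.rcoord P b z \<in> car P" if "b \<in> B" for b
    using that zP lin_mem[OF Vb.lin_rcoord[OF vspace_tensor]] by blast
  have "L (diag_E z) = (\<Sum>b\<in>B. L (diag_E (Vb.rcoord P b z \<otimes>\<^bsub>P,V\<^esub> b)))"
    by (subst Vb.tensor_expand[OF vspace_tensor zP])
      (simp add: lin_sum[OF vspace_tensor lin_compose[OF lin_diag_E lL]] mem)
  also have "\<dots> = Vb.rcoord P c z" by (simp add: D mem delta c)
  finally have "Vb.rcoord P c z = L (z \<otimes>\<^bsub>P \<otimes> V,H\<^esub> 1)" by (simp add: inv)
  then show ?thesis by (simp add: L zP)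
qed

lemma bij_E_param: "bij_betw E_param (B \<rightarrow>\<^sub>E UNIV) (car E)"
proof (rule bij_betw_byWitness[where f' = "\<lambda>z. restrict (\<lambda>b. fibre_counit (Vb.rcoord P b z)) B"])
  show "\<forall>m\<in>B \<rightarrow>\<^sub>E UNIV. restrict (\<lambda>b. fibre_counit (Vb.rcoord P b (E_param m))) B = m"
    by (intro ballI extensionalityI[where A = B]) (auto simp: E_param_rcoord PiE_def)
  show "\<forall>z\<in>car E. E_param (restrict (\<lambda>b. fibre_counit (Vb.rcoord P b z)) B) = z"
  proof
    fix z assume z: "z \<in> car E"
    have "E_param (restrict (\<lambda>b. fibre_counit (Vb.rcoord P b z)) B) = (\<Sum>b\<in>B. Vb.rcoord P b z \<otimes>\<^bsub>P,V\<^esub> b)"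
      using E_coords[OF z] by (simp add: E_param_def)
    also have "\<dots> = z"
      using Vb.tensor_expand[OF vspace_tensor subsetD[OF E_subset z]] by simp
    finally show "E_param (restrict (\<lambda>b. fibre_counit (Vb.rcoord P b z)) B) = z" .
  qed
qed (auto simp: E_param_in_E)

lemma comb_mem: "lin V M.\<Omega> e \<Longrightarrow> comb e m \<in> car M.\<Omega>"
  unfolding comb_def by (intro vspace_sum M.vspace_forms M.lact_forms) (simp add: lin_mem[of V M.\<Omega> e])

text \<open>All conditions but bijectivity hold for any linear \<open>e\<close>. Bijectivity is
  transported along two bijections, \<open>E_param\<close> on the source and \<open>incl\<close> on
  the target.\<close>

lemma framing_iff:
  assumes "lin V M.\<Omega> e"
  shows "is_framing (to_framing e) \<longleftrightarrow> bij_betw (comb e) (B \<rightarrow>\<^sub>E UNIV) (car M.\<Omega>)"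
proof -
  let ?\<theta> = "to_framing e"
  let ?s = "tlift P V PN (\<lambda>p v. lactP p (?\<theta> v))"
  note e = lin_mem[OF assms] and e' = form_mem[OF lin_mem[OF assms]]
  note l\<theta> = lin_to_framing[OF assms] and \<theta> = to_framing_mem[OF assms]
  have \<theta>': "?\<theta> v \<in> car PN" for v using \<theta> ext_space_subset by blast
  have b: "bilin P V PN (\<lambda>p v. lactP p (?\<theta> v))"
    by (intro bilinI lin_lactP_param \<theta>' lin_compose[OF l\<theta> lin_lactP])
  note ls = tlift(1)[OF vspace_PN b] and s = tlift(2)[OF vspace_PN b]
  have s_param: "?s (E_param m) = incl (comb e m)" for m
  proof -
    note la = form_mem[OF M.lact_forms[OF e]]
    have "?s (E_param m) = (\<Sum>b\<in>B. \<Sum>a\<in>B. lactP (m a \<bullet> t b a) (?\<theta> b))"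
      unfolding E_param_expand
      by (simp add: lin_sum[OF vspace_tensor ls] vspace_sum s)
    also have "\<dots> = (\<Sum>b\<in>B. \<Sum>a\<in>B. \<Sum>c\<in>B. ext (lact M N\<^sub>M (m a) (e c)) (t b a * r c b) 1)"
      by (simp add: to_framing_basis[OF assms] lin_sum[OF vspace_PN lin_lactP] ext_mem e' lactP_ext)
    also have "\<dots> = (\<Sum>a\<in>B. \<Sum>c\<in>B. ext (lact M N\<^sub>M (m a) (e c)) (\<Sum>b\<in>B. t b a * r c b) 1)"
      by (subst sum_rotate3) (simp add: lin_sum[OF vspace lin_ext_left] la)
    also have "\<dots> = (\<Sum>a\<in>B. \<Sum>c\<in>B. if c = a then incl (lact M N\<^sub>M (m a) (e c)) else 0)"
      by (intro sum.cong refl) (simp add: sum_t_r lin_zero[OF vspace lin_ext_left] la)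
    also have "\<dots> = incl (comb e m)"
      unfolding comb_def by (simp add: delta lin_sum[OF M.vspace_AA_N lin_ext] la)
    finally show ?thesis .
  qed
  have bt: "bilin P V (P \<otimes> V) (\<lambda>p v. tmult M H (m \<bullet> 1) p \<otimes>\<^bsub>P,V\<^esub> v)" for m
    by (intro bilinI lin_tns_left lin_tns_right bilin_right[OF bilin_tmult] tmult_mem tns_mem vspace_tensor lin_id)
      simp_all
  have mod: "?s (tlift P V (P \<otimes> V) (\<lambda>p v. tmult M H (m \<bullet> 1) p \<otimes>\<^bsub>P,V\<^esub> v) x) = lactP (m \<bullet> 1) (?s x)"
    if "x \<in> car (P \<otimes> V)" for m x
  proof -
    have "m \<bullet> 1 \<in> car P" by (simp)
    then show ?thesis
      by (intro lin_tensor_ext[OF lin_compose[OF tlift(1)[OF vspace_tensor bt] ls]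
            lin_compose[OF ls lin_lactP] refl _ that])
        (simp_all add: tlift(2)[OF vspace_tensor bt] s tmult_mem lactP_tmult \<theta>)
  qed
  have range: "?s x \<in> car base" if "x \<in> car E" for x
  proof -
    have "x \<in> E_param ` (B \<rightarrow>\<^sub>E UNIV)" using that by (simp only: bij_betw_imp_surj_on[OF bij_E_param])
    then obtain m where "x = E_param m" by (rule imageE)
    then show ?thesis by (simp add: s_param car_base_forms comb_mem assms)
  qed
  have "lin E base ?s"
  proof (rule linI)
    have "scl E = fscale" by (simp add: E_space_def)
    then show "?s (scl E c x) = scl base c (?s x)" if "x \<in> car E" for c x
      using lin_scl[OF ls subsetD[OF E_subset that]] by (simp add: scl_base_forms)
  qed (use range lin_add[OF ls] E_subset in \<open>auto simp: subset_iff\<close>)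
  then have "is_framing ?\<theta> \<longleftrightarrow> bij_betw ?s (car E) (car base)"
    unfolding framing_def module_iso_def P_forms_eq
    using lin_to_framing_ext_space[OF assms] to_framing_equivariant[OF assms] mod E_subset by blast
  also have "\<dots> \<longleftrightarrow> bij_betw (incl \<circ> comb e) (B \<rightarrow>\<^sub>E UNIV) (car base)"
    using bij_betw_comp_iff[OF bij_E_param, of ?s "car base"] by (simp add: comp_def s_param)
  also have "\<dots> \<longleftrightarrow> bij_betw (comb e) (B \<rightarrow>\<^sub>E UNIV) (car M.\<Omega>)"
    using bij_betw_comp_iff2[OF bij_incl image_subsetI, of "B \<rightarrow>\<^sub>E UNIV" "comb e"]
    by (simp add: car_base_forms comb_mem assms)
  finally show ?thesis .
qed

text \<open>That the retraction of a framing is a bein needs no further look at the invariants: the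
  framing is \<open>to_framing\<close> of it, and both criteria are bijectivity of the same
  \<open>comb\<close>.\<close>

lemma bij_to_framing: "bij_betw to_framing {e. is_bein e} {\<theta>. is_framing \<theta>}"
proof (rule bij_betw_byWitness[where f' = "\<lambda>\<theta> v. retract (\<theta> v)"])
  have lin: "lin V M.\<Omega> e" if "is_bein e" for e using that by (simp add: bein_def)
  show "\<forall>e\<in>{e. is_bein e}. (\<lambda>v. retract (to_framing e v)) = e"
    by (simp add: retract_to_framing lin)
  have equi: "lin V ext_space \<theta>"
      "\<forall>v. coact (\<theta> v) = tlift V H (PN \<otimes> H) (\<lambda>v0 v1. \<theta> v0 \<otimes>\<^bsub>PN,H\<^esub> v1) (\<rho> v)"
    if "is_framing \<theta>" for \<theta> using that by (auto simp: framing_def P_forms_eq)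
  note inverse = equivariant_is_to_framing[OF equi]
  show "\<forall>\<theta>\<in>{\<theta>. is_framing \<theta>}. to_framing (\<lambda>v. retract (\<theta> v)) = \<theta>"
    by (simp add: inverse)
  show "to_framing ` {e. is_bein e} \<subseteq> {\<theta>. is_framing \<theta>}"
    using lin bein_iff framing_iff by auto
  show "(\<lambda>\<theta> v. retract (\<theta> v)) ` {\<theta>. is_framing \<theta>} \<subseteq> {e. is_bein e}"
  proof clarify
    fix \<theta> assume \<theta>: "is_framing \<theta>"
    then have "is_framing (to_framing (\<lambda>v. retract (\<theta> v)))" by (simp add: inverse)
    then show "is_bein (\<lambda>v. retract (\<theta> v))"
      using bein_iff[OF inverse(1)[OF \<theta> \<theta>]] framing_iff[OF inverse(1)[OF \<theta> \<theta>]] by blast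
  qed
qed

subsection \<open>Coframings\<close>

abbreviation "is_cobein \<equiv> cobein M N\<^sub>M V"
abbreviation "is_coframing \<equiv> coframing M N\<^sub>M H \<Delta> S Q V \<rho> B"
abbreviation "to_coframing \<equiv> coframing_of_cobein M N\<^sub>M H \<Delta> S Q V \<rho>"
abbreviation "coactD \<equiv> dual_coaction H S V \<rho>"
abbreviation "ED \<equiv> E_dual_space M H \<Delta> V \<rho>"

text \<open>As S^-1 reverses coproducts, it is the transpose of \<open>t\<close> that comultiplies
  like a matrix coaction; hence the swapped indices in the instance for
  \<open>dual V\<close>.\<close>

lemma comult_t: "a \<in> B \<Longrightarrow> e \<in> B \<Longrightarrow> \<Delta> (t a e) = (\<Sum>d\<in>B. t d e \<odot> t a d)"
  using sw_t[OF _ _ vspace_tensor bilin_tns] by (simp add: tsum_self)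

text \<open>Tested at v = b, the defining condition prescribes the coordinate of the unknown along
  \<open>fb b\<close>. Coordinates determine a tensor, which gives existence and uniqueness for the
  description operator.\<close>

lemma dual_coaction_eq:
  assumes w: "w \<in> car (dual V)"
  shows "coactD w = (\<Sum>b\<in>B. fb b \<otimes>\<^bsub>dual V,H\<^esub> (\<Sum>a\<in>B. scl H (w a) (t a b)))" (is "_ = ?x")
proof -
  let ?D = "dual V"
  have lw: "lin V gnd w" using w by (simp add: car_dual)
  have bV: "bilin V H H (\<lambda>v0 v1. scl H (w v0) (inv S v1))"
    by (intro lin_intros lw lin_inv_S; simp)
  have bD: "bilin ?D H H (\<lambda>w0 w1. scl H (w0 v) w1)" for v
  proof (intro lin_intros vspace)
    show "lin ?D gnd (\<lambda>w0. w0 v)" by (auto simp: lin_def gnd_def fscale_def plus_fun_apply)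
  qed
  have lv: "lin V H (\<lambda>v. tlift ?D H H (\<lambda>w0 w1. scl H (w0 v) w1) x)" if "x \<in> car (?D \<otimes> H)" for x
  proof (rule lin_tlift_param[OF vspace vspace_V that bD])
    show "lin V H (\<lambda>v. scl H (w0 v) w1)" if "w0 \<in> car ?D" for w0 w1
      using that by (intro lin_scl_left) (simp_all add: car_dual)
  qed
  let ?P = "\<lambda>x. x \<in> car (?D \<otimes> H) \<and> (\<forall>v. tlift ?D H H (\<lambda>w0 w1. scl H (w0 v) w1) x
           = tlift V H H (\<lambda>v0 v1. scl H (w v0) (inv S v1)) (\<rho> v))"
  have rhs: "tlift V H H (\<lambda>v0 v1. scl H (w v0) (inv S v1)) (\<rho> b) = (\<Sum>a\<in>B. scl H (w a) (t a b))" for b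
    by (simp add: tlift_coaction[OF vspace bV] t_def)
  have mem: "?x \<in> car (?D \<otimes> H)"
    by (intro vspace_sum vspace_tensor tns_mem) simp_all
  have "?P ?x"
  proof (intro conjI mem allI)
    fix v
    show "tlift ?D H H (\<lambda>w0 w1. scl H (w0 v) w1) ?x = tlift V H H (\<lambda>v0 v1. scl H (w v0) (inv S v1)) (\<rho> v)"
    proof (rule Vb.lin_basis_ext[OF lv[OF mem] lin_compose[OF V.lin_coaction tlift(1)[OF vspace bV]] refl _ mem_V])
      fix b assume "b \<in> B"
      then show "tlift ?D H H (\<lambda>w0 w1. scl H (w0 b) w1) ?x
          = tlift V H H (\<lambda>v0 v1. scl H (w v0) (inv S v1)) (\<rho> b)"
        unfolding rhs by (intro Db.lcoord_sum[OF vspace, unfolded Db.lcoord_def]) simp_all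
    qed
  qed
  moreover have "x = ?x" if "?P x" for x
    using that Db.tensor_expand_left[OF vspace, of x] by (simp add: Db.lcoord_def rhs)
  ultimately show ?thesis unfolding dual_coaction_def by (intro the_equality) blast+
qed

lemma lin_dual_coaction: "lin (dual V) (dual V \<otimes> H) coactD"
proof -
  have "lin (dual V) (dual V \<otimes> H) (\<lambda>w. \<Sum>b\<in>B. fb b \<otimes>\<^bsub>dual V,H\<^esub> (\<Sum>a\<in>B. scl H (w a) (t a b)))"
    by (intro lin_sum_pointwise lin_tns_right lin_scl_left Db.lin_coord vspace_tensor vspace vspace_dual) simp_all
  then show ?thesis by (subst lin_cong[OF vspace_dual]) (simp_all add: dual_coaction_eq)
qed

lemma dual_coaction_basis:
  assumes "a \<in> B"
  shows "coactD (fb a) = (\<Sum>b\<in>B. fb b \<otimes>\<^bsub>dual V,H\<^esub> t a b)"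
proof -
  have "(\<Sum>a'\<in>B. scl H (fb a a') (t a' b)) = (\<Sum>a'\<in>B. if a = a' then t a' b else 0)" for b
    by (intro sum.cong refl) (simp add: fb_basis assms vspace_scl_one vspace_zero_scl)
  then show ?thesis by (simp add: dual_coaction_eq delta assms)
qed

sublocale Dc: matrix_coaction H \<Delta> \<epsilon> S Q M N\<^sub>M "dual V" B fb "\<lambda>b w. w b" coactD "\<lambda>b a. t a b"
  by unfold_locales (simp_all add: lin_dual_coaction dual_coaction_basis comult_t counit_t eq_commute)

text \<open>The coframing carries the coacted element in the second fibre leg and
  \<open>induced\<close> in the first. On base forms the two agree by \<open>ext_mult_left\<close>,
  so the results for \<open>induced\<close> apply to coframings as well.\<close>

lemma to_coframing_apply:
  assumes e: "lin (dual V) M.\<Omega> e'" and w: "w \<in> car (dual V)"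
  shows "to_coframing e' w = Dc.induced e' w"
proof -
  have b: "bilin (dual V) H PN (\<lambda>w0 w1. ext (e' w0) 1 w1)"
  proof (rule bilinI)
    have "lin (dual V) M.AA_N e'" by (rule lin_weaken[OF e M.forms_subset]) simp
    then show "lin (dual V) PN (\<lambda>v. ext (e' v) 1 h)" for h by (rule lin_compose[OF _ lin_ext])
    show "lin H PN (\<lambda>h. ext (e' v) 1 h)" if "v \<in> car (dual V)" for v
      by (rule lin_ext_right) (simp add: form_mem lin_mem[OF e that])
  qed
  have "to_coframing e' w = tlift (dual V) H PN (\<lambda>w0 w1. ext (e' w0) 1 w1) (coactD w)"
    using w by (simp add: coframing_of_cobein_def)
  also have "\<dots> = Dc.induced e' w"
    unfolding Dc.induced_def
  proof (rule lin_tensor_ext[OF tlift(1)[OF vspace_PN b] tlift(1)[OF vspace_PN Dc.bilin_induced[OF e]] refl])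
    fix v h assume v: "v \<in> car (dual V)"
    have "ext (e' v) 1 h = ext (e' v) h 1"
      using ext_mult_left[OF lin_mem[OF e v], of 1 h] by simp
    then show "tlift (dual V) H PN (\<lambda>w0 w1. ext (e' w0) 1 w1) (v \<otimes>\<^bsub>dual V,H\<^esub> h)
        = tlift (dual V) H PN (\<lambda>x0 x1. ext (e' x0) x1 1) (v \<otimes>\<^bsub>dual V,H\<^esub> h)"
      by (simp add: tlift(2)[OF vspace_PN b] tlift(2)[OF vspace_PN Dc.bilin_induced[OF e]] v)
  qed (simp add: lin_mem[OF lin_dual_coaction w])
  finally show ?thesis .
qed

definition cocomb :: "(('v \<Rightarrow> 'k) \<Rightarrow> ('k, 'm) form) \<Rightarrow> ('v \<Rightarrow> 'm) \<Rightarrow> ('k, 'm) form" where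
  "cocomb e' m = (\<Sum>a\<in>B. ract M N\<^sub>M (e' (fb a)) (m a))"

lemma cobein_iff:
  assumes l: "lin (dual V) M.\<Omega> e'" and x: "e' \<in> extensional (car (dual V))"
  shows "is_cobein e' \<longleftrightarrow> bij_betw (cocomb e') (B \<rightarrow>\<^sub>E UNIV) (car M.\<Omega>)"
proof -
  let ?D = "dual V"
  let ?s = "tlift ?D M M.\<Omega> (\<lambda>w m. ract M N\<^sub>M (e' w) m)"
  note e = lin_mem[OF l]
  have b: "bilin ?D M M.\<Omega> (\<lambda>w m. ract M N\<^sub>M (e' w) m)"
    by (intro bilinI M.lin_ract_param lin_compose[OF l M.lin_ract_forms]) (simp add: e)
  note ls = tlift(1)[OF M.vspace_forms b] and s = tlift(2)[OF M.vspace_forms b]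
  have b2: "bilin ?D M (?D \<otimes> M) (\<lambda>w m'. w \<otimes>\<^bsub>?D,M\<^esub> (m' * m))" for m
    by (intro lin_intros M.lin_mult_left; simp add: vspace_dual)
  have lm: "?s (tlift ?D M (?D \<otimes> M) (\<lambda>w m'. w \<otimes>\<^bsub>?D,M\<^esub> (m' * m)) x) = ract M N\<^sub>M (?s x) m"
    if "x \<in> car (?D \<otimes> M)" for m x
    by (rule lin_tensor_ext[OF lin_compose[OF tlift(1)[OF vspace_tensor b2] ls]
          lin_compose[OF ls M.lin_ract_forms] refl _ that])
      (simp add: tlift(2)[OF vspace_tensor b2] s M.ract_ract e)
  have c: "?s (\<Sum>a\<in>B. fb a \<otimes>\<^bsub>?D,M\<^esub> m a) = cocomb e' m" for m
    by (simp add: cocomb_def lin_sum[OF vspace_tensor ls] s)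
  have "is_cobein e' \<longleftrightarrow> bij_betw ?s (car (?D \<otimes> M)) (car M.\<Omega>)"
    unfolding cobein_def module_iso_def using l x ls lm by blast
  also have "\<dots> \<longleftrightarrow> bij_betw (cocomb e') (B \<rightarrow>\<^sub>E UNIV) (car M.\<Omega>)"
    using bij_betw_comp_iff[OF Db.bij_tensor_coords_left[OF M.vspace], of ?s "car M.\<Omega>"]
    by (simp add: comp_def c M.car_UNIV)
  finally show ?thesis .
qed

section \<open>Comodule maps from \<open>V\<close> to \<open>P\<close>\<close>

lemma bilin_ED: "lin V P \<phi> \<Longrightarrow> bilin V H (P \<otimes> H) (\<lambda>v0 v1. \<phi> v0 \<otimes>\<^bsub>P,H\<^esub> v1)"
  by (intro lin_intros; simp add: lin_mem[of V P \<phi>])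

lemma car_ED: "\<phi> \<in> car ED \<longleftrightarrow> lin V P \<phi> \<and> (\<forall>b\<in>B. coactP (\<phi> b) = (\<Sum>a\<in>B. \<phi> a \<otimes>\<^bsub>P,H\<^esub> r a b))"
proof -
  have "(\<forall>v. coactP (\<phi> v) = tlift V H (P \<otimes> H) (\<lambda>v0 v1. \<phi> v0 \<otimes>\<^bsub>P,H\<^esub> v1) (\<rho> v))
      \<longleftrightarrow> (\<forall>b\<in>B. coactP (\<phi> b) = (\<Sum>a\<in>B. \<phi> a \<otimes>\<^bsub>P,H\<^esub> r a b))" if l: "lin V P \<phi>"
  proof -
    note t = tlift_coaction[OF vspace_tensor bilin_ED[OF l]]
    have "coactP (\<phi> v) = tlift V H (P \<otimes> H) (\<lambda>v0 v1. \<phi> v0 \<otimes>\<^bsub>P,H\<^esub> v1) (\<rho> v)"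
      if "\<forall>b\<in>B. coactP (\<phi> b) = (\<Sum>a\<in>B. \<phi> a \<otimes>\<^bsub>P,H\<^esub> r a b)" for v
      by (rule Vb.lin_basis_ext[OF lin_compose[OF l lin_coactP]
            lin_compose[OF V.lin_coaction tlift(1)[OF vspace_tensor bilin_ED[OF l]]]])
        (simp_all add: t that)
    then show ?thesis by (auto simp: t)
  qed
  then show ?thesis by (auto simp: E_dual_space_def)
qed

text \<open>The comodule map into the cofree comodule \<open>P\<close> that corresponds to the
  linear map from \<open>V\<close> to \<open>M\<close> with value \<open>m a\<close> at each basis
  vector \<open>a\<close>; this linear extension is the inner sum.\<close>

definition ED_param :: "('v \<Rightarrow> 'm) \<Rightarrow> 'v \<Rightarrow> ('k, 'm, 'h) tens" where
  "ED_param m v = tlift V H P (\<lambda>v0 h. (\<Sum>a\<in>B. scl M (fb a v0) (m a)) \<bullet> h) (\<rho> v)"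

lemma
  shows lin_ED_param: "lin V P (ED_param m)"
    and ED_param_basis: "ED_param m b = (\<Sum>a\<in>B. m a \<bullet> r a b)"
proof -
  have b: "bilin V H P (\<lambda>v0 h. (\<Sum>a\<in>B. scl M (fb a v0) (m a)) \<bullet> h)"
    by (intro bilinI lin_tns_left lin_tns_right lin_sum_pointwise lin_scl_left lin_fb lin_id) simp_all
  show "lin V P (ED_param m)"
    unfolding ED_param_def by (rule lin_compose[OF V.lin_coaction tlift(1)[OF vspace_tensor b]])
  have "(\<Sum>a\<in>B. scl M (fb a c) (m a)) = (\<Sum>a\<in>B. if a = c then m a else 0)" if "c \<in> B" for c
    by (intro sum.cong refl) (simp add: fb_basis that vspace_scl_one vspace_zero_scl)
  then show "ED_param m b = (\<Sum>a\<in>B. m a \<bullet> r a b)"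
    by (simp add: ED_param_def tlift_coaction[OF vspace_tensor b] delta)
qed

lemma ED_param_mem: "ED_param m \<in> car ED"
proof -
  have b: "bilin H H (P \<otimes> H) (\<lambda>x y. (m a \<bullet> x) \<otimes>\<^bsub>P,H\<^esub> y)" for a
    by (intro lin_intros; simp)
  have "coactP (ED_param m b) = (\<Sum>c\<in>B. ED_param m c \<otimes>\<^bsub>P,H\<^esub> r c b)" for b
  proof -
    have "coactP (ED_param m b) = (\<Sum>a\<in>B. \<Sum>c\<in>B. (m a \<bullet> r a c) \<otimes>\<^bsub>P,H\<^esub> r c b)"
      by (simp add: ED_param_basis lin_sum[OF vspace_tensor lin_coactP] coactP_tns
          sw_r[OF _ vspace_tensor b])
    also have "\<dots> = (\<Sum>c\<in>B. ED_param m c \<otimes>\<^bsub>P,H\<^esub> r c b)"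
      by (subst sum.swap)
        (simp add: ED_param_basis lin_sum[OF vspace_tensor bilin_left[OF bilin_tns[of P H]]])
    finally show ?thesis .
  qed
  then show ?thesis by (simp add: car_ED lin_ED_param)
qed

lemma fibre_counit_ED_param:
  assumes "b \<in> B"
  shows "fibre_counit (ED_param m b) = m b"
proof -
  have "fibre_counit (ED_param m b) = (\<Sum>a\<in>B. if a = b then m a else 0)"
    unfolding ED_param_basis
    by (simp add: lin_sum[OF vspace_tensor lin_fibre_counit] fibre_counit_tns counit_r assms
        vspace_scl_one vspace_zero_scl if_distrib[of "\<lambda>c. scl M c _"] cong: if_cong)
  then show ?thesis by (simp add: delta assms)
qed

text \<open>\<open>P\<close> is cofree over \<open>M\<close>: the map \<open>L\<close>, which
  applies the fibre counit to the first leg, is a left inverse of the coaction. Applied to the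
  equivariance equation it gives the expansion.\<close>

lemma ED_basis:
  assumes \<phi>: "\<phi> \<in> car ED" and b: "b \<in> B"
  shows "\<phi> b = (\<Sum>a\<in>B. fibre_counit (\<phi> a) \<bullet> r a b)"
proof -
  have l: "lin V P \<phi>" and eq: "coactP (\<phi> b) = (\<Sum>a\<in>B. \<phi> a \<otimes>\<^bsub>P,H\<^esub> r a b)"
    using assms by (auto simp: car_ED)
  note mem = lin_mem[OF l mem_V]
  define L where "L = tlift P H P (\<lambda>p h. fibre_counit p \<bullet> h)"
  have bL: "bilin P H P (\<lambda>p h. fibre_counit p \<bullet> h)"
    by (intro bilinI lin_tns_left lin_tns_right lin_fibre_counit lin_id vspace_tensor) simp_all
  note lL = tlift(1)[OF vspace_tensor bL, folded L_def] and L = tlift(2)[OF vspace_tensor bL, folded L_def]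
  have "L (coactP p) = p" if "p \<in> car P" for p
  proof (rule lin_tensor_ext[OF lin_compose[OF lin_coactP lL] lin_id refl _ that])
    fix m g
    note lm = bilin_right[OF bilin_tns M.mem_car, of H m]
    have "L (coactP (m \<bullet> g)) = sw g (\<lambda>x y. scl M (\<epsilon> x) m \<bullet> y)"
      by (simp add: coactP_tns lin_tsum[OF lL] L fibre_counit_tns)
    also have "\<dots> = sw g (\<lambda>x y. m \<bullet> scl H (\<epsilon> x) y)"
      using lin_scl[OF lm] by (simp add: scl_tns[symmetric])
    finally show "L (coactP (m \<bullet> g)) = m \<bullet> g"
      by (simp add: lin_tsum_H[OF lm] sw_counit_left)
  qed
  from this[OF mem, of b] show ?thesis
    by (simp add: eq lin_sum[OF vspace_tensor lL] mem L)
qed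

lemma bij_ED_param: "bij_betw ED_param (B \<rightarrow>\<^sub>E UNIV) (car ED)"
proof (rule bij_betw_byWitness[where f' = "\<lambda>\<phi>. restrict (\<lambda>b. fibre_counit (\<phi> b)) B"])
  show "\<forall>m\<in>B \<rightarrow>\<^sub>E UNIV. restrict (\<lambda>b. fibre_counit (ED_param m b)) B = m"
    by (intro ballI extensionalityI[where A = B]) (auto simp: fibre_counit_ED_param PiE_def)
  show "\<forall>\<phi>\<in>car ED. ED_param (restrict (\<lambda>b. fibre_counit (\<phi> b)) B) = \<phi>"
  proof
    fix \<phi> assume \<phi>: "\<phi> \<in> car ED"
    then have l: "lin V P \<phi>" by (simp add: car_ED)
    show "ED_param (restrict (\<lambda>b. fibre_counit (\<phi> b)) B) = \<phi>"
      by (rule HOL.ext, rule Vb.lin_basis_ext[OF lin_ED_param l refl])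
        (simp_all add: ED_param_basis ED_basis[OF \<phi>, symmetric])
  qed
qed (auto simp: ED_param_mem)

lemma cocomb_mem: "lin (dual V) M.\<Omega> e' \<Longrightarrow> cocomb e' m \<in> car M.\<Omega>"
  unfolding cocomb_def by (intro vspace_sum M.vspace_forms M.ract_forms) (simp add: lin_mem[of "dual V" M.\<Omega> e'])

lemma coframing_iff:
  assumes l: "lin (dual V) M.\<Omega> e'"
  shows "is_coframing (to_coframing e') \<longleftrightarrow> bij_betw (cocomb e') (B \<rightarrow>\<^sub>E UNIV) (car M.\<Omega>)"
proof -
  let ?\<theta> = "to_coframing e'" and ?D = "dual V"
  let ?s = "\<lambda>\<phi>. \<Sum>b\<in>B. ractP (?\<theta> (fb b)) (\<phi> b)"
  note e = lin_mem[OF l fb_mem] and e' = form_mem[OF lin_mem[OF l fb_mem]]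
  note app = to_coframing_apply[OF l]
  have lin\<theta>: "lin ?D ext_space ?\<theta>"
    by (subst lin_cong[OF vspace_dual app]) (auto intro: Dc.lin_induced_ext_space l)
  have lin\<theta>': "lin ?D PN ?\<theta>" by (rule lin_weaken[OF lin\<theta> ext_space_subset]) simp
  have \<theta>: "?\<theta> (fb b) \<in> car ext_space" and \<theta>': "?\<theta> (fb b) \<in> car PN" for b
    using lin_mem[OF lin\<theta> fb_mem] lin_mem[OF lin\<theta>' fb_mem] .
  \<comment> \<open>The entries of \<open>t\<close> are kept in the second fibre leg, so that right
    multiplication by \<open>r a b\<close> produces the products in the order of
    \<open>sum_t_r\<close>.\<close>
  have basis: "?\<theta> (fb b) = (\<Sum>c\<in>B. ext (e' (fb c)) 1 (t b c))" if "b \<in> B" for b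
  proof -
    have "ext (e' (fb c)) (t b c) 1 = ext (e' (fb c)) 1 (t b c)" for c
      using ext_mult_right[OF e, where h = "t b c" and h' = 1] by simp
    then show ?thesis by (simp add: app Dc.induced_basis[OF l that])
  qed
  have equi: "\<forall>w\<in>car ?D. coact (?\<theta> w) = tlift ?D H (PN \<otimes> H) (\<lambda>w0 w1. ?\<theta> w0 \<otimes>\<^bsub>PN,H\<^esub> w1) (coactD w)"
    using Dc.induced_equivariant[OF l]
    unfolding Dc.equivariant_iff_basis[OF lin\<theta>'] Dc.equivariant_iff_basis[OF Dc.lin_induced[OF l]]
    by (simp add: app)
  have s_param: "?s (ED_param m) = incl (cocomb e' m)" for m
  proof -
    note ra = form_mem[OF M.ract_forms[OF e]]
    have "?s (ED_param m) = (\<Sum>b\<in>B. \<Sum>a\<in>B. \<Sum>c\<in>B. ractP (ext (e' (fb c)) 1 (t b c)) (m a \<bullet> r a b))"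
      by (simp add: ED_param_basis lin_sum[OF vspace_tensor lin_ractP_param] \<theta>'
          basis[symmetric] lin_sum[OF vspace_PN lin_ractP, symmetric] ext_mem e')
    also have "\<dots> = (\<Sum>a\<in>B. \<Sum>c\<in>B. ext (ract M N\<^sub>M (e' (fb c)) (m a)) 1 (\<Sum>b\<in>B. t b c * r a b))"
      by (subst sum_rotate3) (simp add: ractP_ext e' lin_sum[OF vspace lin_ext_right] ra)
    also have "\<dots> = (\<Sum>a\<in>B. \<Sum>c\<in>B. if a = c then incl (ract M N\<^sub>M (e' (fb c)) (m a)) else 0)"
      by (intro sum.cong refl) (simp add: sum_t_r lin_zero[OF vspace lin_ext_right] ra)
    also have "\<dots> = incl (cocomb e' m)"
      unfolding cocomb_def by (simp add: delta lin_sum[OF M.vspace_AA_N lin_ext] ra)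
    finally show ?thesis .
  qed
  have ED_P: "\<phi> v \<in> car P" if "\<phi> \<in> car ED" for \<phi> v
    using that lin_mem[of V P \<phi>] by (simp add: car_ED)
  have mod: "?s (\<lambda>v. tmult M H (\<phi> v) (m \<bullet> 1)) = ractP (?s \<phi>) (m \<bullet> 1)" if "\<phi> \<in> car ED" for m \<phi>
    by (simp add: ractP_tmult \<theta> \<theta>' ED_P that lin_sum[OF vspace_PN lin_ractP] ractP_mem)
  have range: "?s \<phi> \<in> car base" if "\<phi> \<in> car ED" for \<phi>
  proof -
    have "\<phi> \<in> ED_param ` (B \<rightarrow>\<^sub>E UNIV)" using that by (simp only: bij_betw_imp_surj_on[OF bij_ED_param])
    then obtain m where "\<phi> = ED_param m" by (rule imageE)
    then show ?thesis by (simp add: s_param car_base_forms cocomb_mem l)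
  qed
  have "lin ED base ?s"
  proof (rule linI)
    fix \<phi> \<psi> assume "\<phi> \<in> car ED" "\<psi> \<in> car ED"
    then show "?s (\<phi> + \<psi>) = ?s \<phi> + ?s \<psi>"
      by (simp add: plus_fun_apply lin_add[OF lin_ractP_param] \<theta>' ED_P sum.distrib)
  next
    fix c \<phi> assume \<phi>: "\<phi> \<in> car ED"
    have "scl ED c \<phi> v = scl P c (\<phi> v)" for v by (simp add: E_dual_space_def)
    then show "?s (scl ED c \<phi>) = scl base c (?s \<phi>)"
      by (simp add: lin_scl[OF lin_ractP_param, simplified] \<theta>' ED_P \<phi> scl_base_forms
          vspace_scl_sum[OF vspace_base, unfolded scl_base_forms])
  qed (rule range)
  then have "is_coframing ?\<theta> \<longleftrightarrow> bij_betw ?s (car ED) (car base)"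
    unfolding coframing_def module_iso_def forms_P_eq
    using lin\<theta> equi mod by (simp add: coframing_of_cobein_def)
  also have "\<dots> \<longleftrightarrow> bij_betw (incl \<circ> cocomb e') (B \<rightarrow>\<^sub>E UNIV) (car base)"
    using bij_betw_comp_iff[OF bij_ED_param, of ?s "car base"] by (simp add: comp_def s_param)
  also have "\<dots> \<longleftrightarrow> bij_betw (cocomb e') (B \<rightarrow>\<^sub>E UNIV) (car M.\<Omega>)"
    using bij_betw_comp_iff2[OF bij_incl image_subsetI, of "B \<rightarrow>\<^sub>E UNIV" "cocomb e'"]
    by (simp add: car_base_forms cocomb_mem l)
  finally show ?thesis .
qed

text \<open>As for framings; the inverse is restricted because cobeins and coframings are
  extensional on \<open>dual V\<close>.\<close>

lemma bij_to_coframing: "bij_betw to_coframing {e'. is_cobein e'} {\<theta>'. is_coframing \<theta>'}"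
proof (rule bij_betw_byWitness[where f' = "\<lambda>\<theta>'. restrict (\<lambda>w. retract (\<theta>' w)) (car (dual V))"])
  let ?D = "dual V"
  let ?r = "\<lambda>\<theta>'. restrict (\<lambda>w. retract (\<theta>' w)) (car ?D)"
  have lin: "lin ?D M.\<Omega> e'" and extn: "e' \<in> extensional (car ?D)" if "is_cobein e'" for e'
    using that by (simp_all add: cobein_def)
  show "\<forall>e'\<in>{e'. is_cobein e'}. ?r (to_coframing e') = e'"
    by (auto intro!: extensionalityI[where A = "car ?D"] simp: to_coframing_apply Dc.retract_induced lin extn)
  have equi: "lin ?D ext_space \<theta>'"
      "\<forall>w\<in>car ?D. coact (\<theta>' w) = tlift ?D H (PN \<otimes> H) (\<lambda>w0 w1. \<theta>' w0 \<otimes>\<^bsub>PN,H\<^esub> w1) (coactD w)"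
    and extn': "\<theta>' \<in> extensional (car ?D)" if "is_coframing \<theta>'" for \<theta>'
    using that by (simp_all add: coframing_def forms_P_eq)
  have l: "lin ?D M.\<Omega> (?r \<theta>')" if "is_coframing \<theta>'" for \<theta>'
    by (subst lin_cong[OF vspace_dual, where g = "\<lambda>w. retract (\<theta>' w)"])
      (simp_all add: Dc.lin_retract_equivariant[OF equi] that)
  have inverse: "to_coframing (?r \<theta>') = \<theta>'" if \<theta>': "is_coframing \<theta>'" for \<theta>'
  proof (rule extensionalityI[where A = "car ?D"])
    fix w assume w: "w \<in> car ?D"
    note ll = Dc.lin_retract_equivariant[OF equi[OF \<theta>']]
    \<comment> \<open>Restriction leaves the values on the dual basis unchanged, and these determine
      the induced map.\<close>
    have "Dc.induced (?r \<theta>') w = Dc.induced (\<lambda>w. retract (\<theta>' w)) w"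
      by (rule Db.lin_basis_ext[OF Dc.lin_induced[OF l[OF \<theta>']] Dc.lin_induced[OF ll] refl _ w])
        (simp add: Dc.induced_basis[OF l[OF \<theta>']] Dc.induced_basis[OF ll])
    then show "to_coframing (?r \<theta>') w = \<theta>' w"
      by (simp add: to_coframing_apply l \<theta>' w Dc.induced_retract[OF equi[OF \<theta>']])
  qed (simp_all add: coframing_of_cobein_def extn' \<theta>')
  then show "\<forall>\<theta>'\<in>{\<theta>'. is_coframing \<theta>'}. to_coframing (?r \<theta>') = \<theta>'" by simp
  show "to_coframing ` {e'. is_cobein e'} \<subseteq> {\<theta>'. is_coframing \<theta>'}"
    using lin extn cobein_iff coframing_iff by auto
  show "?r ` {\<theta>'. is_coframing \<theta>'} \<subseteq> {e'. is_cobein e'}"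
  proof clarify
    fix \<theta>' assume \<theta>': "is_coframing \<theta>'"
    then have "is_coframing (to_coframing (?r \<theta>'))" by (simp add: inverse)
    then show "is_cobein (?r \<theta>')"
      using cobein_iff[OF l[OF \<theta>']] coframing_iff[OF l[OF \<theta>']] by simp
  qed
qed

subsection \<open>The quantum metric\<close>

text \<open>\<open>retract\<close> is a module map along \<open>fibre_counit\<close>, since
  \<epsilon> is multiplicative. Together with its left-handed counterpart this lets the retraction
  of both factors descend from the tensor product over \<open>P\<close> to that over
  \<open>M\<close>.\<close>

lemma retract_ractP:
  assumes \<zeta>: "\<zeta> \<in> car ext_space" and p: "p \<in> car P"
  shows "retract (ractP \<zeta> p) = ract M N\<^sub>M (retract \<zeta>) (fibre_counit p)"
proof -
  have \<zeta>': "\<zeta> \<in> car PN" using \<zeta> ext_space_subset by blast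
  have "lin P M.AA_N (\<lambda>p. ract M N\<^sub>M (retract \<zeta>) (fibre_counit p))"
    by (rule lin_weaken[OF lin_compose[OF lin_fibre_counit M.lin_ract_param[OF retract_mem[OF \<zeta>]]] M.forms_subset])
      simp
  then show ?thesis
  proof (rule lin_tensor_ext[OF lin_compose[OF lin_ractP_param[OF \<zeta>'] lin_retract] _ refl _ p])
    fix m g
    show "retract (ractP \<zeta> (m \<bullet> g)) = ract M N\<^sub>M (retract \<zeta>) (fibre_counit (m \<bullet> g))"
    proof (rule lin_ext_space_ext[OF lin_compose[OF lin_ractP lin_retract]
          lin_compose[OF lin_retract M.lin_ract] M.vspace_AA_N _ \<zeta>])
      fix \<omega> h assume \<omega>: "\<omega> \<in> car M.\<Omega>"
      show "retract (ractP (ext \<omega> h 1) (m \<bullet> g))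
          = ract M N\<^sub>M (retract (ext \<omega> h 1)) (fibre_counit (m \<bullet> g))"
        using lin_scl[OF M.lin_ract_forms \<omega>] lin_scl[OF M.lin_ract_param[OF vspace_scl[OF M.vspace_forms \<omega>]]]
          vspace_scl_scl[OF M.vspace_forms]
        by (simp add: ractP_ext form_mem \<omega> M.ract_forms retract_ext fibre_counit_tns counit_one mult.commute)
    qed (simp)
  qed
qed

lemma retract_lactP:
  assumes \<zeta>: "\<zeta> \<in> car ext_space" and p: "p \<in> car P"
  shows "retract (lactP p \<zeta>) = lact M N\<^sub>M (fibre_counit p) (retract \<zeta>)"
proof -
  have \<zeta>': "\<zeta> \<in> car PN" using \<zeta> ext_space_subset by blast
  have "lin P M.AA_N (\<lambda>p. lact M N\<^sub>M (fibre_counit p) (retract \<zeta>))"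
    by (rule lin_weaken[OF lin_compose[OF lin_fibre_counit M.lin_lact_param[OF retract_mem[OF \<zeta>]]] M.forms_subset])
      simp
  then show ?thesis
  proof (rule lin_tensor_ext[OF lin_compose[OF lin_lactP_param[OF \<zeta>'] lin_retract] _ refl _ p])
    fix m g
    show "retract (lactP (m \<bullet> g) \<zeta>) = lact M N\<^sub>M (fibre_counit (m \<bullet> g)) (retract \<zeta>)"
    proof (rule lin_ext_space_ext[OF lin_compose[OF lin_lactP lin_retract]
          lin_compose[OF lin_retract M.lin_lact] M.vspace_AA_N _ \<zeta>])
      fix \<omega> h assume \<omega>: "\<omega> \<in> car M.\<Omega>"
      show "retract (lactP (m \<bullet> g) (ext \<omega> h 1))
          = lact M N\<^sub>M (fibre_counit (m \<bullet> g)) (retract (ext \<omega> h 1))"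
        using lin_scl[OF M.lin_lact_forms \<omega>] lin_scl[OF M.lin_lact_param[OF vspace_scl[OF M.vspace_forms \<omega>]]]
          vspace_scl_scl[OF M.vspace_forms]
        by (simp add: lactP_ext form_mem \<omega> M.lact_forms retract_ext fibre_counit_tns counit_mult counit_one)
    qed (simp)
  qed
qed

abbreviation "tensor_M \<equiv> btensor UNIV M.\<Omega> (ract M N\<^sub>M) M.\<Omega> (lact M N\<^sub>M)"
abbreviation "tns_M \<equiv> btns UNIV M.\<Omega> (ract M N\<^sub>M) M.\<Omega> (lact M N\<^sub>M)"
abbreviation "tensor_P \<equiv> btensor (car P) ext_space ractP ext_space lactP"
abbreviation "tns_P \<equiv> btns (car P) ext_space ractP ext_space lactP"

text \<open>The map occurring in \<open>quantum_metric\<close>, with \<open>forms_P\<close> and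
  \<open>P_forms\<close> already replaced by \<open>ext_space\<close>.\<close>

definition metric_map where
  "metric_map = qlift (M.\<Omega> \<otimes> M.\<Omega>) (balancing UNIV M.\<Omega> (ract M N\<^sub>M) M.\<Omega> (lact M N\<^sub>M)) tensor_P
     (tlift M.\<Omega> M.\<Omega> tensor_P (\<lambda>\<omega> \<eta>. tns_P (incl \<omega>) (incl \<eta>)))"

lemma incl_mem: "\<omega> \<in> car M.\<Omega> \<Longrightarrow> incl \<omega> \<in> car ext_space"
  by (rule ext_in_ext_space)

lemma lin_incl: "lin M.\<Omega> ext_space incl"
  using lin_restrict_dom[OF lin_ext M.forms_subset] incl_mem by (auto simp: lin_def)

lemma
  shows lin_metric_map: "lin tensor_M tensor_P metric_map"
    and metric_map_tns: "\<omega> \<in> car M.\<Omega> \<Longrightarrow> \<eta> \<in> car M.\<Omega> \<Longrightarrow> metric_map (tns_M \<omega> \<eta>) = tns_P (incl \<omega>) (incl \<eta>)"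
proof -
  have b: "bilin M.\<Omega> M.\<Omega> tensor_P (\<lambda>\<omega> \<eta>. tns_P (incl \<omega>) (incl \<eta>))"
    by (intro bilinI lin_bilin_left[OF bilin_btns] lin_bilin_right[OF bilin_btns] lin_incl incl_mem)
  note l = tlift(1)[OF vspace_btensor b] and t = tlift(2)[OF vspace_btensor b]
  have z: "tlift M.\<Omega> M.\<Omega> tensor_P (\<lambda>\<omega> \<eta>. tns_P (incl \<omega>) (incl \<eta>)) n = 0"
    if "n \<in> balancing UNIV M.\<Omega> (ract M N\<^sub>M) M.\<Omega> (lact M N\<^sub>M)" for n
  proof (rule balancing_vanish[OF l vspace_btensor that])
    fix \<omega> a \<eta> assume \<omega>: "\<omega> \<in> car M.\<Omega>" and \<eta>: "\<eta> \<in> car M.\<Omega>"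
    have a: "a \<bullet> 1 \<in> car P" by (simp)
    \<comment> \<open>Balancing over \<open>M\<close> is the special case
      \<open>a \<bullet> 1\<close> of balancing over \<open>P\<close>.\<close>
    have 1: "incl (ract M N\<^sub>M \<omega> a) = ractP (incl \<omega>) (a \<bullet> 1)"
      and 2: "incl (lact M N\<^sub>M a \<eta>) = lactP (a \<bullet> 1) (incl \<eta>)"
      by (simp_all add: ractP_ext lactP_ext form_mem \<omega> \<eta>)
    have "tns_P (incl (ract M N\<^sub>M \<omega> a)) (incl \<eta>) = tns_P (incl \<omega>) (incl (lact M N\<^sub>M a \<eta>))"
      unfolding 1 2 by (intro btns_balanced incl_mem \<omega> \<eta> a ractP_ext_space lactP_ext_space)
    then show "tlift M.\<Omega> M.\<Omega> tensor_P (\<lambda>\<omega> \<eta>. tns_P (incl \<omega>) (incl \<eta>)) (ract M N\<^sub>M \<omega> a \<otimes>\<^bsub>M.\<Omega>,M.\<Omega>\<^esub> \<eta>)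
        = tlift M.\<Omega> M.\<Omega> tensor_P (\<lambda>\<omega> \<eta>. tns_P (incl \<omega>) (incl \<eta>)) (\<omega> \<otimes>\<^bsub>M.\<Omega>,M.\<Omega>\<^esub> lact M N\<^sub>M a \<eta>)"
      by (simp add: t \<omega> \<eta> M.ract_forms M.lact_forms)
  qed (simp_all add: M.ract_forms M.lact_forms)
  show "lin tensor_M tensor_P metric_map"
    unfolding metric_map_def btensor_def[of UNIV] by (rule qlift(1)[OF vspace_tensor vspace_btensor l z])
  show "metric_map (tns_M \<omega> \<eta>) = tns_P (incl \<omega>) (incl \<eta>)" if "\<omega> \<in> car M.\<Omega>" "\<eta> \<in> car M.\<Omega>" for \<omega> \<eta>
    unfolding metric_map_def btns_def[of UNIV]
    by (subst qlift(2)[OF vspace_tensor vspace_btensor l z]) (simp_all add: that t)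
qed

lemma metric_map_inj:
  assumes "g \<in> car tensor_M" "g' \<in> car tensor_M" "metric_map g = metric_map g'"
  shows "g = g'"
proof -
  let ?f = "\<lambda>\<zeta> \<xi>. tns_M (retract \<zeta>) (retract \<xi>)"
  let ?bal = "balancing (car P) ext_space ractP ext_space lactP"
  have b: "bilin ext_space ext_space tensor_M ?f"
    by (intro bilinI lin_bilin_left[OF bilin_btns] lin_bilin_right[OF bilin_btns] lin_retract_ext_space retract_mem)
  note l = tlift(1)[OF vspace_btensor b] and t = tlift(2)[OF vspace_btensor b]
  have z: "tlift ext_space ext_space tensor_M ?f n = 0" if "n \<in> ?bal" for n
  proof (rule balancing_vanish[OF l vspace_btensor that])
    fix \<zeta> p \<xi> assume "\<zeta> \<in> car ext_space" "p \<in> car P" "\<xi> \<in> car ext_space"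
    then show "tlift ext_space ext_space tensor_M ?f (ractP \<zeta> p \<otimes>\<^bsub>ext_space,ext_space\<^esub> \<xi>)
        = tlift ext_space ext_space tensor_M ?f (\<zeta> \<otimes>\<^bsub>ext_space,ext_space\<^esub> lactP p \<xi>)"
      by (simp add: t ractP_ext_space lactP_ext_space retract_ractP retract_lactP btns_balanced
          retract_mem M.ract_forms M.lact_forms)
  qed (simp_all add: ractP_ext_space lactP_ext_space)
  define R where "R = qlift (ext_space \<otimes> ext_space) ?bal tensor_M (tlift ext_space ext_space tensor_M ?f)"
  have lR: "lin tensor_P tensor_M R"
    unfolding R_def btensor_def[of "car P"] by (rule qlift(1)[OF vspace_tensor vspace_btensor l z])
  have R: "R (tns_P \<zeta> \<xi>) = ?f \<zeta> \<xi>" if "\<zeta> \<in> car ext_space" "\<xi> \<in> car ext_space" for \<zeta> \<xi>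
    unfolding R_def btns_def[of "car P"]
    by (subst qlift(2)[OF vspace_tensor vspace_btensor l z]) (simp_all add: that t)
  have inv: "R (metric_map x) = x" if x: "x \<in> car tensor_M" for x
  proof -
    obtain y where y: "y \<in> car (M.\<Omega> \<otimes> M.\<Omega>)"
        "x = qcls (M.\<Omega> \<otimes> M.\<Omega>) (balancing UNIV M.\<Omega> (ract M N\<^sub>M) M.\<Omega> (lact M N\<^sub>M)) y"
      using x by (auto simp: btensor_def car_quot)
    have lq: "lin (M.\<Omega> \<otimes> M.\<Omega>) tensor_M (qcls (M.\<Omega> \<otimes> M.\<Omega>) (balancing UNIV M.\<Omega> (ract M N\<^sub>M) M.\<Omega> (lact M N\<^sub>M)))"
      unfolding btensor_def by (rule lin_qcls)
    show ?thesis
      unfolding y(2)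
      by (rule lin_tensor_ext[OF lin_compose[OF lin_compose[OF lq lin_metric_map] lR] lq refl _ y(1)])
        (simp add: metric_map_tns R incl_mem retract_incl form_mem flip: btns_def)
  qed
  have "g = R (metric_map g)" by (rule inv[OF assms(1), symmetric])
  also have "\<dots> = R (metric_map g')" by (simp only: assms(3))
  also have "\<dots> = g'" by (rule inv[OF assms(2)])
  finally show ?thesis .
qed

text \<open>The fibre element of the first factor is the right action of
  \<open>1 \<bullet> h\<close>, which balancing carries over to the left action on the second
  factor.\<close>

lemma tns_P_ext:
  assumes "\<omega> \<in> car M.\<Omega>" "\<eta> \<in> car M.\<Omega>"
  shows "tns_P (ext \<omega> h 1) (ext \<eta> g 1) = tns_P (incl \<omega>) (ext \<eta> (h * g) 1)"
proof -
  have h: "1 \<bullet> h \<in> car P" by (simp)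
  have "ext \<omega> h 1 = ractP (incl \<omega>) (1 \<bullet> h)" by (simp add: ractP_incl assms M.ract_one)
  moreover have "ext \<eta> (h * g) 1 = lactP (1 \<bullet> h) (ext \<eta> g 1)"
    by (simp add: lactP_ext form_mem assms M.lact_one)
  ultimately show ?thesis
    using btns_balanced[of "incl \<omega>" ext_space "1 \<bullet> h" "car P" "ext \<eta> g 1" ext_space ractP lactP]
    by (simp add: h incl_mem assms ext_in_ext_space ractP_ext_space lactP_ext_space)
qed

text \<open>Moving all fibre elements into the second factor brings t b c and r a b together, and
  the sum over \<open>b\<close> removes both. As \<open>quantum_metric\<close> is a predicate, the
  equation for \<open>g\<close> also needs uniqueness, which is
  \<open>metric_map_inj\<close>.\<close>

lemma quantum_metric_iff:
  assumes e: "is_bein e" and e': "is_cobein e'"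
  shows "quantum_metric M N\<^sub>M H \<Delta> Q V B (to_framing e) (to_coframing e') g
    \<longleftrightarrow> g = (\<Sum>b\<in>B. base_tns M N\<^sub>M (e' (fb b)) (e b))"
proof -
  have le: "lin V M.\<Omega> e" and le': "lin (dual V) M.\<Omega> e'"
    using e e' by (simp_all add: bein_def cobein_def)
  note m = lin_mem[OF le mem_V] and m' = lin_mem[OF le' fb_mem]
  let ?g = "\<Sum>b\<in>B. tns_M (e' (fb b)) (e b)"
  have g: "?g \<in> car tensor_M"
    by (intro vspace_sum vspace_btensor bilin_mem[OF bilin_btns] m m')
  have "(\<Sum>b\<in>B. tns_P (to_coframing e' (fb b)) (to_framing e b))
      = (\<Sum>b\<in>B. \<Sum>c\<in>B. \<Sum>a\<in>B. tns_P (ext (e' (fb c)) (t b c) 1) (ext (e a) (r a b) 1))"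
  proof (intro sum.cong refl)
    fix b assume b: "b \<in> B"
    have "tns_P (to_coframing e' (fb b)) (to_framing e b)
        = tns_P (\<Sum>c\<in>B. ext (e' (fb c)) (t b c) 1) (\<Sum>a\<in>B. ext (e a) (r a b) 1)"
      by (simp add: to_coframing_apply[OF le'] Dc.induced_basis[OF le' b] to_framing_basis[OF le b])
    also have "\<dots> = (\<Sum>c\<in>B. tns_P (ext (e' (fb c)) (t b c) 1) (\<Sum>a\<in>B. ext (e a) (r a b) 1))"
      by (rule lin_sum[OF vspace_ext_space bilin_left[OF bilin_btns]])
        (intro vspace_sum vspace_ext_space ext_in_ext_space m m')+
    also have "\<dots> = (\<Sum>c\<in>B. \<Sum>a\<in>B. tns_P (ext (e' (fb c)) (t b c) 1) (ext (e a) (r a b) 1))"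
      by (intro sum.cong refl lin_sum[OF vspace_ext_space bilin_right[OF bilin_btns]] ext_in_ext_space m m')
    finally show "tns_P (to_coframing e' (fb b)) (to_framing e b)
        = (\<Sum>c\<in>B. \<Sum>a\<in>B. tns_P (ext (e' (fb c)) (t b c) 1) (ext (e a) (r a b) 1))" .
  qed
  also have "\<dots> = (\<Sum>c\<in>B. \<Sum>a\<in>B. \<Sum>b\<in>B. tns_P (incl (e' (fb c))) (ext (e a) (t b c * r a b) 1))"
    by (subst sum_rotate3) (intro sum.cong refl tns_P_ext m m')
  also have "\<dots> = (\<Sum>c\<in>B. \<Sum>a\<in>B. tns_P (incl (e' (fb c))) (ext (e a) (\<Sum>b\<in>B. t b c * r a b) 1))"
    by (simp add: lin_sum[OF vspace lin_ext_left] m form_mem ext_in_ext_space incl_mem m'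
        lin_sum[OF vspace_ext_space bilin_right[OF bilin_btns]])
  also have "\<dots> = (\<Sum>c\<in>B. \<Sum>a\<in>B. if a = c then tns_P (incl (e' (fb c))) (incl (e a)) else 0)"
    by (intro sum.cong refl)
      (simp add: sum_t_r lin_zero[OF vspace lin_ext_left] m form_mem incl_mem m'
        lin_zero[OF vspace_ext_space bilin_right[OF bilin_btns]])
  also have "\<dots> = metric_map ?g"
    by (simp add: delta lin_sum[OF vspace_btensor lin_metric_map] bilin_mem[OF bilin_btns] m m' metric_map_tns)
  finally have T: "(\<Sum>b\<in>B. tns_P (to_coframing e' (fb b)) (to_framing e b)) = metric_map ?g" .
  have "quantum_metric M N\<^sub>M H \<Delta> Q V B (to_framing e) (to_coframing e') g
      \<longleftrightarrow> g \<in> car tensor_M \<and> metric_map g = metric_map ?g"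
    unfolding quantum_metric_def metrics_def P_forms_eq forms_P_eq T metric_map_def ..
  also have "\<dots> \<longleftrightarrow> g = ?g" using g metric_map_inj by blast
  finally show ?thesis by (simp add: base_tns_def)
qed

end

theorem proposition3p2:
  fixes M :: "('k::field, 'm::{ring, monoid_mult}) kspace"
    and N\<^sub>M :: "('k, 'm, 'm) tens set"
    and H :: "('k, 'h::ring_1) kspace"
    and \<Delta> :: "'h \<Rightarrow> ('k, 'h, 'h) tens" and \<epsilon> :: "'h \<Rightarrow> 'k" and S :: "'h \<Rightarrow> 'h"
    and Q :: "'h set"
    and V :: "('k, 'v::ab_group_add) kspace" and \<rho> :: "'v \<Rightarrow> ('k, 'v, 'h) tens"
    and B :: "'v set"
  assumes "k_algebra M" and "calculus M N\<^sub>M"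
    and "hopf_algebra H \<Delta> \<epsilon> S" and "bij S" and "bicovariant_ideal H \<Delta> \<epsilon> S Q"
    and "right_comodule H \<Delta> \<epsilon> V \<rho>" and "finite_dimensional_vector_space (scl V) B"
  shows "bij_betw (framing_of_bein M N\<^sub>M H \<Delta> Q V \<rho>)
           {e. bein M N\<^sub>M V e} {\<theta>. framing M N\<^sub>M H \<Delta> Q V \<rho> \<theta>}
       \<and> bij_betw (coframing_of_cobein M N\<^sub>M H \<Delta> S Q V \<rho>)
           {e'. cobein M N\<^sub>M V e'} {\<theta>'. coframing M N\<^sub>M H \<Delta> S Q V \<rho> B \<theta>'}
       \<and> (\<forall>e e'. bein M N\<^sub>M V e \<longrightarrow> cobein M N\<^sub>M V e' \<longrightarrow>
           (\<forall>g. quantum_metric M N\<^sub>M H \<Delta> Q V B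
                   (framing_of_bein M N\<^sub>M H \<Delta> Q V \<rho> e)
                   (coframing_of_cobein M N\<^sub>M H \<Delta> S Q V \<rho> e') g
              \<longleftrightarrow> g = (\<Sum>b\<in>B. base_tns M N\<^sub>M (e' (dual_basis V B b)) (e b))))"
proof -
  interpret bundle_comodule H \<Delta> \<epsilon> S Q M N\<^sub>M V \<rho> B
    using assms
    by (intro bundle_comodule.intro tensor_bundle.intro bicovariant_calculus.intro
        bicovariant_calculus_axioms.intro first_order_calculus.intro first_order_calculus_axioms.intro
        bundle_comodule_axioms.intro)
  show ?thesis
    using bij_to_framing bij_to_coframing quantum_metric_iff by blast
qed

end
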